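(* Let $\mathcal K$ be a simplicial complex on the vertex set $[m]=\{1,\dots,m\}$, and let $$RC_{\mathcal K}=F(a_1,\ldots,a_m)\big/\bigl(a_i^2=1\text{ for } i\in[m],\; a_ia_j=a_ja_i\text{ for }\{i,j\}\in\mathcal K\bigr)$$ be the corresponding right-angled Coxeter group. Then there is an isomorphism of $2$-Lie algebras (restricted Lie algebras) over $\mathbb Z_2$ $$\operatorname{gr}_\bullet\gamma^{[2]}(RC_{\mathcal K})\cong FL_2(u_1,\ldots,u_m)\big/\bigl(u_i^{[2]}=0\text{ for } i\in[m],\;[u_i,u_j]=0\text{ for }\{i,j\}\in\mathcal K\bigr),$$ where the left-hand side is the restricted Lie algebra associated with the lower $2$-central series of $RC_{\mathcal K}$.
   Context: $\mathbb Z_2$ is the field (or cyclic group) of residues modulo $2$. $F(a_1,\dots,a_m)$ is the free group. A simplicial complex $\mathcal K$ on $[m]$ is a collection of subsets of $[m]$ closed under taking subsets; it is assumed that $\varnothing$ and all one-element subsets belong to $\mathcal K$. A $2$-Lie algebra over $\mathbb Z_2$ is a Lie algebra $L$ over $\mathbb Z_2$ (bilinear bracket with $[x,x]=0$ and the Jacobi identity) with an operation $x\mapsto x^{[2]}$ satisfying $[x,y^{[2]}]=[[x,y],y]$, $(\alpha x)^{[2]}=\alpha^2x^{[2]}$ for $\alpha\in\mathbb Z_2$, and $(x+y)^{[2]}=x^{[2]}+y^{[2]}+[x,y]$. Homomorphisms preserve the bracket and the operation $x\mapsto x^{[2]}$. $FL_2(u_1,\ldots,u_m)$ is the free $2$-Lie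 algebra over $\mathbb Z_2$ on $u_1,\dots,u_m$ (any map of the generators to a $2$-Lie algebra extends uniquely to a homomorphism), and the quotient is by the smallest restricted ideal (Lie ideal closed under $x\mapsto x^{[2]}$) generated by the indicated relations. For a group $G$, write $(g,h)=g^{-1}h^{-1}gh$. The lower central series is $\gamma_1(G)=G$, $\gamma_k(G)=(\gamma_{k-1}(G),G)$ for $k\ge2$ (the subgroup generated by commutators). The lower $2$-central series is $$\gamma^{[2]}_k(G)=\prod_{n2^i\ge k}\bigl(\gamma_n(G)\bigr)^{2^i},\quad k\ge1,$$ where $(\gamma_n(G))^{2^i}$ is the subgroup generated by the $2^i$-th powers of elements of $\gamma_n(G)$, $n\ge1$, $i\ge0$. It is the fastest descending series of subgroups $\Gamma_1=G\supset\Gamma_2\supset\cdots$ with $(\Gamma_k,\Gamma_\ell)\subset\Gamma_{k+\ell}$ and $g^2\in\Gamma_{2k}$ for $g\in\Gamma_k$. The associated $2$-Lie algebra over $\mathbb Z_2$ is $\operatorname{gr}_\bullet\gamma^{[2]}(G)=\bigoplus_{k\ge1}\gamma^{[2]}_k(G)/\gamma^{[2]}_{k+1}(G)$, with $[\overline g_k,\overline g_\ell]=\overline{(g_k,g_\ell)}\in\operatorname{gr}_{k+\ell}$ and $(\overline g_k)^{[2]}=\overline{g_k^2}\in\operatorname{gr}_{2k}$ for $g_k\in\gamma_k^{[2]}(G)$, $g_\ell\in\gamma^{[2]}_\ell(G)$, where $\overline g_k$ denotes the class in $\gamma^{[2]}_k(G)/\gamma^{[2]}_{k+1}(G)$; on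 non-homogeneous elements the operation $x\mapsto x^{[2]}$ is extended by the sum formula above. *)

theory Defs
  imports "HOL-Algebra.QuotRing" "HOL-Algebra.Product_Groups" "HOL-Number_Theory.Residues"
begin

section \<open>Simplicial complexes\<close>

definition simplicial_complex :: "nat \<Rightarrow> nat set set \<Rightarrow> bool" where
  "simplicial_complex m K \<longleftrightarrow>
     K \<subseteq> Pow {1..m} \<and> (\<forall>I\<in>K. \<forall>J. J \<subseteq> I \<longrightarrow> J \<in> K) \<and>
     {} \<in> K \<and> (\<forall>i\<in>{1..m}. {i} \<in> K)"


section \<open>Free groups and presentations\<close>

text \<open>A word is a list of letters; \<open>(v, True)\<close> stands for the generator \<open>v\<close> and
  \<open>(v, False)\<close> for its formal inverse.\<close>

inductive word_cancel :: "('v \<times> bool) list \<Rightarrow> ('v \<times> bool) list \<Rightarrow> bool" where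
  "word_cancel (p @ [(v, b), (v, \<not> b)] @ q) (p @ q)"

definition words :: "'v set \<Rightarrow> ('v \<times> bool) list set" where
  "words V = lists (V \<times> UNIV)"

definition word_rel :: "'v set \<Rightarrow> (('v \<times> bool) list \<times> ('v \<times> bool) list) set" where
  "word_rel V = {(p, q). p \<in> words V \<and> q \<in> words V \<and> equivclp word_cancel p q}"

definition free_group :: "'v set \<Rightarrow> ('v \<times> bool) list set monoid" where
  "free_group V =
     \<lparr>carrier = words V // word_rel V,
      monoid.mult = (\<lambda>X Y. \<Union>p\<in>X. \<Union>q\<in>Y. word_rel V `` {p @ q}),
      one = word_rel V `` {[]}\<rparr>"

definition free_gen :: "'v set \<Rightarrow> 'v \<Rightarrow> ('v \<times> bool) list set" where
  "free_gen V v = word_rel V `` {[(v, True)]}"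

definition normal_closure :: "('a, 'b) monoid_scheme \<Rightarrow> 'a set \<Rightarrow> 'a set" where
  "normal_closure G R = \<Inter>{N. N \<lhd> G \<and> R \<subseteq> N}"

text \<open>The right-angled Coxeter group \<open>racg m K\<close>; a relation \<open>s = t\<close> is imposed by killing
  \<open>s t\<^sup>-\<^sup>1\<close>. The universal property of \<^const>\<open>free_group\<close> is proved below
  (\<open>free_group_universal\<close>).\<close>

definition racg_relators :: "nat \<Rightarrow> nat set set \<Rightarrow> (nat \<times> bool) list set set" where
  "racg_relators m K = (let F = free_group {1..m}; a = free_gen {1..m} in
     {a i \<otimes>\<^bsub>F\<^esub> a i | i. i \<in> {1..m}} \<union>
     {(a i \<otimes>\<^bsub>F\<^esub> a j) \<otimes>\<^bsub>F\<^esub> inv\<^bsub>F\<^esub> (a j \<otimes>\<^bsub>F\<^esub> a i) | i j. {i, j} \<in> K})"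

definition racg :: "nat \<Rightarrow> nat set set \<Rightarrow> (nat \<times> bool) list set set monoid" where
  "racg m K = free_group {1..m} Mod normal_closure (free_group {1..m}) (racg_relators m K)"


section \<open>2-Lie algebras\<close>

abbreviation F2 :: "int ring" where
  "F2 \<equiv> residue_ring 2"

text \<open>The multiplicative fields \<open>mult\<close> and \<open>one\<close> inherited from the library's record of
  modules play no role.\<close>

record 'a two_lie = "(int, 'a) module" +
  bracket :: "'a \<Rightarrow> 'a \<Rightarrow> 'a"
  sq :: "'a \<Rightarrow> 'a"

locale two_lie_algebra = module "residue_ring 2" L for L :: "('a, 'c) two_lie_scheme" (structure) +
  assumes bracket_closed:
      "\<lbrakk>x \<in> carrier L; y \<in> carrier L\<rbrakk> \<Longrightarrow> bracket L x y \<in> carrier L"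
    and bracket_add_left:
      "\<lbrakk>x \<in> carrier L; y \<in> carrier L; z \<in> carrier L\<rbrakk> \<Longrightarrow>
        bracket L (x \<oplus>\<^bsub>L\<^esub> y) z = bracket L x z \<oplus>\<^bsub>L\<^esub> bracket L y z"
    and bracket_add_right:
      "\<lbrakk>x \<in> carrier L; y \<in> carrier L; z \<in> carrier L\<rbrakk> \<Longrightarrow>
        bracket L x (y \<oplus>\<^bsub>L\<^esub> z) = bracket L x y \<oplus>\<^bsub>L\<^esub> bracket L x z"
    and bracket_smult_left:
      "\<lbrakk>a \<in> carrier F2; x \<in> carrier L; y \<in> carrier L\<rbrakk> \<Longrightarrow>
        bracket L (a \<odot>\<^bsub>L\<^esub> x) y = a \<odot>\<^bsub>L\<^esub> bracket L x y"
    and bracket_smult_right: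
      "\<lbrakk>a \<in> carrier F2; x \<in> carrier L; y \<in> carrier L\<rbrakk> \<Longrightarrow>
        bracket L x (a \<odot>\<^bsub>L\<^esub> y) = a \<odot>\<^bsub>L\<^esub> bracket L x y"
    and bracket_self: "x \<in> carrier L \<Longrightarrow> bracket L x x = \<zero>\<^bsub>L\<^esub>"
    and jacobi:
      "\<lbrakk>x \<in> carrier L; y \<in> carrier L; z \<in> carrier L\<rbrakk> \<Longrightarrow>
        bracket L x (bracket L y z) \<oplus>\<^bsub>L\<^esub> bracket L y (bracket L z x)
          \<oplus>\<^bsub>L\<^esub> bracket L z (bracket L x y) = \<zero>\<^bsub>L\<^esub>"
    and sq_closed: "x \<in> carrier L \<Longrightarrow> sq L x \<in> carrier L"
    and bracket_sq:
      "\<lbrakk>x \<in> carrier L; y \<in> carrier L\<rbrakk> \<Longrightarrow>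
        bracket L x (sq L y) = bracket L (bracket L x y) y"
    and sq_smult:
      "\<lbrakk>a \<in> carrier F2; x \<in> carrier L\<rbrakk> \<Longrightarrow>
        sq L (a \<odot>\<^bsub>L\<^esub> x) = (a \<otimes>\<^bsub>F2\<^esub> a) \<odot>\<^bsub>L\<^esub> sq L x"
    and sq_add:
      "\<lbrakk>x \<in> carrier L; y \<in> carrier L\<rbrakk> \<Longrightarrow>
        sq L (x \<oplus>\<^bsub>L\<^esub> y) = sq L x \<oplus>\<^bsub>L\<^esub> sq L y \<oplus>\<^bsub>L\<^esub> bracket L x y"

definition two_lie_hom ::
  "('a, 'c) two_lie_scheme \<Rightarrow> ('b, 'd) two_lie_scheme \<Rightarrow> ('a \<Rightarrow> 'b) set" where
  "two_lie_hom L M = {f. f \<in> carrier L \<rightarrow> carrier M \<and>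
     (\<forall>x\<in>carrier L. \<forall>y\<in>carrier L. f (x \<oplus>\<^bsub>L\<^esub> y) = f x \<oplus>\<^bsub>M\<^esub> f y) \<and>
     (\<forall>a\<in>carrier F2. \<forall>x\<in>carrier L. f (a \<odot>\<^bsub>L\<^esub> x) = a \<odot>\<^bsub>M\<^esub> f x) \<and>
     (\<forall>x\<in>carrier L. \<forall>y\<in>carrier L. f (bracket L x y) = bracket M (f x) (f y)) \<and>
     (\<forall>x\<in>carrier L. f (sq L x) = sq M (f x))}"

definition two_lie_isomorphic ::
  "('a, 'c) two_lie_scheme \<Rightarrow> ('b, 'd) two_lie_scheme \<Rightarrow> bool" where
  "two_lie_isomorphic L M \<longleftrightarrow> two_lie_algebra L \<and> two_lie_algebra M \<and>
     (\<exists>f\<in>two_lie_hom L M. bij_betw f (carrier L) (carrier M))"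

text \<open>Since \<open>[y, x] = [x, y]\<close> in characteristic 2, closure under one-sided brackets suffices.\<close>

definition restricted_ideal :: "'a set \<Rightarrow> ('a, 'c) two_lie_scheme \<Rightarrow> bool" where
  "restricted_ideal I L \<longleftrightarrow> submodule I F2 L \<and>
     (\<forall>x\<in>carrier L. \<forall>y\<in>I. bracket L x y \<in> I) \<and> (\<forall>y\<in>I. sq L y \<in> I)"

definition restricted_ideal_gen :: "('a, 'c) two_lie_scheme \<Rightarrow> 'a set \<Rightarrow> 'a set" where
  "restricted_ideal_gen L S = \<Inter>{I. restricted_ideal I L \<and> S \<subseteq> I}"

definition two_lie_quot :: "('a, 'c) two_lie_scheme \<Rightarrow> 'a set \<Rightarrow> 'a set two_lie" where
  "two_lie_quot L I =
     \<lparr>carrier = a_rcosets\<^bsub>L\<^esub> I, monoid.mult = undefined, one = undefined,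
      zero = I, add = set_add L,
      smult = (\<lambda>a X. \<Union>x\<in>X. I +>\<^bsub>L\<^esub> (a \<odot>\<^bsub>L\<^esub> x)),
      bracket = (\<lambda>X Y. \<Union>x\<in>X. \<Union>y\<in>Y. I +>\<^bsub>L\<^esub> bracket L x y),
      sq = (\<lambda>X. \<Union>x\<in>X. I +>\<^bsub>L\<^esub> sq L x)\<rparr>"


section \<open>Free 2-Lie algebras\<close>

text \<open>The free 2-Lie algebra is the algebra of formal terms modulo the identities of 2-Lie
  algebras. Scalars do not occur in terms: a vector space over the field with two elements
  is an abelian group in which \<open>x + x = 0\<close>. The universal property is proved below
  (\<open>free_two_lie_universal\<close>).\<close>

datatype (vars: 'v) lie_term =
    Var 'v
  | Zero
  | Add "'v lie_term" "'v lie_term"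
  | Brk "'v lie_term" "'v lie_term"
  | Sqr "'v lie_term"

inductive lie_eq :: "'v lie_term \<Rightarrow> 'v lie_term \<Rightarrow> bool" where
  refl: "lie_eq s s"
| sym: "lie_eq s t \<Longrightarrow> lie_eq t s"
| trans: "lie_eq s t \<Longrightarrow> lie_eq t u \<Longrightarrow> lie_eq s u"
| Add_cong: "lie_eq s s' \<Longrightarrow> lie_eq t t' \<Longrightarrow> lie_eq (Add s t) (Add s' t')"
| Brk_cong: "lie_eq s s' \<Longrightarrow> lie_eq t t' \<Longrightarrow> lie_eq (Brk s t) (Brk s' t')"
| Sqr_cong: "lie_eq s s' \<Longrightarrow> lie_eq (Sqr s) (Sqr s')"
| Add_assoc: "lie_eq (Add (Add s t) u) (Add s (Add t u))"
| Add_comm: "lie_eq (Add s t) (Add t s)"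
| Add_Zero: "lie_eq (Add Zero s) s"
| Add_self: "lie_eq (Add s s) Zero"
| Brk_Add_left: "lie_eq (Brk (Add s t) u) (Add (Brk s u) (Brk t u))"
| Brk_Add_right: "lie_eq (Brk s (Add t u)) (Add (Brk s t) (Brk s u))"
| Brk_self: "lie_eq (Brk s s) Zero"
| Jacobi: "lie_eq (Add (Add (Brk s (Brk t u)) (Brk t (Brk u s))) (Brk u (Brk s t))) Zero"
| Brk_Sqr: "lie_eq (Brk s (Sqr t)) (Brk (Brk s t) t)"
| Sqr_Zero: "lie_eq (Sqr Zero) Zero"
| Sqr_Add: "lie_eq (Sqr (Add s t)) (Add (Add (Sqr s) (Sqr t)) (Brk s t))"

definition lie_terms :: "'v set \<Rightarrow> 'v lie_term set" where
  "lie_terms V = {t. vars t \<subseteq> V}"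

definition lie_rel :: "'v set \<Rightarrow> ('v lie_term \<times> 'v lie_term) set" where
  "lie_rel V = {(s, t). s \<in> lie_terms V \<and> t \<in> lie_terms V \<and> lie_eq s t}"

definition free_two_lie :: "'v set \<Rightarrow> 'v lie_term set two_lie" where
  "free_two_lie V =
     \<lparr>carrier = lie_terms V // lie_rel V, monoid.mult = undefined, one = undefined,
      zero = lie_rel V `` {Zero},
      add = (\<lambda>X Y. \<Union>s\<in>X. \<Union>t\<in>Y. lie_rel V `` {Add s t}),
      smult = (\<lambda>a X. if a = 0 then lie_rel V `` {Zero} else X),
      bracket = (\<lambda>X Y. \<Union>s\<in>X. \<Union>t\<in>Y. lie_rel V `` {Brk s t}),
      sq = (\<lambda>X. \<Union>s\<in>X. lie_rel V `` {Sqr s})\<rparr>"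

definition lie_gen :: "'v set \<Rightarrow> 'v \<Rightarrow> 'v lie_term set" where
  "lie_gen V v = lie_rel V `` {Var v}"


section \<open>The lower 2-central series and its associated 2-Lie algebra\<close>

definition grp_comm :: "('a, 'b) monoid_scheme \<Rightarrow> 'a \<Rightarrow> 'a \<Rightarrow> 'a" where
  "grp_comm G g h = inv\<^bsub>G\<^esub> g \<otimes>\<^bsub>G\<^esub> inv\<^bsub>G\<^esub> h \<otimes>\<^bsub>G\<^esub> g \<otimes>\<^bsub>G\<^esub> h"

text \<open>The series are indexed from 1; the value of \<open>lower_central\<close> at 0 is irrelevant.\<close>

fun lower_central :: "('a, 'b) monoid_scheme \<Rightarrow> nat \<Rightarrow> 'a set" where
  "lower_central G 0 = carrier G"
| "lower_central G (Suc 0) = carrier G"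
| "lower_central G (Suc (Suc k)) =
     generate G {grp_comm G g h | g h. g \<in> lower_central G (Suc k) \<and> h \<in> carrier G}"

definition power_subgroup :: "('a, 'b) monoid_scheme \<Rightarrow> 'a set \<Rightarrow> nat \<Rightarrow> 'a set" where
  "power_subgroup G H q = generate G {h [^]\<^bsub>G\<^esub> q | h. h \<in> H}"

text \<open>The product of the (infinitely many) normal subgroups \<open>\<gamma>\<^sub>n(G)\<^bsup>2^i\<^esup>\<close> with \<open>n 2^i \<ge> k\<close> is the
  subgroup generated by their union.\<close>

definition lower_2_central :: "('a, 'b) monoid_scheme \<Rightarrow> nat \<Rightarrow> 'a set" where
  "lower_2_central G k =
     generate G (\<Union>{power_subgroup G (lower_central G n) (2 ^ i) | n i. 1 \<le> n \<and> k \<le> n * 2 ^ i})"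

definition gr_comp :: "('a, 'b) monoid_scheme \<Rightarrow> nat \<Rightarrow> 'a set monoid" where
  "gr_comp G k = (G\<lparr>carrier := lower_2_central G k\<rparr>) Mod lower_2_central G (Suc k)"

text \<open>The operations on homogeneous elements are given by representatives. As in
  \<^const>\<open>rcoset_mult\<close>, the union runs over all representatives of the given classes.\<close>

definition gr_bracket_hom ::
  "('a, 'b) monoid_scheme \<Rightarrow> nat \<Rightarrow> nat \<Rightarrow> 'a set \<Rightarrow> 'a set \<Rightarrow> 'a set" where
  "gr_bracket_hom G k l X Y =
     (\<Union>g\<in>X. \<Union>h\<in>Y. lower_2_central G (Suc (k + l)) #>\<^bsub>G\<^esub> grp_comm G g h)"

definition gr_sq_hom :: "('a, 'b) monoid_scheme \<Rightarrow> nat \<Rightarrow> 'a set \<Rightarrow> 'a set" where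
  "gr_sq_hom G k X = (\<Union>g\<in>X. lower_2_central G (Suc (2 * k)) #>\<^bsub>G\<^esub> (g \<otimes>\<^bsub>G\<^esub> g))"

text \<open>An element of the direct sum is a finitely supported family \<open>x\<close> with \<open>x k\<close> in the
  degree \<open>k\<close> component, \<open>k \<ge> 1\<close>. The bracket is extended bilinearly, and the sum formula
  gives \<open>(\<Sum>\<^sub>k x\<^sub>k)\<^bsup>[2]\<^esup> = \<Sum>\<^sub>k x\<^sub>k\<^bsup>[2]\<^esup> + \<Sum>\<^bsub>k<l\<^esub> [x\<^sub>k, x\<^sub>l]\<close>; both are written out in each degree \<open>n\<close>.
  The component groups are written multiplicatively.\<close>

definition gr_two_lie :: "('a, 'b) monoid_scheme \<Rightarrow> (nat \<Rightarrow> 'a set) two_lie" where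
  "gr_two_lie G =
    (let S = sum_group {1..} (gr_comp G) in
     \<lparr>carrier = carrier S, monoid.mult = undefined, one = undefined,
      zero = \<one>\<^bsub>S\<^esub>, add = monoid.mult S,
      smult = (\<lambda>a x. x [^]\<^bsub>S\<^esub> (a :: int)),
      bracket = (\<lambda>x y. \<lambda>n\<in>{1..}.
        \<Otimes>\<^bsub>gr_comp G n\<^esub>k\<in>{1..<n}. gr_bracket_hom G k (n - k) (x k) (y (n - k))),
      sq = (\<lambda>x. \<lambda>n\<in>{1..}.
        (\<Otimes>\<^bsub>gr_comp G n\<^esub>k\<in>{k. 1 \<le> k \<and> 2 * k = n}. gr_sq_hom G k (x k))
        \<otimes>\<^bsub>gr_comp G n\<^esub>
        (\<Otimes>\<^bsub>gr_comp G n\<^esub>k\<in>{k. 1 \<le> k \<and> k < n - k}.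
          gr_bracket_hom G k (n - k) (x k) (x (n - k))))\<rparr>)"

definition racg_lie_relators :: "nat \<Rightarrow> nat set set \<Rightarrow> nat lie_term set set" where
  "racg_lie_relators m K = (let L = free_two_lie {1..m}; u = lie_gen {1..m} in
     {sq L (u i) | i. i \<in> {1..m}} \<union> {bracket L (u i) (u j) | i j. {i, j} \<in> K})"


section \<open>Sanity checks\<close>

lemma equiv_word_rel: "equiv (words V) (word_rel V)"
  by (rule equivI)
    (auto simp: word_rel_def refl_on_def intro!: symI transI intro: equivclp_sym equivclp_trans)

lemma word_cancel_context: "word_cancel p q \<Longrightarrow> word_cancel (r @ p @ s) (r @ q @ s)"
proof (induction rule: word_cancel.induct)
  case (1 p v b q)
  show ?case using word_cancel.intros[of "r @ p" v b "q @ s"] by simp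
qed

lemma equivclp_word_cancel_context:
  "equivclp word_cancel p q \<Longrightarrow> equivclp word_cancel (r @ p @ s) (r @ q @ s)"
proof (induction rule: equivclp_induct)
  case (step y z)
  then have "equivclp word_cancel (r @ y @ s) (r @ z @ s)"
    using word_cancel_context r_into_equivclp equivclp_sym by metis
  with step show ?case using equivclp_trans by metis
qed simp

lemma equivclp_word_cancel_append:
  assumes "equivclp word_cancel p p'" "equivclp word_cancel q q'"
  shows "equivclp word_cancel (p @ q) (p' @ q')"
  using equivclp_word_cancel_context[OF assms(1), of "[]" q]
    equivclp_word_cancel_context[OF assms(2), of p' "[]"]
  by (auto intro: equivclp_trans)

lemma append_in_words: "p \<in> words V \<Longrightarrow> q \<in> words V \<Longrightarrow> p @ q \<in> words V"
  by (auto simp: words_def)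

lemma mult_free_group:
  assumes "p \<in> words V" "q \<in> words V"
  shows "word_rel V `` {p} \<otimes>\<^bsub>free_group V\<^esub> word_rel V `` {q} = word_rel V `` {p @ q}"
proof -
  have "(\<lambda>p q. word_rel V `` {p @ q}) respects2 word_rel V"
    by (rule congruent2I'; rule equiv_class_eq[OF equiv_word_rel])
      (auto simp: word_rel_def append_in_words equivclp_word_cancel_append)
  from UN_equiv_class2[OF equiv_word_rel equiv_word_rel this assms]
  show ?thesis by (simp add: free_group_def)
qed

definition inv_word :: "('v \<times> bool) list \<Rightarrow> ('v \<times> bool) list" where
  "inv_word p = rev (map (\<lambda>(v, b). (v, \<not> b)) p)"

lemma inv_word_words: "p \<in> words V \<Longrightarrow> inv_word p \<in> words V"
  by (force simp: inv_word_def words_def)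

lemma inv_word_cancel: "equivclp word_cancel (inv_word p @ p) []"
proof (induction p)
  case (Cons a p)
  obtain v b where a: "a = (v, b)" by force
  have "word_cancel (inv_word p @ [(v, \<not> b), (v, \<not> \<not> b)] @ p) (inv_word p @ p)"
    by (rule word_cancel.intros)
  then have "equivclp word_cancel (inv_word (a # p) @ a # p) (inv_word p @ p)"
    by (simp add: a inv_word_def r_into_equivclp)
  with Cons show ?case by (metis equivclp_trans)
qed (simp add: inv_word_def)

lemma group_free_group: "group (free_group V)"
proof (rule groupI)
  have E: "\<And>p. p \<in> words V \<Longrightarrow> word_rel V `` {p} \<in> carrier (free_group V)"
    by (simp add: free_group_def quotientI)
  have C: "\<exists>p\<in>words V. x = word_rel V `` {p}" if "x \<in> carrier (free_group V)" for x
    using that by (auto simp: free_group_def quotient_def)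
  have N: "[] \<in> words V" by (simp add: words_def)
  have one: "\<one>\<^bsub>free_group V\<^esub> = word_rel V `` {[]}" by (simp add: free_group_def)
  show "\<one>\<^bsub>free_group V\<^esub> \<in> carrier (free_group V)" by (simp add: one E N)
  fix x assume "x \<in> carrier (free_group V)"
  then obtain p where p: "p \<in> words V" "x = word_rel V `` {p}" using C by blast
  show "\<one>\<^bsub>free_group V\<^esub> \<otimes>\<^bsub>free_group V\<^esub> x = x" by (simp add: one mult_free_group N p)
  have "word_rel V `` {inv_word p @ p} = word_rel V `` {[]}"
    by (rule equiv_class_eq[OF equiv_word_rel])
      (simp add: word_rel_def N append_in_words inv_word_words p inv_word_cancel)
  then show "\<exists>y\<in>carrier (free_group V). y \<otimes>\<^bsub>free_group V\<^esub> x = \<one>\<^bsub>free_group V\<^esub>"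
    by (intro bexI[of _ "word_rel V `` {inv_word p}"])
      (simp_all add: one mult_free_group p inv_word_words E)
  fix y assume "y \<in> carrier (free_group V)"
  then obtain q where q: "q \<in> words V" "y = word_rel V `` {q}" using C by blast
  show "x \<otimes>\<^bsub>free_group V\<^esub> y \<in> carrier (free_group V)"
    by (simp add: p q mult_free_group append_in_words E)
  fix z assume "z \<in> carrier (free_group V)"
  then obtain r where r: "r \<in> words V" "z = word_rel V `` {r}" using C by blast
  show "x \<otimes>\<^bsub>free_group V\<^esub> y \<otimes>\<^bsub>free_group V\<^esub> z = x \<otimes>\<^bsub>free_group V\<^esub> (y \<otimes>\<^bsub>free_group V\<^esub> z)"
    by (simp add: p q r mult_free_group append_in_words)
qed

fun word_eval :: "('a, 'c) monoid_scheme \<Rightarrow> ('v \<Rightarrow> 'a) \<Rightarrow> ('v \<times> bool) list \<Rightarrow> 'a" where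
  "word_eval G f [] = \<one>\<^bsub>G\<^esub>"
| "word_eval G f ((v, b) # p) = (if b then f v else inv\<^bsub>G\<^esub> f v) \<otimes>\<^bsub>G\<^esub> word_eval G f p"

lemma (in group) word_eval_closed:
  "range f \<subseteq> carrier G \<Longrightarrow> word_eval G f p \<in> carrier G"
proof (induction p)
  case (Cons a p)
  then show ?case by (cases a) auto
qed simp

lemma (in group) word_eval_append:
  "range f \<subseteq> carrier G \<Longrightarrow> word_eval G f (p @ q) = word_eval G f p \<otimes> word_eval G f q"
proof (induction p)
  case (Cons a p)
  then show ?case
    by (cases a) (auto simp: word_eval_closed m_assoc image_subset_iff)
qed (simp add: word_eval_closed)

lemma (in group) word_eval_cong:
  assumes f: "range f \<subseteq> carrier G" and e: "equivclp word_cancel p q"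
  shows "word_eval G f p = word_eval G f q"
proof -
  have S: "word_eval G f p = word_eval G f q" if "word_cancel p q" for p q
    using that
  proof (induction rule: word_cancel.induct)
    case (1 p v b q)
    have "f v \<in> carrier G" using f by auto
    then have "word_eval G f ([(v, b), (v, \<not> b)] @ q) = word_eval G f q"
      by (simp add: word_eval_closed f m_assoc[symmetric])
    then show ?case by (simp add: word_eval_append f del: append_Cons)
  qed
  from e show ?thesis
    by (induction rule: equivclp_induct) (use S in \<open>metis\<close>)+
qed

text \<open>The universal property of the free group.\<close>

lemma free_group_universal:
  fixes G :: "('a, 'c) monoid_scheme"
  assumes "group G" and f: "f \<in> V \<rightarrow> carrier G"
  shows "\<exists>!h. h \<in> extensional (carrier (free_group V)) \<and> h \<in> hom (free_group V) G \<and>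
           (\<forall>v\<in>V. h (free_gen V v) = f v)"
proof -
  interpret group G by fact
  define g where "g v = (if v \<in> V then f v else \<one>\<^bsub>G\<^esub>)" for v
  have g: "range g \<subseteq> carrier G" using f by (auto simp: g_def)
  define h where "h = (\<lambda>X\<in>carrier (free_group V). the_elem (word_eval G g ` X))"
  have C: "\<exists>p\<in>words V. x = word_rel V `` {p}" if "x \<in> carrier (free_group V)" for x
    using that by (auto simp: free_group_def quotient_def)
  have E: "\<And>p. p \<in> words V \<Longrightarrow> word_rel V `` {p} \<in> carrier (free_group V)"
    by (simp add: free_group_def quotientI)
  have h: "h (word_rel V `` {p}) = word_eval G g p" if "p \<in> words V" for p
  proof -
    have "p \<in> word_rel V `` {p}" using that by (simp add: word_rel_def)
    moreover have "\<And>q. q \<in> word_rel V `` {p} \<Longrightarrow> word_eval G g q = word_eval G g p"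
      using word_eval_cong[OF g] by (auto simp: word_rel_def)
    ultimately have "word_eval G g ` (word_rel V `` {p}) = {word_eval G g p}" by blast
    then show ?thesis using that by (simp add: h_def E)
  qed
  have gen: "[(v, b)] \<in> words V" if "v \<in> V" for v b using that by (simp add: words_def)
  show ?thesis
  proof (rule ex1I[of _ h], intro conjI ballI)
    show "h \<in> extensional (carrier (free_group V))" by (simp add: h_def)
    show "h \<in> hom (free_group V) G"
    proof (rule homI)
      fix x y assume "x \<in> carrier (free_group V)" "y \<in> carrier (free_group V)"
      then obtain p q where pq: "p \<in> words V" "q \<in> words V"
        "x = word_rel V `` {p}" "y = word_rel V `` {q}"
        using C by meson
      show "h (x \<otimes>\<^bsub>free_group V\<^esub> y) = h x \<otimes>\<^bsub>G\<^esub> h y"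
        by (simp add: pq mult_free_group append_in_words h word_eval_append g)
      show "h x \<in> carrier G" by (simp add: pq h word_eval_closed g)
    qed
    show "h (free_gen V v) = f v" if "v \<in> V" for v
      using that Pi_mem[OF f that] by (simp add: free_gen_def gen h g_def)
  next
    fix k assume k: "k \<in> extensional (carrier (free_group V)) \<and> k \<in> hom (free_group V) G \<and>
           (\<forall>v\<in>V. k (free_gen V v) = f v)"
    interpret F: group "free_group V" by (rule group_free_group)
    interpret k: group_hom "free_group V" G k
      using k by unfold_locales auto
    have kp: "k (word_rel V `` {p}) = word_eval G g p" if "p \<in> words V" for p
      using that
    proof (induction p)
      case Nil
      then show ?case using k.hom_one by (simp add: free_group_def)
    next
      case (Cons a p)
      obtain v b where a: "a = (v, b)" by force
      have v: "v \<in> V" and p: "p \<in> words V" using Cons.prems by (auto simp: words_def a)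
      have gc: "free_gen V v \<in> carrier (free_group V)" by (simp add: free_gen_def E gen v)
      have T: "k (word_rel V `` {[(v, True)]}) = g v"
        using k v by (simp add: free_gen_def g_def)
      have "word_rel V `` {[(v, False)]} \<otimes>\<^bsub>free_group V\<^esub> free_gen V v = \<one>\<^bsub>free_group V\<^esub>"
      proof -
        have "word_cancel ([] @ [(v, False), (v, \<not> False)] @ []) ([] @ [])"
          by (rule word_cancel.intros)
        then have "word_rel V `` {[(v, False), (v, True)]} = word_rel V `` {[]}"
          by (intro equiv_class_eq[OF equiv_word_rel])
            (auto simp: word_rel_def r_into_equivclp words_def v)
        then show ?thesis
          by (simp add: free_gen_def mult_free_group gen v)
            (simp add: free_group_def)
      qed
      then have "word_rel V `` {[(v, False)]} = inv\<^bsub>free_group V\<^esub> free_gen V v"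
        using F.inv_equality gc E gen v by metis
      then have Fa: "k (word_rel V `` {[(v, False)]}) = inv\<^bsub>G\<^esub> g v"
        using T gc by (simp add: free_gen_def)
      have "k (word_rel V `` {a # p}) = k (word_rel V `` {[a]} \<otimes>\<^bsub>free_group V\<^esub> word_rel V `` {p})"
        by (simp add: mult_free_group a gen v p)
      also have "\<dots> = k (word_rel V `` {[a]}) \<otimes>\<^bsub>G\<^esub> k (word_rel V `` {p})"
        by (rule k.hom_mult) (simp_all add: E a gen v p)
      finally show ?case using Cons.IH[OF p] T Fa by (simp add: a)
    qed
    show "k = h"
    proof (rule extensionalityI)
      show "k \<in> extensional (carrier (free_group V))" using k by blast
      show "h \<in> extensional (carrier (free_group V))" by (simp add: h_def)
      show "k x = h x" if "x \<in> carrier (free_group V)" for x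
        using C[OF that] kp h by metis
    qed
  qed
qed

lemma equiv_lie_rel: "equiv (lie_terms V) (lie_rel V)"
  by (rule equivI)
    (auto simp: lie_rel_def refl_on_def intro!: symI transI intro: lie_eq.intros)

lemma lie_terms_simps [simp]:
  "Zero \<in> lie_terms V" "Var v \<in> lie_terms V \<longleftrightarrow> v \<in> V"
  "Add s t \<in> lie_terms V \<longleftrightarrow> s \<in> lie_terms V \<and> t \<in> lie_terms V"
  "Brk s t \<in> lie_terms V \<longleftrightarrow> s \<in> lie_terms V \<and> t \<in> lie_terms V"
  "Sqr s \<in> lie_terms V \<longleftrightarrow> s \<in> lie_terms V"
  by (auto simp: lie_terms_def)

lemma lie_class_eq:
  assumes "s \<in> lie_terms V" "t \<in> lie_terms V" "lie_eq s t"
  shows "lie_rel V `` {s} = lie_rel V `` {t}"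
  by (rule equiv_class_eq[OF equiv_lie_rel]) (simp add: lie_rel_def assms)

lemma free_two_lie_ops:
  assumes "s \<in> lie_terms V" "t \<in> lie_terms V"
  shows "lie_rel V `` {s} \<oplus>\<^bsub>free_two_lie V\<^esub> lie_rel V `` {t} = lie_rel V `` {Add s t}"
    and "bracket (free_two_lie V) (lie_rel V `` {s}) (lie_rel V `` {t}) = lie_rel V `` {Brk s t}"
    and "sq (free_two_lie V) (lie_rel V `` {s}) = lie_rel V `` {Sqr s}"
proof -
  have "(\<lambda>s t. lie_rel V `` {Add s t}) respects2 lie_rel V"
    by (rule congruent2I'; rule lie_class_eq) (auto simp: lie_rel_def intro: lie_eq.intros)
  from UN_equiv_class2[OF equiv_lie_rel equiv_lie_rel this assms]
  show "lie_rel V `` {s} \<oplus>\<^bsub>free_two_lie V\<^esub> lie_rel V `` {t} = lie_rel V `` {Add s t}"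
    by (simp add: free_two_lie_def)
  have "(\<lambda>s t. lie_rel V `` {Brk s t}) respects2 lie_rel V"
    by (rule congruent2I'; rule lie_class_eq) (auto simp: lie_rel_def intro: lie_eq.intros)
  from UN_equiv_class2[OF equiv_lie_rel equiv_lie_rel this assms]
  show "bracket (free_two_lie V) (lie_rel V `` {s}) (lie_rel V `` {t}) = lie_rel V `` {Brk s t}"
    by (simp add: free_two_lie_def)
  have "(\<lambda>s. lie_rel V `` {Sqr s}) respects lie_rel V"
    by (rule congruentI; rule lie_class_eq) (auto simp: lie_rel_def intro: lie_eq.intros)
  from UN_equiv_class[OF equiv_lie_rel this assms(1)]
  show "sq (free_two_lie V) (lie_rel V `` {s}) = lie_rel V `` {Sqr s}"
    by (simp add: free_two_lie_def)
qed

lemma carrier_free_two_lie: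
  "x \<in> carrier (free_two_lie V) \<longleftrightarrow> (\<exists>s\<in>lie_terms V. x = lie_rel V `` {s})"
  by (auto simp: free_two_lie_def quotient_def)

lemma zero_free_two_lie: "\<zero>\<^bsub>free_two_lie V\<^esub> = lie_rel V `` {Zero}"
  by (simp add: free_two_lie_def)

lemma carrier_F2: "carrier F2 = {0, 1}"
  by (auto simp: residue_ring_def)

lemma cring_F2: "cring F2"
  by (rule residues.cring) (simp add: residues_def)

lemma smult_free_two_lie:
  "0 \<odot>\<^bsub>free_two_lie V\<^esub> x = \<zero>\<^bsub>free_two_lie V\<^esub>" "1 \<odot>\<^bsub>free_two_lie V\<^esub> x = x"
  by (simp_all add: free_two_lie_def)

lemma two_lie_algebraI:
  fixes L :: "('a, 'c) two_lie_scheme"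
  assumes ab: "abelian_group L"
    and self: "\<And>x. x \<in> carrier L \<Longrightarrow> x \<oplus>\<^bsub>L\<^esub> x = \<zero>\<^bsub>L\<^esub>"
    and s0: "\<And>x. x \<in> carrier L \<Longrightarrow> 0 \<odot>\<^bsub>L\<^esub> x = \<zero>\<^bsub>L\<^esub>"
    and s1: "\<And>x. x \<in> carrier L \<Longrightarrow> 1 \<odot>\<^bsub>L\<^esub> x = x"
    and bc: "\<And>x y. x \<in> carrier L \<Longrightarrow> y \<in> carrier L \<Longrightarrow> bracket L x y \<in> carrier L"
    and bl: "\<And>x y z. x \<in> carrier L \<Longrightarrow> y \<in> carrier L \<Longrightarrow> z \<in> carrier L \<Longrightarrow>
        bracket L (x \<oplus>\<^bsub>L\<^esub> y) z = bracket L x z \<oplus>\<^bsub>L\<^esub> bracket L y z"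
    and br: "\<And>x y z. x \<in> carrier L \<Longrightarrow> y \<in> carrier L \<Longrightarrow> z \<in> carrier L \<Longrightarrow>
        bracket L x (y \<oplus>\<^bsub>L\<^esub> z) = bracket L x y \<oplus>\<^bsub>L\<^esub> bracket L x z"
    and bs: "\<And>x. x \<in> carrier L \<Longrightarrow> bracket L x x = \<zero>\<^bsub>L\<^esub>"
    and ja: "\<And>x y z. x \<in> carrier L \<Longrightarrow> y \<in> carrier L \<Longrightarrow> z \<in> carrier L \<Longrightarrow>
        bracket L x (bracket L y z) \<oplus>\<^bsub>L\<^esub> bracket L y (bracket L z x)
          \<oplus>\<^bsub>L\<^esub> bracket L z (bracket L x y) = \<zero>\<^bsub>L\<^esub>"
    and qc: "\<And>x. x \<in> carrier L \<Longrightarrow> sq L x \<in> carrier L"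
    and bq: "\<And>x y. x \<in> carrier L \<Longrightarrow> y \<in> carrier L \<Longrightarrow>
        bracket L x (sq L y) = bracket L (bracket L x y) y"
    and qa: "\<And>x y. x \<in> carrier L \<Longrightarrow> y \<in> carrier L \<Longrightarrow>
        sq L (x \<oplus>\<^bsub>L\<^esub> y) = sq L x \<oplus>\<^bsub>L\<^esub> sq L y \<oplus>\<^bsub>L\<^esub> bracket L x y"
  shows "two_lie_algebra L"
proof -
  interpret abelian_group L by fact
  have F2: "\<zero>\<^bsub>F2\<^esub> = 0" "\<one>\<^bsub>F2\<^esub> = 1" "0 \<oplus>\<^bsub>F2\<^esub> 0 = 0" "0 \<oplus>\<^bsub>F2\<^esub> 1 = 1" "1 \<oplus>\<^bsub>F2\<^esub> 0 = 1"
    "1 \<oplus>\<^bsub>F2\<^esub> 1 = 0" "0 \<otimes>\<^bsub>F2\<^esub> a = 0" "a \<otimes>\<^bsub>F2\<^esub> 0 = 0" "1 \<otimes>\<^bsub>F2\<^esub> 1 = 1" for a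
    by (simp_all add: residue_ring_def)
  have z: "\<zero>\<^bsub>L\<^esub> \<in> carrier L" by simp
  have idem: "x = \<zero>\<^bsub>L\<^esub>" if "x \<in> carrier L" "x = x \<oplus>\<^bsub>L\<^esub> x" for x
    using self that by simp
  have b0: "bracket L \<zero>\<^bsub>L\<^esub> x = \<zero>\<^bsub>L\<^esub>" if "x \<in> carrier L" for x
    using bl[OF z z that] by (intro idem bc z that) (simp add: z)
  have b0': "bracket L x \<zero>\<^bsub>L\<^esub> = \<zero>\<^bsub>L\<^esub>" if "x \<in> carrier L" for x
    using br[OF that z z] by (intro idem bc z that) (simp add: z)
  have q0: "sq L \<zero>\<^bsub>L\<^esub> = \<zero>\<^bsub>L\<^esub>"
    using qa[OF z z] self[OF qc[OF z]] bs[OF z] by (simp add: z)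
  have "module F2 L"
    by (rule moduleI[OF cring_F2 ab]) (auto simp: carrier_F2 F2 s0 s1 self)
  then show ?thesis
    by (intro two_lie_algebra.intro two_lie_algebra_axioms.intro)
      (auto simp: carrier_F2 F2 s0 s1 b0 b0' q0 bc bl br bs ja qc bq qa)
qed

lemma two_lie_algebra_free: "two_lie_algebra (free_two_lie V)"
proof -
  let ?F = "free_two_lie V"
  let ?c = "\<lambda>s. lie_rel V `` {s}"
  have T: "\<And>s. s \<in> lie_terms V \<Longrightarrow> ?c s \<in> carrier ?F"
    using carrier_free_two_lie by blast
  have Q: "P x" if "x \<in> carrier ?F" "\<And>s. s \<in> lie_terms V \<Longrightarrow> P (?c s)" for P x
    using that carrier_free_two_lie by metis
  note ops = zero_free_two_lie free_two_lie_ops smult_free_two_lie T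
  have ab: "abelian_group ?F"
  proof (rule abelian_groupI)
    fix x y z assume x: "x \<in> carrier ?F" and y: "y \<in> carrier ?F" and z: "z \<in> carrier ?F"
    show "x \<oplus>\<^bsub>?F\<^esub> y \<in> carrier ?F"
      by (rule Q[OF x], rule Q[OF y]) (simp add: ops)
    show "x \<oplus>\<^bsub>?F\<^esub> y \<oplus>\<^bsub>?F\<^esub> z = x \<oplus>\<^bsub>?F\<^esub> (y \<oplus>\<^bsub>?F\<^esub> z)"
      by (rule Q[OF x], rule Q[OF y], rule Q[OF z])
        (simp add: ops lie_class_eq[OF _ _ lie_eq.Add_assoc])
    show "x \<oplus>\<^bsub>?F\<^esub> y = y \<oplus>\<^bsub>?F\<^esub> x"
      by (rule Q[OF x], rule Q[OF y]) (simp add: ops lie_class_eq[OF _ _ lie_eq.Add_comm])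
    show "\<zero>\<^bsub>?F\<^esub> \<oplus>\<^bsub>?F\<^esub> x = x"
      by (rule Q[OF x]) (simp add: ops lie_class_eq[OF _ _ lie_eq.Add_Zero])
    have "x \<oplus>\<^bsub>?F\<^esub> x = \<zero>\<^bsub>?F\<^esub>"
      by (rule Q[OF x]) (simp add: ops lie_class_eq[OF _ _ lie_eq.Add_self])
    with x show "\<exists>y\<in>carrier ?F. y \<oplus>\<^bsub>?F\<^esub> x = \<zero>\<^bsub>?F\<^esub>" by blast
  qed (simp add: ops)
  show ?thesis
  proof (rule two_lie_algebraI[OF ab])
    fix x y z assume x: "x \<in> carrier ?F" and y: "y \<in> carrier ?F" and z: "z \<in> carrier ?F"
    show "x \<oplus>\<^bsub>?F\<^esub> x = \<zero>\<^bsub>?F\<^esub>"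
      by (rule Q[OF x]) (simp add: ops lie_class_eq[OF _ _ lie_eq.Add_self])
    show "0 \<odot>\<^bsub>?F\<^esub> x = \<zero>\<^bsub>?F\<^esub>" "1 \<odot>\<^bsub>?F\<^esub> x = x"
      by (simp_all only: smult_free_two_lie)
    show "bracket ?F x y \<in> carrier ?F"
      by (rule Q[OF x], rule Q[OF y]) (simp add: ops)
    show "bracket ?F (x \<oplus>\<^bsub>?F\<^esub> y) z = bracket ?F x z \<oplus>\<^bsub>?F\<^esub> bracket ?F y z"
      by (rule Q[OF x], rule Q[OF y], rule Q[OF z])
        (simp add: ops lie_class_eq[OF _ _ lie_eq.Brk_Add_left])
    show "bracket ?F x (y \<oplus>\<^bsub>?F\<^esub> z) = bracket ?F x y \<oplus>\<^bsub>?F\<^esub> bracket ?F x z"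
      by (rule Q[OF x], rule Q[OF y], rule Q[OF z])
        (simp add: ops lie_class_eq[OF _ _ lie_eq.Brk_Add_right])
    show "bracket ?F x x = \<zero>\<^bsub>?F\<^esub>"
      by (rule Q[OF x]) (simp add: ops lie_class_eq[OF _ _ lie_eq.Brk_self])
    show "bracket ?F x (bracket ?F y z) \<oplus>\<^bsub>?F\<^esub> bracket ?F y (bracket ?F z x)
          \<oplus>\<^bsub>?F\<^esub> bracket ?F z (bracket ?F x y) = \<zero>\<^bsub>?F\<^esub>"
      by (rule Q[OF x], rule Q[OF y], rule Q[OF z])
        (simp add: ops lie_class_eq[OF _ _ lie_eq.Jacobi])
    show "sq ?F x \<in> carrier ?F"
      by (rule Q[OF x]) (simp add: ops)
    show "bracket ?F x (sq ?F y) = bracket ?F (bracket ?F x y) y"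
      by (rule Q[OF x], rule Q[OF y]) (simp add: ops lie_class_eq[OF _ _ lie_eq.Brk_Sqr])
    show "sq ?F (x \<oplus>\<^bsub>?F\<^esub> y) = sq ?F x \<oplus>\<^bsub>?F\<^esub> sq ?F y \<oplus>\<^bsub>?F\<^esub> bracket ?F x y"
      by (rule Q[OF x], rule Q[OF y]) (simp add: ops lie_class_eq[OF _ _ lie_eq.Sqr_Add])
  qed
qed

fun lie_eval :: "('a, 'c) two_lie_scheme \<Rightarrow> ('v \<Rightarrow> 'a) \<Rightarrow> 'v lie_term \<Rightarrow> 'a" where
  "lie_eval L f (Var v) = f v"
| "lie_eval L f Zero = \<zero>\<^bsub>L\<^esub>"
| "lie_eval L f (Add s t) = lie_eval L f s \<oplus>\<^bsub>L\<^esub> lie_eval L f t"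
| "lie_eval L f (Brk s t) = bracket L (lie_eval L f s) (lie_eval L f t)"
| "lie_eval L f (Sqr s) = sq L (lie_eval L f s)"

context two_lie_algebra
begin

lemma lie_eval_closed: "range f \<subseteq> carrier L \<Longrightarrow> lie_eval L f s \<in> carrier L"
  by (induction s) (auto simp: bracket_closed sq_closed)

lemma F2_ops: "\<one>\<^bsub>F2\<^esub> = 1" "1 \<oplus>\<^bsub>F2\<^esub> 1 = 0" "\<zero>\<^bsub>F2\<^esub> = 0" "0 \<otimes>\<^bsub>F2\<^esub> 0 = 0"
  by (simp_all add: residue_ring_def)

lemma smult_0: "x \<in> carrier L \<Longrightarrow> 0 \<odot>\<^bsub>L\<^esub> x = \<zero>\<^bsub>L\<^esub>"
  using smult_l_null[of x] by (simp add: F2_ops)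

lemma smult_1: "x \<in> carrier L \<Longrightarrow> 1 \<odot>\<^bsub>L\<^esub> x = x"
  using smult_one[of x] by (simp add: F2_ops)

lemma add_self: "x \<in> carrier L \<Longrightarrow> x \<oplus>\<^bsub>L\<^esub> x = \<zero>\<^bsub>L\<^esub>"
  using smult_l_distr[of 1 1 x] by (simp add: carrier_F2 F2_ops smult_0 smult_1)

lemma sq_zero: "sq L \<zero>\<^bsub>L\<^esub> = \<zero>\<^bsub>L\<^esub>"
  using sq_smult[of 0 "\<zero>\<^bsub>L\<^esub>"] by (simp add: carrier_F2 F2_ops smult_0 sq_closed)

lemma lie_eval_cong:
  assumes f: "range f \<subseteq> carrier L" and "lie_eq s t"
  shows "lie_eval L f s = lie_eval L f t"
  using assms(2)
proof (induction rule: lie_eq.induct)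
  case (Add_assoc s t u) then show ?case by (simp add: lie_eval_closed f a_assoc)
next
  case (Add_comm s t) then show ?case by (simp add: lie_eval_closed f a_comm)
qed (simp_all add: lie_eval_closed f add_self bracket_add_left bracket_add_right bracket_self
    jacobi bracket_sq sq_zero sq_add)

end

text \<open>The universal property of the free 2-Lie algebra.\<close>

lemma free_two_lie_universal:
  fixes L :: "('a, 'c) two_lie_scheme"
  assumes "two_lie_algebra L" and f: "f \<in> V \<rightarrow> carrier L"
  shows "\<exists>!h. h \<in> extensional (carrier (free_two_lie V)) \<and> h \<in> two_lie_hom (free_two_lie V) L \<and>
           (\<forall>v\<in>V. h (lie_gen V v) = f v)"
proof -
  interpret two_lie_algebra L by fact
  let ?F = "free_two_lie V"
  interpret F: two_lie_algebra ?F by (rule two_lie_algebra_free)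
  define g where "g v = (if v \<in> V then f v else \<zero>\<^bsub>L\<^esub>)" for v
  have g: "range g \<subseteq> carrier L" using f by (auto simp: g_def)
  define h where "h = (\<lambda>X\<in>carrier ?F. the_elem (lie_eval L g ` X))"
  have C: "\<exists>s\<in>lie_terms V. x = lie_rel V `` {s}" if "x \<in> carrier ?F" for x
    using that carrier_free_two_lie by metis
  have E: "\<And>s. s \<in> lie_terms V \<Longrightarrow> lie_rel V `` {s} \<in> carrier ?F"
    using carrier_free_two_lie by blast
  have h: "h (lie_rel V `` {s}) = lie_eval L g s" if "s \<in> lie_terms V" for s
  proof -
    have "s \<in> lie_rel V `` {s}" using that by (simp add: lie_rel_def lie_eq.refl)
    moreover have "\<And>t. t \<in> lie_rel V `` {s} \<Longrightarrow> lie_eval L g t = lie_eval L g s"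
      using lie_eval_cong[OF g] by (auto simp: lie_rel_def)
    ultimately have "lie_eval L g ` (lie_rel V `` {s}) = {lie_eval L g s}" by blast
    then show ?thesis using that by (simp add: h_def E)
  qed
  have hadd: "h (x \<oplus>\<^bsub>?F\<^esub> y) = h x \<oplus>\<^bsub>L\<^esub> h y"
    and hbr: "h (bracket ?F x y) = bracket L (h x) (h y)"
    and hsq: "h (sq ?F x) = sq L (h x)"
    if "x \<in> carrier ?F" "y \<in> carrier ?F" for x y
    using C[OF that(1)] C[OF that(2)] by (auto simp: free_two_lie_ops h)
  have hc: "h x \<in> carrier L" if "x \<in> carrier ?F" for x
    using C[OF that] by (auto simp: h lie_eval_closed g)
  have h0: "h \<zero>\<^bsub>?F\<^esub> = \<zero>\<^bsub>L\<^esub>"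
    by (simp add: zero_free_two_lie h)
  show ?thesis
  proof (rule ex1I[of _ h], intro conjI ballI)
    show "h \<in> extensional (carrier ?F)" by (simp add: h_def)
    show "h \<in> two_lie_hom ?F L"
      by (auto simp: two_lie_hom_def hadd hbr hsq hc carrier_F2 h0 smult_0 smult_1
          F.smult_0 F.smult_1)
    show "h (lie_gen V v) = f v" if "v \<in> V" for v
      using that by (simp add: lie_gen_def h g_def)
  next
    fix k assume k: "k \<in> extensional (carrier ?F) \<and> k \<in> two_lie_hom ?F L \<and>
           (\<forall>v\<in>V. k (lie_gen V v) = f v)"
    then have kh: "k \<in> two_lie_hom ?F L" by blast
    have kc: "k x \<in> carrier L" if "x \<in> carrier ?F" for x
      using kh that by (auto simp: two_lie_hom_def)
    have kadd: "k (x \<oplus>\<^bsub>?F\<^esub> y) = k x \<oplus>\<^bsub>L\<^esub> k y"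
      and kbr: "k (bracket ?F x y) = bracket L (k x) (k y)"
      and ksq: "k (sq ?F x) = sq L (k x)"
      if "x \<in> carrier ?F" "y \<in> carrier ?F" for x y
      using kh that by (auto simp: two_lie_hom_def)
    have k0: "k \<zero>\<^bsub>?F\<^esub> = \<zero>\<^bsub>L\<^esub>"
      using kadd[of "\<zero>\<^bsub>?F\<^esub>" "\<zero>\<^bsub>?F\<^esub>"] add_self[of "k \<zero>\<^bsub>?F\<^esub>"] kc[of "\<zero>\<^bsub>?F\<^esub>"] by simp
    have kp: "k (lie_rel V `` {s}) = lie_eval L g s" if "s \<in> lie_terms V" for s
      using that
    proof (induction s)
      case (Var v)
      then show ?case using k by (simp add: lie_gen_def g_def)
    next
      case Zero
      then show ?case using k0 by (simp add: zero_free_two_lie)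
    next
      case (Add s t)
      then show ?case
        using kadd[of "lie_rel V `` {s}" "lie_rel V `` {t}"] by (simp add: E free_two_lie_ops)
    next
      case (Brk s t)
      then show ?case
        using kbr[of "lie_rel V `` {s}" "lie_rel V `` {t}"] by (simp add: E free_two_lie_ops)
    next
      case (Sqr s)
      then show ?case
        using ksq[of "lie_rel V `` {s}" "lie_rel V `` {s}"]
        by (simp add: E free_two_lie_ops)
    qed
    show "k = h"
    proof (rule extensionalityI)
      show "k \<in> extensional (carrier ?F)" using k by blast
      show "h \<in> extensional (carrier ?F)" by (simp add: h_def)
      show "k x = h x" if "x \<in> carrier ?F" for x
        using C[OF that] kp h by metis
    qed
  qed
qed

lemma restricted_ideal_restricted_ideal_gen:
  assumes "two_lie_algebra L" and "S \<subseteq> carrier L"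
  shows "restricted_ideal (restricted_ideal_gen L S) L"
proof -
  interpret two_lie_algebra L by fact
  let ?A = "{I. restricted_ideal I L \<and> S \<subseteq> I}"
  have "restricted_ideal (carrier L) L"
    by (simp add: restricted_ideal_def carrier_is_submodule bracket_closed sq_closed)
  then have ne: "carrier L \<in> ?A" using assms(2) by blast
  have sub: "submodule I F2 L" if "I \<in> ?A" for I
    using that by (simp add: restricted_ideal_def)
  have "submodule (\<Inter>?A) F2 L"
  proof (rule submoduleI)
    show "\<Inter>?A \<subseteq> carrier L" using ne by blast
    show "\<zero>\<^bsub>L\<^esub> \<in> \<Inter>?A"
      using subgroup.one_closed[OF submodule.axioms(1)[OF sub]] by simp
    show "\<ominus>\<^bsub>L\<^esub> a \<in> \<Inter>?A" if "a \<in> \<Inter>?A" for a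
      using that submoduleE(3)[OF sub] by blast
    show "a \<oplus>\<^bsub>L\<^esub> b \<in> \<Inter>?A" if "a \<in> \<Inter>?A" "b \<in> \<Inter>?A" for a b
      using that submoduleE(5)[OF sub] by blast
    show "a \<odot>\<^bsub>L\<^esub> x \<in> \<Inter>?A" if "a \<in> carrier F2" "x \<in> \<Inter>?A" for a x
      using that submoduleE(4)[OF sub] by blast
  qed
  then show ?thesis
    by (auto simp: restricted_ideal_gen_def restricted_ideal_def)
qed

lemma two_lie_algebra_quot:
  assumes "two_lie_algebra L" and I: "restricted_ideal I L"
  shows "two_lie_algebra (two_lie_quot L I)"
proof -
  interpret two_lie_algebra L by fact
  have subm: "submodule I F2 L" using I by (simp add: restricted_ideal_def)
  interpret abelian_subgroup I L
    by (rule abelian_subgroupI3)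
      (simp_all add: additive_subgroup.intro submodule.axioms(1)[OF subm]
        module.axioms(2)[OF two_lie_algebra.axioms(1)[OF assms(1)]])
  let ?Q = "two_lie_quot L I"
  let ?c = "\<lambda>x. I +>\<^bsub>L\<^esub> x"
  have Ib: "bracket L x y \<in> I" if "x \<in> carrier L" "y \<in> I" for x y
    using that I by (simp add: restricted_ideal_def)
  have Is: "sq L y \<in> I" if "y \<in> I" for y
    using that I by (simp add: restricted_ideal_def)
  have Ic: "y \<in> carrier L" if "y \<in> I" for y
    using that a_subset by blast
  have b0: "bracket L x \<zero>\<^bsub>L\<^esub> = \<zero>\<^bsub>L\<^esub>" if "x \<in> carrier L" for x
    using bracket_smult_right[of 0 x "\<zero>\<^bsub>L\<^esub>"] that
    by (simp add: carrier_F2 smult_0 bracket_closed)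
  have comm: "bracket L x y = bracket L y x" if xy: "x \<in> carrier L" "y \<in> carrier L" for x y
  proof -
    have "\<zero>\<^bsub>L\<^esub> = bracket L (x \<oplus>\<^bsub>L\<^esub> y) (x \<oplus>\<^bsub>L\<^esub> y)"
      using xy by (simp add: bracket_self)
    also have "\<dots> = bracket L x (x \<oplus>\<^bsub>L\<^esub> y) \<oplus>\<^bsub>L\<^esub> bracket L y (x \<oplus>\<^bsub>L\<^esub> y)"
      using xy by (intro bracket_add_left) auto
    also have "\<dots> = bracket L x y \<oplus>\<^bsub>L\<^esub> bracket L y x"
      using xy by (simp add: bracket_add_right bracket_closed bracket_self)
    finally have *: "bracket L x y \<oplus>\<^bsub>L\<^esub> bracket L y x = \<zero>\<^bsub>L\<^esub>" ..
    have "bracket L y x \<oplus>\<^bsub>L\<^esub> bracket L y x = \<zero>\<^bsub>L\<^esub>"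
      using xy by (simp add: add_self bracket_closed)
    with * show ?thesis
      using xy by (metis bracket_closed add.right_cancel)
  qed
  have Ib': "bracket L y x \<in> I" if "x \<in> carrier L" "y \<in> I" for x y
    using comm[of y x] Ib[OF that] that Ic by simp
  have mem: "x' \<in> ?c x \<longleftrightarrow> (\<exists>i\<in>I. x' = i \<oplus>\<^bsub>L\<^esub> x)" for x x'
    by (auto simp: a_r_coset_def')
  have self: "x \<in> ?c x" if "x \<in> carrier L" for x
    using that by (auto simp: mem intro!: bexI[of _ "\<zero>\<^bsub>L\<^esub>"])
  have eqI: "?c x' = ?c x" if "i \<in> I" "x \<in> carrier L" "x' = i \<oplus>\<^bsub>L\<^esub> x" for i x x'
    using that a_repr_independence'[of x' x] by (auto simp: mem)
  have sm: "a \<odot>\<^bsub>?Q\<^esub> ?c x = ?c (a \<odot>\<^bsub>L\<^esub> x)" if "a \<in> carrier F2" "x \<in> carrier L" for a x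
  proof -
    have "?c (a \<odot>\<^bsub>L\<^esub> x') = ?c (a \<odot>\<^bsub>L\<^esub> x)" if "x' \<in> ?c x" for x'
    proof -
      from that obtain i where i: "i \<in> I" "x' = i \<oplus>\<^bsub>L\<^esub> x" by (auto simp: mem)
      show ?thesis
        using i \<open>a \<in> carrier F2\<close> \<open>x \<in> carrier L\<close> submoduleE(4)[OF subm]
        by (intro eqI[of "a \<odot>\<^bsub>L\<^esub> i"]) (auto simp: smult_r_distr Ic)
    qed
    then have "(\<Union>x'\<in>?c x. ?c (a \<odot>\<^bsub>L\<^esub> x')) = ?c (a \<odot>\<^bsub>L\<^esub> x)"
      using self[OF that(2)] by blast
    then show ?thesis by (simp add: two_lie_quot_def)
  qed
  have br: "bracket ?Q (?c x) (?c y) = ?c (bracket L x y)"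
    if x: "x \<in> carrier L" and y: "y \<in> carrier L" for x y
  proof -
    have *: "?c (bracket L x' y') = ?c (bracket L x y)" if "x' \<in> ?c x" "y' \<in> ?c y" for x' y'
    proof -
      from that obtain i j where i: "i \<in> I" "x' = i \<oplus>\<^bsub>L\<^esub> x" and j: "j \<in> I" "y' = j \<oplus>\<^bsub>L\<^esub> y"
        by (auto simp: mem)
      have "?c (bracket L x' y') = ?c (bracket L x y')"
        by (rule eqI[of "bracket L i y'"])
          (use i j x y Ib' Ic in \<open>auto simp: bracket_add_left bracket_closed\<close>)
      also have "\<dots> = ?c (bracket L x y)"
        by (rule eqI[of "bracket L x j"])
          (use i j x y Ib Ic in \<open>auto simp: bracket_add_right bracket_closed\<close>)
      finally show ?thesis .
    qed
    have "(\<Union>y'\<in>?c y. ?c (bracket L x' y')) = ?c (bracket L x y)" if "x' \<in> ?c x" for x'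
      using *[OF that] self[OF y] by blast
    then have "(\<Union>x'\<in>?c x. \<Union>y'\<in>?c y. ?c (bracket L x' y')) = ?c (bracket L x y)"
      using self[OF x] by blast
    then show ?thesis by (simp add: two_lie_quot_def)
  qed
  have sq: "sq ?Q (?c x) = ?c (sq L x)" if x: "x \<in> carrier L" for x
  proof -
    have "?c (sq L x') = ?c (sq L x)" if "x' \<in> ?c x" for x'
    proof -
      from that obtain i where i: "i \<in> I" "x' = i \<oplus>\<^bsub>L\<^esub> x" by (auto simp: mem)
      have "sq L x' = sq L i \<oplus>\<^bsub>L\<^esub> bracket L i x \<oplus>\<^bsub>L\<^esub> sq L x"
        using i x Ic by (simp add: sq_add sq_closed bracket_closed a_ac)
      then show ?thesis
        by (intro eqI[of "sq L i \<oplus>\<^bsub>L\<^esub> bracket L i x"])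
          (use i x Is Ib' in \<open>auto simp: sq_closed\<close>)
    qed
    then have "(\<Union>x'\<in>?c x. ?c (sq L x')) = ?c (sq L x)"
      using self[OF x] by blast
    then show ?thesis by (simp add: two_lie_quot_def)
  qed
  have ad: "?c x \<oplus>\<^bsub>?Q\<^esub> ?c y = ?c (x \<oplus>\<^bsub>L\<^esub> y)" if "x \<in> carrier L" "y \<in> carrier L" for x y
    using that by (simp add: two_lie_quot_def a_rcos_sum)
  have ze: "\<zero>\<^bsub>?Q\<^esub> = ?c \<zero>\<^bsub>L\<^esub>"
    using a_coset_add_zero[OF a_subset] by (simp add: two_lie_quot_def)
  have T: "\<And>x. x \<in> carrier L \<Longrightarrow> ?c x \<in> carrier ?Q"
    by (auto simp: two_lie_quot_def A_RCOSETS_def')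
  have Q: "P X" if "X \<in> carrier ?Q" "\<And>x. x \<in> carrier L \<Longrightarrow> P (?c x)" for P X
    using that by (auto simp: two_lie_quot_def A_RCOSETS_def')
  have F2: "0 \<in> carrier F2" "1 \<in> carrier F2" by (simp_all add: carrier_F2)
  note ops = ze ad br sq sm F2 T bracket_closed sq_closed
  have ab: "abelian_group ?Q"
  proof (rule abelian_groupI)
    fix x y z assume x: "x \<in> carrier ?Q" and y: "y \<in> carrier ?Q" and z: "z \<in> carrier ?Q"
    show "x \<oplus>\<^bsub>?Q\<^esub> y \<in> carrier ?Q"
      by (rule Q[OF x], rule Q[OF y]) (simp add: ops)
    show "x \<oplus>\<^bsub>?Q\<^esub> y \<oplus>\<^bsub>?Q\<^esub> z = x \<oplus>\<^bsub>?Q\<^esub> (y \<oplus>\<^bsub>?Q\<^esub> z)"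
      by (rule Q[OF x], rule Q[OF y], rule Q[OF z]) (simp add: ops a_assoc)
    show "x \<oplus>\<^bsub>?Q\<^esub> y = y \<oplus>\<^bsub>?Q\<^esub> x"
      by (rule Q[OF x], rule Q[OF y]) (simp add: ops a_comm)
    show "\<zero>\<^bsub>?Q\<^esub> \<oplus>\<^bsub>?Q\<^esub> x = x"
      by (rule Q[OF x]) (simp add: ops)
    have "x \<oplus>\<^bsub>?Q\<^esub> x = \<zero>\<^bsub>?Q\<^esub>"
      by (rule Q[OF x]) (simp add: ops add_self)
    with x show "\<exists>y\<in>carrier ?Q. y \<oplus>\<^bsub>?Q\<^esub> x = \<zero>\<^bsub>?Q\<^esub>" by blast
  qed (simp add: ops)
  show ?thesis
  proof (rule two_lie_algebraI[OF ab])
    fix x y z assume x: "x \<in> carrier ?Q" and y: "y \<in> carrier ?Q" and z: "z \<in> carrier ?Q"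
    show "x \<oplus>\<^bsub>?Q\<^esub> x = \<zero>\<^bsub>?Q\<^esub>"
      by (rule Q[OF x]) (simp add: ops add_self)
    show "0 \<odot>\<^bsub>?Q\<^esub> x = \<zero>\<^bsub>?Q\<^esub>"
      by (rule Q[OF x]) (simp add: ops smult_0)
    show "1 \<odot>\<^bsub>?Q\<^esub> x = x"
      by (rule Q[OF x]) (simp add: ops smult_1)
    show "bracket ?Q x y \<in> carrier ?Q"
      by (rule Q[OF x], rule Q[OF y]) (simp add: ops)
    show "bracket ?Q (x \<oplus>\<^bsub>?Q\<^esub> y) z = bracket ?Q x z \<oplus>\<^bsub>?Q\<^esub> bracket ?Q y z"
      by (rule Q[OF x], rule Q[OF y], rule Q[OF z]) (simp add: ops bracket_add_left)
    show "bracket ?Q x (y \<oplus>\<^bsub>?Q\<^esub> z) = bracket ?Q x y \<oplus>\<^bsub>?Q\<^esub> bracket ?Q x z"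
      by (rule Q[OF x], rule Q[OF y], rule Q[OF z]) (simp add: ops bracket_add_right)
    show "bracket ?Q x x = \<zero>\<^bsub>?Q\<^esub>"
      by (rule Q[OF x]) (simp add: ops bracket_self)
    show "bracket ?Q x (bracket ?Q y z) \<oplus>\<^bsub>?Q\<^esub> bracket ?Q y (bracket ?Q z x)
          \<oplus>\<^bsub>?Q\<^esub> bracket ?Q z (bracket ?Q x y) = \<zero>\<^bsub>?Q\<^esub>"
      by (rule Q[OF x], rule Q[OF y], rule Q[OF z]) (simp add: ops jacobi)
    show "sq ?Q x \<in> carrier ?Q"
      by (rule Q[OF x]) (simp add: ops)
    show "bracket ?Q x (sq ?Q y) = bracket ?Q (bracket ?Q x y) y"
      by (rule Q[OF x], rule Q[OF y]) (simp add: ops bracket_sq)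
    show "sq ?Q (x \<oplus>\<^bsub>?Q\<^esub> y) = sq ?Q x \<oplus>\<^bsub>?Q\<^esub> sq ?Q y \<oplus>\<^bsub>?Q\<^esub> bracket ?Q x y"
      by (rule Q[OF x], rule Q[OF y]) (simp add: ops sq_add)
  qed
qed

end

theory Submission
  imports Defs "HOL-Computational_Algebra.Formal_Power_Series" "HOL-Library.Countable_Set"
begin

text \<open>The lower 2-central series is the fastest \<open>N\<^sub>2\<close>-series (Lazard), so that its graded object is a
  2-Lie algebra generated in degree 1, and \<open>u\<^sub>i \<mapsto> [a\<^sub>i]\<close> defines an epimorphism from the presented
  algebra \<open>L\<close> onto it. For injectivity, embed \<open>L\<close> into an associative algebra \<open>A\<close> of characteristic 2 by
  \<open>j\<close>, with brackets becoming commutators and the 2-power operation squares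
  (Poincare-Birkhoff-Witt). As \<open>j(u\<^sub>i)\<^sup>2 = 0\<close>, the assignment \<open>a\<^sub>i \<mapsto> 1 + j(u\<^sub>i) t\<close> extends to a
  homomorphism from the Coxeter group to the units of \<open>A[[t]]\<close>. It maps the \<open>k\<close>-th term of the
  series into \<open>1 + t\<^sup>k A[[t]]\<close>, and the sum of the leading coefficients is a map from the graded
  algebra to \<open>A\<close> whose composite with the epimorphism is the injective map \<open>j\<close>.\<close>

section \<open>Vectors over the field with two elements and a diamond lemma\<close>

class char_two_group = ab_group_add +
  assumes char_two [simp]: "x + x = 0"
begin

lemma char_two_left [simp]: "x + (x + y) = y"
  by (simp flip: add.assoc)

lemma char_two_uminus [simp]: "- x = x"
  by (rule minus_unique) simp

lemma char_two_minus [simp]: "x - y = x + y"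
  using add_uminus_conv_diff[of x y] by simp

lemma char_two_move: "x + y = z \<Longrightarrow> x = y + z"
  by (metis add.commute char_two_left)

lemma char_two_eq_iff: "x + y = 0 \<longleftrightarrow> x = y"
  using add_eq_0_iff2 by simp

end

text \<open>The vector space over the field with two elements with basis \<open>'a\<close>: a vector is its support,
  and addition is the symmetric difference.\<close>

typedef 'a fvec = "{A :: 'a set. finite A}"
  morphisms supp Fvec by blast

setup_lifting type_definition_fvec

lemma finite_supp [simp]: "finite (supp x)"
  using supp by blast

instantiation fvec :: (type) char_two_group
begin

lift_definition zero_fvec :: "'a fvec" is "{}" by simp
lift_definition plus_fvec :: "'a fvec \<Rightarrow> 'a fvec \<Rightarrow> 'a fvec" is "\<lambda>A B. (A - B) \<union> (B - A)" by simp
lift_definition uminus_fvec :: "'a fvec \<Rightarrow> 'a fvec" is "\<lambda>A. A" .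
definition minus_fvec :: "'a fvec \<Rightarrow> 'a fvec \<Rightarrow> 'a fvec" where "minus_fvec x y = x + - y"

instance
  by standard (simp add: minus_fvec_def | (transfer, blast))+

end

lift_definition unit :: "'a \<Rightarrow> 'a fvec" is "\<lambda>a. {a}" by simp

lemma supp_zero [simp]: "supp 0 = {}"
  by transfer rule

lemma supp_unit [simp]: "supp (unit a) = {a}"
  by transfer rule

lemma supp_add: "a \<in> supp (x + y) \<longleftrightarrow> (a \<in> supp x) \<noteq> (a \<in> supp y)"
  by transfer blast

lemma fvec_induct [case_names zero unit add]:
  assumes "P 0" "\<And>a. P (unit a)" "\<And>x y. P x \<Longrightarrow> P y \<Longrightarrow> P (x + y)"
  shows "P x"
proof (induction "card (supp x)" arbitrary: x)
  case 0
  then have "supp x = supp 0" by simp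
  then have "x = 0" by (simp only: supp_inject)
  then show ?case using assms(1) by simp
next
  case (Suc n)
  then obtain a where a: "a \<in> supp x" by fastforce
  have "supp (x + unit a) = supp x - {a}" using a by (auto simp: supp_add)
  with Suc a have "P (x + unit a)" by simp
  then have "P ((x + unit a) + unit a)" using assms by blast
  then show ?case by (simp add: add.assoc)
qed

text \<open>The linear extension of a map given on the basis. All nonzero coefficients are 1, so a
  plain sum over the support computes it.\<close>

definition lin :: "('a \<Rightarrow> 'b::char_two_group) \<Rightarrow> 'a fvec \<Rightarrow> 'b" where
  "lin f x = (\<Sum>a\<in>supp x. f a)"

lemma lin_zero [simp]: "lin f 0 = 0"
  by (simp add: lin_def)

lemma lin_unit [simp]: "lin f (unit a) = f a"
  by (simp add: lin_def)

lemma lin_add [simp]: "lin f (x + y) = lin f x + lin f y"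
proof -
  let ?U = "supp x \<union> supp y"
  have *: "lin f z = (\<Sum>a\<in>?U. if a \<in> supp z then f a else 0)" if "supp z \<subseteq> ?U" for z
    using that unfolding lin_def by (intro sum.mono_neutral_cong_left) auto
  have "lin f (x + y) = (\<Sum>a\<in>?U. if a \<in> supp (x + y) then f a else 0)"
    by (rule *) (auto simp: supp_add)
  also have "\<dots> = (\<Sum>a\<in>?U. (if a \<in> supp x then f a else 0) + (if a \<in> supp y then f a else 0))"
    by (rule sum.cong) (auto simp: supp_add)
  also have "\<dots> = lin f x + lin f y"
    using *[of x] *[of y] by (simp add: sum.distrib)
  finally show ?thesis .
qed

lemma lin_lin: "lin f (lin g x) = lin (\<lambda>a. lin f (g a)) x"
  by (induction x rule: fvec_induct) auto

lemma lin_unit_id [simp]: "lin unit x = x"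
  by (induction x rule: fvec_induct) auto

lemma lin_swap: "lin (\<lambda>a. lin (\<lambda>b. f a b) y) x = lin (\<lambda>b. lin (\<lambda>a. f a b) x) y"
  unfolding lin_def by (rule sum.swap)

text \<open>The second termination measure, after the length. Only strict inversions count: a
  repeated letter is removed by shortening the word, never by a swap.\<close>

fun inversions :: "nat list \<Rightarrow> nat" where
  "inversions [] = 0"
| "inversions (x # xs) = length (filter (\<lambda>y. y < x) xs) + inversions xs"

lemma inversions_swap: "c < b \<Longrightarrow> inversions (p @ c # b # q) < inversions (p @ b # c # q)"
  by (induction p) auto

text \<open>By the pivot argument below (\<open>two_lie_fvec_code\<close>) every countable 2-Lie algebra embeds into
  one whose underlying space is \<open>nat fvec\<close>.\<close>

locale two_lie_fvec =
  fixes br :: "nat fvec \<Rightarrow> nat fvec \<Rightarrow> nat fvec" and sqr :: "nat fvec \<Rightarrow> nat fvec"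
  assumes br_add_left: "br (x + y) z = br x z + br y z"
    and br_add_right: "br x (y + z) = br x y + br x z"
    and br_self: "br x x = 0"
    and br_jacobi: "br x (br y z) + br y (br z x) + br z (br x y) = 0"
    and br_sqr: "br x (sqr y) = br (br x y) y"
    and sqr_add: "sqr (x + y) = sqr x + sqr y + br x y"
begin

lemma sqr_zero [simp]: "sqr 0 = 0"
  using sqr_add[of 0 0] br_self[of 0] by simp

lemma br_zero [simp]: "br 0 x = 0" "br x 0 = 0"
  using br_add_left[of 0 0 x] br_add_right[of x 0 0] by simp_all

lemma br_comm: "br x y = br y x"
proof -
  have "br (x + y) (x + y) = br x y + br y x"
    by (simp only: br_add_left br_add_right) (simp add: br_self)
  then show ?thesis by (simp add: br_self char_two_eq_iff)
qed

text \<open>In the restricted enveloping algebra \<open>b c = c b + [b, c]\<close> for distinct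
  letters and \<open>b b = b^[2]\<close>; this is the length-one term of either rule.\<close>

definition corr :: "nat \<Rightarrow> nat \<Rightarrow> nat fvec" where
  "corr b c = (if b = c then sqr (unit b) else br (unit b) (unit c))"

text \<open>The map \<open>sigma\<close> sends a word to its normal form, a combination of strictly increasing words, in
  the restricted enveloping algebra. The choice of the descent to be reduced first is immaterial by
  \<open>sigma_reduce\<close>, which is the Poincare-Birkhoff-Witt theorem.\<close>

definition descent :: "nat list \<Rightarrow> nat list \<times> nat \<times> nat \<times> nat list" where
  "descent w = (SOME (p, b, c, q). w = p @ b # c # q \<and> c \<le> b)"

lemma descent:
  assumes "descent w = (p, b, c, q)" "\<exists>p b c q. w = p @ b # c # q \<and> c \<le> b"
  shows "w = p @ b # c # q \<and> c \<le> b"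
proof -
  have "case descent w of (p, b, c, q) \<Rightarrow> w = p @ b # c # q \<and> c \<le> b"
    unfolding descent_def by (rule someI_ex) (use assms(2) in auto)
  with assms(1) show ?thesis by simp
qed

function sigma :: "nat list \<Rightarrow> nat list fvec" where
  "sigma w = (if \<exists>p b c q. w = p @ b # c # q \<and> c \<le> b
     then (case descent w of (p, b, c, q) \<Rightarrow>
       (if c < b then sigma (p @ c # b # q) else 0) + (\<Sum>d\<in>supp (corr b c). sigma (p @ d # q)))
     else unit w)"
  by pat_completeness auto
termination sigma
\<comment> \<open>A swap keeps the length and removes an inversion; a correction term replaces two
  letters by one.\<close>
proof (relation "measures [length, inversions]", goal_cases)
  case (2 w p y b z c q)
  then have "descent w = (p, b, c, q)" by simp
  then have "w = p @ b # c # q" using descent 2(1) by blast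
  then show ?case using \<open>c < b\<close> by (simp add: inversions_swap)
next
  case (3 w p y b z c q d)
  then have "descent w = (p, b, c, q)" by simp
  then have "w = p @ b # c # q" using descent 3(1) by blast
  then show ?case by simp
qed simp

declare sigma.simps [simp del]

text \<open>The normal form of a product whose middle factor is an element of the Lie algebra
  instead of a basis letter. Correction terms have this shape.\<close>

definition insert_lin :: "nat list \<Rightarrow> nat fvec \<Rightarrow> nat list \<Rightarrow> nat list fvec" where
  "insert_lin p v q = lin (\<lambda>d. sigma (p @ d # q)) v"

lemma insert_lin_simps [simp]:
  "insert_lin p 0 q = 0"
  "insert_lin p (x + y) q = insert_lin p x q + insert_lin p y q"
  "insert_lin p (unit d) q = sigma (p @ d # q)"
  by (simp_all add: insert_lin_def)

text \<open>The condition is \<open>b \<noteq> c\<close> and not \<open>c < b\<close>, so that the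
  right-hand side of the rewriting rule also makes sense at an ascent, where it is the same relation
  read backwards.\<close>

definition reduct :: "nat list \<Rightarrow> nat \<Rightarrow> nat \<Rightarrow> nat list \<Rightarrow> nat list fvec" where
  "reduct p b c q = (if b \<noteq> c then sigma (p @ c # b # q) else 0) + insert_lin p (corr b c) q"

lemma sigma_increasing:
  "(\<And>p b c q. w = p @ b # c # q \<Longrightarrow> b < c) \<Longrightarrow> sigma w = unit w"
  by (subst sigma.simps) (auto simp: not_le[symmetric])

lemma sigma_descent:
  assumes "w = p @ b # c # q" "c \<le> b"
  obtains p' b' c' q' where "w = p' @ b' # c' # q'" "c' \<le> b'" "sigma w = reduct p' b' c' q'"
proof -
  have ex: "\<exists>p b c q. w = p @ b # c # q \<and> c \<le> b" using assms by blast
  obtain p' b' c' q' where d: "descent w = (p', b', c', q')" by (cases "descent w") auto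
  have "sigma w = reduct p' b' c' q'"
    using ex descent[OF d ex] d
    by (subst sigma.simps) (auto simp: reduct_def insert_lin_def lin_def)
  with that descent[OF d ex] show thesis by blast
qed

lemma corr_comm: "corr b c = corr c b"
  by (auto simp: corr_def br_comm)

text \<open>Because \<open>corr\<close> is symmetric, the relations at \<open>b c\<close> and at
  \<open>c b\<close> are one and the same equation in characteristic 2.\<close>

lemma reduct_swap:
  assumes "sigma (p @ b # c # q) = reduct p b c q"
  shows "sigma (p @ c # b # q) = reduct p c b q"
  using assms by (auto simp: reduct_def corr_comm[of b c] add.assoc)

text \<open>Two overlapping reductions are resolved by the Jacobi identity and by
  \<open>[x, y\<^bsup>[2]\<^esup>] = [[x, y], y]\<close>.\<close>

lemma overlap:
  assumes IH: "\<And>p' b' c' q'. length p' + length q' < length p + length q + 1 \<Longrightarrow>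
      sigma (p' @ b' # c' # q') = reduct p' b' c' q'"
    and inv: "\<And>p' b' c' q'. \<lbrakk>length p' + length q' = length p + length q + 1;
      c' \<le> b';
      inversions (p' @ b' # c' # q') < inversions (p @ a # b # c # q)\<rbrakk> \<Longrightarrow>
      sigma (p' @ b' # c' # q') = reduct p' b' c' q'"
    and "c \<le> b" "b \<le> a"
  shows "reduct p a b (c # q) = reduct (p @ [a]) b c q"
proof -
  \<comment> \<open>Moves a letter past an inserted vector at the price of their bracket. On a basis
    letter this is the induction hypothesis, the words being one letter shorter than the
    overlap.\<close>
  have L: "lin (\<lambda>d. sigma (p @ d # c # q)) v + lin (\<lambda>d. sigma (p @ c # d # q)) v
      = insert_lin p (br v (unit c)) q" for v c
  proof (induction v rule: fvec_induct)
    case (unit d)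
    show ?case using IH[of p q d c] by (auto simp: reduct_def corr_def br_self ac_simps)
  qed (simp_all add: br_add_left ac_simps)
  have L1: "insert_lin p v (c # q) = insert_lin (p @ [c]) v q + insert_lin p (br v (unit c)) q" for v c
    using char_two_move[OF L[of c v]] by (simp add: insert_lin_def)
  consider "c < b" "b < a" | "c = b" "b < a" | "c < b" "b = a" | "c = b" "b = a"
    using assms(3,4) by linarith
  then show ?thesis
  proof cases
    case 1
    \<comment> \<open>The two paths from \<open>a b c\<close> down to \<open>c b a\<close> run
      through \<open>b a c\<close>, \<open>b c a\<close> and through \<open>a c b\<close>,
      \<open>c a b\<close>. All four words have fewer inversions, so each may be reduced at the
      place that its path prescribes.\<close>
    have i1: "inversions (p @ b # a # c # q) < inversions (p @ a # b # c # q)"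
      using inversions_swap[of b a p "c # q"] 1 by simp
    have i2: "inversions (p @ b # c # a # q) < inversions (p @ a # b # c # q)"
      using inversions_swap[of c a "p @ [b]" q] 1 i1 by simp
    have i3: "inversions (p @ a # c # b # q) < inversions (p @ a # b # c # q)"
      using inversions_swap[of c b "p @ [a]" q] 1 by simp
    have i4: "inversions (p @ c # a # b # q) < inversions (p @ a # b # c # q)"
      using inversions_swap[of c a p "b # q"] 1 i3 by simp
    have e1: "sigma (p @ b # a # c # q) = reduct (p @ [b]) a c q"
      using inv[of "p @ [b]" q c a] i1 1 by simp
    have e2: "sigma (p @ b # c # a # q) = reduct p b c (a # q)"
      using inv[of p "a # q" c b] i2 1 by simp
    have e3: "sigma (p @ a # c # b # q) = reduct p a c (b # q)"
      using inv[of p "b # q" c a] i3 1 by simp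
    have e4: "sigma (p @ c # a # b # q) = reduct (p @ [c]) a b q"
      using inv[of "p @ [c]" q b a] i4 1 by simp
    have "br (br (unit a) (unit b)) (unit c) + br (br (unit b) (unit c)) (unit a)
        = br (br (unit a) (unit c)) (unit b)"
      using br_jacobi[of "unit a" "unit b" "unit c"] by (simp add: br_comm char_two_eq_iff ac_simps)
    then have "insert_lin p (br (br (unit a) (unit b)) (unit c)) q +
        insert_lin p (br (br (unit b) (unit c)) (unit a)) q
        = insert_lin p (br (br (unit a) (unit c)) (unit b)) q"
      by (simp flip: insert_lin_simps(2))
    then show ?thesis
      using 1 by (simp add: reduct_def e1 e2 e3 e4 corr_def L1 ac_simps)
  next
    case 2
    have i1: "inversions (p @ b # a # b # q) < inversions (p @ a # b # b # q)"
      using inversions_swap[of b a p "b # q"] 2 by simp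
    have e1: "sigma (p @ b # a # b # q) = reduct (p @ [b]) a b q"
      using inv[of "p @ [b]" q b a] i1 2 by simp
    have i2: "inversions (p @ b # b # a # q) < inversions (p @ a # b # b # q)"
      using inversions_swap[of b a "p @ [b]" q] 2 i1 by simp
    have e2: "sigma (p @ b # b # a # q) = reduct p b b (a # q)"
      using inv[of p "a # q" b b] i2 2 by simp
    have "br (sqr (unit b)) (unit a) = br (br (unit a) (unit b)) (unit b)"
      using br_sqr[of "unit a" "unit b"] by (simp add: br_comm)
    then show ?thesis
      using 2 by (simp add: reduct_def e1 e2 corr_def L1 ac_simps)
  next
    case 3
    have i1: "inversions (p @ a # c # a # q) < inversions (p @ a # a # c # q)"
      using inversions_swap[of c a "p @ [a]" q] 3 by simp
    have e1: "sigma (p @ a # c # a # q) = reduct p a c (a # q)"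
      using inv[of p "a # q" c a] i1 3 by simp
    have i2: "inversions (p @ c # a # a # q) < inversions (p @ a # a # c # q)"
      using inversions_swap[of c a p "a # q"] 3 i1 by simp
    have e2: "sigma (p @ c # a # a # q) = reduct (p @ [c]) a a q"
      using inv[of "p @ [c]" q a a] i2 3 by simp
    have "br (sqr (unit a)) (unit c) = br (br (unit a) (unit c)) (unit a)"
      using br_sqr[of "unit c" "unit a"] by (simp add: br_comm)
    then show ?thesis
      using 3 by (simp add: reduct_def e1 e2 corr_def L1 ac_simps)
  next
    case 4
    have "br (sqr (unit a)) (unit a) = 0"
      using br_sqr[of "unit a" "unit a"] by (simp add: br_comm br_self)
    then show ?thesis
      using 4 by (simp add: reduct_def corr_def L1)
  qed
qed

text \<open>After a reduction at one place the other place is untouched and can still be reduced.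
  Both orders lead to the same terms; those with two corrections agree by
  \<open>lin_swap\<close>.\<close>

lemma disjoint:
  assumes IH: "\<And>p' b' c' q'. length p' + length q' < length p + length m + length q + 2 \<Longrightarrow>
      sigma (p' @ b' # c' # q') = reduct p' b' c' q'"
    and inv: "\<And>p' b' c' q'. \<lbrakk>length p' + length q' = length p + length m + length q + 2;
      c' \<le> b';
      inversions (p' @ b' # c' # q') < inversions (p @ a # b # m @ c # d # q)\<rbrakk> \<Longrightarrow>
      sigma (p' @ b' # c' # q') = reduct p' b' c' q'"
    and "b \<le> a" "d \<le> c"
  shows "reduct p a b (m @ c # d # q) = reduct (p @ a # b # m) c d q"
proof -
  have e1: "sigma (p @ b # a # m @ c # d # q) = reduct (p @ b # a # m) c d q" if "a \<noteq> b"
    using that inv[of "p @ b # a # m" q d c] assms(3,4) inversions_swap[of b a p "m @ c # d # q"]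
    by simp
  have e2: "sigma (p @ a # b # m @ d # c # q) = reduct p a b (m @ d # c # q)" if "c \<noteq> d"
    using that inv[of p "m @ d # c # q" b a] assms(3,4)
      inversions_swap[of d c "p @ a # b # m" q] by simp
  have e3: "insert_lin p v (m @ c # d # q) =
      (if c \<noteq> d then insert_lin p v (m @ d # c # q) else 0)
      + lin (\<lambda>x. insert_lin (p @ x # m) (corr c d) q) v" for v
  proof (induction v rule: fvec_induct)
    case (unit x)
    show ?case using IH[of "p @ x # m" q c d] by (simp add: reduct_def)
  next
    case (add v w)
    show ?case unfolding insert_lin_simps lin_add add by (simp add: ac_simps)
  qed simp
  have e4: "insert_lin (p @ a # b # m) v q =
      (if a \<noteq> b then insert_lin (p @ b # a # m) v q else 0)
      + lin (\<lambda>x. insert_lin p (corr a b) (m @ x # q)) v" for v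
  proof (induction v rule: fvec_induct)
    case (unit x)
    show ?case using IH[of p "m @ x # q" a b] by (simp add: reduct_def)
  next
    case (add v w)
    show ?case unfolding insert_lin_simps lin_add add by (simp add: ac_simps)
  qed simp
  have "lin (\<lambda>x. insert_lin (p @ x # m) (corr c d) q) (corr a b)
      = lin (\<lambda>x. insert_lin p (corr a b) (m @ x # q)) (corr c d)"
    unfolding insert_lin_def append_assoc append_Cons by (rule lin_swap)
  then show ?thesis
    unfolding reduct_def e3[of "corr a b"] e4[of "corr c d"]
    using e1 e2 by (cases "a = b"; cases "c = d") (simp_all add: reduct_def ac_simps)
qed

text \<open>The diamond lemma, by induction on length and inversions: the descent chosen by
  \<open>sigma\<close> and the given one coincide, overlap in a letter or are disjoint, and
  \<open>overlap\<close> and \<open>disjoint\<close> compare the two results.\<close>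

lemma sigma_reduce_aux:
  assumes "w = p @ b # c # q" "c \<le> b"
  shows "sigma w = reduct p b c q"
  using assms
proof (induction w arbitrary: p b c q rule: wf_induct_rule[OF wf_measures[of "[length, inversions]"]])
  case (1 w)
  have IH0: "sigma (p' @ b' # c' # q') = reduct p' b' c' q'"
    if "length (p' @ b' # c' # q') < length w" "c' \<le> b'" for p' b' c' q'
    using that by (intro 1(1)) auto
  \<comment> \<open>For shorter words the hypothesis extends from descents to all adjacent pairs, by
    \<open>reduct_swap\<close>.\<close>
  have IH1: "sigma (p' @ b' # c' # q') = reduct p' b' c' q'"
    if "length p' + length q' + 2 < length w" for p' b' c' q'
    using that IH0[of p' b' c' q'] IH0[of p' c' b' q'] reduct_swap[of p' c' b' q']
    by (cases "c' \<le> b'") auto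
  have IH2: "sigma (p' @ b' # c' # q') = reduct p' b' c' q'"
    if "length p' + length q' + 2 = length w" "c' \<le> b'"
      "inversions (p' @ b' # c' # q') < inversions w" for p' b' c' q'
    using that by (intro 1(1)) auto
  have ov: "reduct r x y (z # s) = reduct (r @ [x]) y z s"
    if "w = r @ x # y # z # s" "z \<le> y" "y \<le> x" for r x y z s
    by (rule overlap) (use that in \<open>simp_all add: IH1 IH2\<close>)
  have dj: "reduct r x y (t @ z # u # s) = reduct (r @ x # y # t) z u s"
    if "w = r @ x # y # t @ z # u # s" "y \<le> x" "u \<le> z" for r x y t z u s
    by (rule disjoint) (use that in \<open>simp_all add: IH1 IH2\<close>)
  have conf: "reduct p1 b1 c1 q1 = reduct p2 b2 c2 q2"
    if w1: "w = p1 @ b1 # c1 # q1" "c1 \<le> b1" and w2: "w = p2 @ b2 # c2 # q2" "c2 \<le> b2"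
      and le: "length p1 \<le> length p2" for p1 b1 c1 q1 p2 b2 c2 q2
  proof -
    \<comment> \<open>The offset \<open>t\<close> between the two places decides: empty means the
      same descent, one letter an overlap, two or more letters disjoint descents.\<close>
    obtain t where t: "p2 = p1 @ t" "b1 # c1 # q1 = t @ b2 # c2 # q2"
      using w1(1) w2(1) le by (auto simp: append_eq_append_conv2)
    show ?thesis
    proof (cases t)
      case Nil
      then show ?thesis using t by simp
    next
      case (Cons x t')
      show ?thesis
      proof (cases t')
        case Nil
        then show ?thesis using t Cons w1 w2 ov[of p1 b1 c1 c2 q2] by auto
      next
        case (Cons y t'')
        then show ?thesis using t \<open>t = x # t'\<close> w1 w2 dj[of p1 b1 c1 t'' b2 c2 q2] by auto
      qed
    qed
  qed
  obtain p' b' c' q' where "w = p' @ b' # c' # q'" "c' \<le> b'" "sigma w = reduct p' b' c' q'"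
    using sigma_descent[OF 1(2,3)] .
  then show ?case
    using conf[of p b c q p' b' c' q'] conf[of p' b' c' q' p b c q] 1(2,3)
    by (cases "length p \<le> length p'") auto
qed

lemma sigma_reduce: "sigma (p @ b # c # q) = reduct p b c q"
proof (cases "c \<le> b")
  case True
  then show ?thesis by (rule sigma_reduce_aux[OF HOL.refl])
next
  case False
  then have "b \<le> c" by simp
  from reduct_swap[OF sigma_reduce_aux[OF HOL.refl this]] show ?thesis .
qed

text \<open>A reduction inside \<open>w\<close> is also a reduction inside \<open>p @ w\<close>, so
  normalising a right factor beforehand changes nothing. This makes left multiplication on normal
  forms an action.\<close>

lemma sigma_sigma: "lin (\<lambda>w. sigma (p @ w)) (sigma w) = sigma (p @ w)"
proof (induction w rule: wf_induct_rule[OF wf_measures[of "[length, inversions]"]])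
  case (1 w)
  show ?case
  proof (cases "\<exists>r b c q. w = r @ b # c # q \<and> c \<le> b")
    case True
    then obtain r b c q where w: "w = r @ b # c # q" "c \<le> b" by blast
    have *: "lin (\<lambda>w. sigma (p @ w)) (insert_lin r v q) = insert_lin (p @ r) v q" for v
    proof (induction v rule: fvec_induct)
      case (unit d)
      show ?case using 1[of "r @ d # q"] w by simp
    qed auto
    have "lin (\<lambda>w. sigma (p @ w)) (sigma (r @ c # b # q)) = sigma (p @ r @ c # b # q)" if "c < b"
      using that 1[of "r @ c # b # q"] w inversions_swap[of c b r q] by simp
    then show ?thesis
      using w sigma_reduce[of r b c q] sigma_reduce[of "p @ r" b c q] *
      by (auto simp: reduct_def)
  next
    case False
    then have "b < c" if "w = r @ b # c # q" for r b c q using that not_le by blast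
    then have "sigma w = unit w" by (rule sigma_increasing)
    then show ?thesis by simp
  qed
qed

end

section \<open>A faithful representation of a countable 2-Lie algebra\<close>

class char_two_ring = ring_1 + char_two_group

instance fps :: (char_two_group) char_two_group
  by standard (simp add: fps_eq_iff)

instance fps :: (char_two_ring) char_two_ring ..

text \<open>The associative algebra of the representation. Additivity is linearity over the field
  with two elements. As a type it can be a ring instance and serve as the coefficient ring of power
  series.\<close>

typedef endo = "{f :: nat list fvec \<Rightarrow> nat list fvec. \<forall>x y. f (x + y) = f x + f y}"
  morphisms app Endo by (rule exI[of _ id]) simp

setup_lifting type_definition_endo

lemma app_add [simp]: "app f (x + y) = app f x + app f y"
  using app by blast

lemma app_zero [simp]: "app f 0 = 0"
  using app_add[of f 0 0] by (metis add_cancel_left_left)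

instantiation endo :: char_two_ring
begin

lift_definition zero_endo :: endo is "\<lambda>x. 0" by simp
lift_definition one_endo :: endo is "\<lambda>x. x" by simp
lift_definition plus_endo :: "endo \<Rightarrow> endo \<Rightarrow> endo" is "\<lambda>f g x. f x + g x"
  by (simp add: ac_simps)
lift_definition times_endo :: "endo \<Rightarrow> endo \<Rightarrow> endo" is "\<lambda>f g x. f (g x)"
  by simp
definition uminus_endo :: "endo \<Rightarrow> endo" where "uminus_endo f = f"
definition minus_endo :: "endo \<Rightarrow> endo \<Rightarrow> endo" where "minus_endo f g = f + g"

lemma app_simps [simp]:
  "app 0 x = 0" "app 1 x = x" "app (f + g) x = app f x + app g x" "app (f * g) x = app f (app g x)"
  by (simp_all add: zero_endo.rep_eq one_endo.rep_eq plus_endo.rep_eq times_endo.rep_eq)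

lemma endo_ext: "(\<And>x. app f x = app g x) \<Longrightarrow> f = g"
  by (simp add: app_inject[symmetric] fun_eq_iff)

instance
proof
  show "0 \<noteq> (1 :: endo)"
  proof
    assume "0 = (1 :: endo)"
    then have "app 0 (unit []) = app 1 (unit [])" by simp
    then have "supp (unit []) = supp (0 :: nat list fvec)" by simp
    then show False by simp
  qed
qed (rule endo_ext, simp add: uminus_endo_def minus_endo_def ac_simps)+

end

lemma endo_eqI: "(\<And>w. app f (unit w) = app g (unit w)) \<Longrightarrow> f = g"
proof -
  assume a: "\<And>w. app f (unit w) = app g (unit w)"
  have "app f x = app g x" for x
    by (induction x rule: fvec_induct) (simp_all add: a)
  then show "f = g" by (rule endo_ext)
qed

context two_lie_fvec
begin

text \<open>The left regular action on the enveloping algebra: multiply by \<open>v\<close> on the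
  left, then normalise. It is written on all words, which spares a separate type of increasing
  words.\<close>

definition rho :: "nat fvec \<Rightarrow> endo" where
  "rho v = Endo (\<lambda>x. lin (\<lambda>w. insert_lin [] v w) x)"

lemma app_rho: "app (rho v) x = lin (\<lambda>w. insert_lin [] v w) x"
  unfolding rho_def by (subst Endo_inverse) auto

lemma rho_add: "rho (u + v) = rho u + rho v"
  by (rule endo_eqI) (simp add: app_rho)

lemma rho_zero: "rho 0 = 0"
  by (rule endo_eqI) (simp add: app_rho)

lemma sigma_sigma_Cons: "lin (\<lambda>w. sigma (b # w)) (sigma v) = sigma (b # v)"
  using sigma_sigma[of "[b]" v] by simp

text \<open>The inner normalisation of a product is absorbed by \<open>sigma_sigma_Cons\<close>;
  what remains is \<open>sigma_reduce\<close> at the front of a word.\<close>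

lemma rho_unit_reduce:
  "rho (unit b) * rho (unit c) = (if b \<noteq> c then rho (unit c) * rho (unit b) else 0) + rho (corr b c)"
  by (rule endo_eqI)
    (use sigma_reduce[of "[]" b c] in \<open>auto simp: app_rho sigma_sigma_Cons reduct_def\<close>)

lemma rho_br: "rho (br u v) = rho u * rho v + rho v * rho u"
proof (induction u rule: fvec_induct)
  case (unit b)
  show ?case
  proof (induction v rule: fvec_induct)
    case (unit c)
    show ?case using rho_unit_reduce[of b c] by (auto simp: corr_def br_self rho_zero ac_simps)
  qed (simp_all add: rho_add rho_zero br_add_right distrib_left distrib_right ac_simps)
qed (simp_all add: rho_add rho_zero br_add_left distrib_left distrib_right ac_simps)

lemma rho_sqr: "rho (sqr u) = rho u * rho u"
proof (induction u rule: fvec_induct)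
  case (unit b)
  show ?case using rho_unit_reduce[of b b] by (simp add: corr_def)
qed (simp_all add: rho_add rho_zero sqr_add rho_br distrib_left distrib_right ac_simps)

text \<open>One-letter words are already normal, so acting on the empty word returns
  \<open>v\<close> letter by letter, and \<open>hd\<close> reads it back.\<close>

lemma inj_rho: "inj rho"
proof (rule injI)
  have *: "app (rho v) (unit []) = lin (\<lambda>d. unit [d]) v" for v
  proof -
    have "sigma [d] = unit [d]" for d by (rule sigma_increasing) simp
    then show ?thesis by (simp add: app_rho insert_lin_def)
  qed
  have inv: "lin (\<lambda>w. unit (hd w)) (lin (\<lambda>d. unit [d]) v) = v" for v :: "nat fvec"
    by (simp add: lin_lin)
  fix u v assume "rho u = rho v"
  then show "u = v" using * inv by metis
qed

end

lemma (in two_lie_fvec) ex_rho: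
  "\<exists>r :: nat fvec \<Rightarrow> endo. inj r \<and> (\<forall>u v. r (u + v) = r u + r v) \<and>
    (\<forall>u v. r (br u v) = r u * r v + r v * r u) \<and> (\<forall>u. r (sqr u) = r u * r u)"
  using inj_rho rho_add rho_br rho_sqr by blast

section \<open>Realising a countable 2-Lie algebra on the vector space with basis
  \<open>nat\<close>\<close>

context two_lie_algebra
begin

text \<open>Below, \<open>e\<close> enumerates the whole carrier, a spanning family full of linear
  relations. This is the projection from the free vector space on its indices; a complement of the
  kernel is found by elimination.\<close>

definition decode :: "(nat \<Rightarrow> 'a) \<Rightarrow> nat fvec \<Rightarrow> 'a" where
  "decode e x = (\<Oplus>n\<in>supp x. e n)"

context
  fixes e :: "nat \<Rightarrow> 'a"
  assumes e: "range e = carrier L"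
begin

lemma e_closed [simp]: "e n \<in> carrier L"
  using e by blast

lemma decode_closed [simp]: "decode e x \<in> carrier L"
  unfolding decode_def by (rule finsum_closed) auto

lemma decode_zero [simp]: "decode e 0 = \<zero>"
  by (simp add: decode_def)

lemma add_self_left: "x \<in> carrier L \<Longrightarrow> y \<in> carrier L \<Longrightarrow> x \<oplus> (x \<oplus> y) = y"
  by (simp add: a_assoc[symmetric] add_self)

lemma decode_add_unit: "decode e (x + unit a) = decode e x \<oplus> e a"
proof (cases "a \<in> supp x")
  case True
  then have s: "supp x = insert a (supp (x + unit a))" "a \<notin> supp (x + unit a)"
    by (auto simp: supp_add)
  have "decode e x = e a \<oplus> decode e (x + unit a)"
    unfolding decode_def by (subst s(1), subst finsum_insert) (use s(2) in auto)
  then show ?thesis by (metis a_comm add_self_left decode_closed e_closed)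
next
  case False
  then have s: "supp (x + unit a) = insert a (supp x)"
    by (auto simp: supp_add)
  show ?thesis
    unfolding decode_def s by (subst finsum_insert) (use False in \<open>auto intro!: a_comm finsum_closed\<close>)
qed

lemma decode_unit [simp]: "decode e (unit a) = e a"
  using decode_add_unit[of 0 a] by simp

lemma decode_add [simp]: "decode e (x + y) = decode e x \<oplus> decode e y"
proof (induction y arbitrary: x rule: fvec_induct)
  case (add y z)
  show ?case unfolding add.assoc[symmetric] add by (simp add: add a_assoc)
qed (simp_all add: decode_add_unit)

text \<open>The vectors without a pivot in their support form a complement of the kernel of \<open>decode\<close>,
  whence an additive section \<open>code\<close>.\<close>

definition pivot :: "nat \<Rightarrow> bool" where
  "pivot n \<longleftrightarrow> (\<exists>z. decode e z = \<zero> \<and> n \<in> supp z \<and> (\<forall>k\<in>supp z. k \<le> n))"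

definition reduced :: "nat fvec \<Rightarrow> bool" where
  "reduced x \<longleftrightarrow> (\<forall>n\<in>supp x. \<not> pivot n)"

text \<open>Gaussian elimination from the top: a kernel vector with largest index \<open>n\<close>
  clears that index and otherwise touches only smaller ones, so the bound on the remaining pivots
  drops.\<close>

lemma reduced_exists_aux:
  "(\<forall>k\<in>supp x. pivot k \<longrightarrow> k < n) \<Longrightarrow> \<exists>y. reduced y \<and> decode e y = decode e x"
proof (induction n arbitrary: x)
  case 0
  then show ?case by (auto simp: reduced_def)
next
  case (Suc n)
  show ?case
  proof (cases "n \<in> supp x \<and> pivot n")
    case True
    then obtain z where z: "decode e z = \<zero>" "n \<in> supp z" "\<forall>k\<in>supp z. k \<le> n"
      by (auto simp: pivot_def)
    have "\<forall>k\<in>supp (x + z). pivot k \<longrightarrow> k < n"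
    proof (intro ballI impI)
      fix k assume k: "k \<in> supp (x + z)" "pivot k"
      have "k \<noteq> n" using k True z by (auto simp: supp_add)
      moreover have "k \<le> n" using k z Suc.prems by (force simp: supp_add)
      ultimately show "k < n" by simp
    qed
    from Suc.IH[OF this] show ?thesis by (simp add: z)
  next
    case False
    then have "\<forall>k\<in>supp x. pivot k \<longrightarrow> k < n"
      using Suc.prems by (metis less_Suc_eq)
    then show ?thesis by (rule Suc.IH)
  qed
qed

lemma reduced_exists: "\<exists>y. reduced y \<and> decode e y = decode e x"
proof (rule reduced_exists_aux)
  show "\<forall>k\<in>supp x. pivot k \<longrightarrow> k < Suc (Max (supp x))"
    by (auto simp: less_Suc_eq_le)
qed

lemma reduced_add: "reduced x \<Longrightarrow> reduced y \<Longrightarrow> reduced (x + y)"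
  by (auto simp: reduced_def supp_add)

text \<open>The sum of the two vectors is reduced and lies in the kernel; were it nonzero, the
  largest index of its support would be a pivot.\<close>

lemma reduced_unique:
  assumes "reduced x" "reduced y" "decode e x = decode e y"
  shows "x = y"
proof (rule ccontr)
  assume "x \<noteq> y"
  then have "x + y \<noteq> 0" by (simp add: char_two_eq_iff)
  then have "supp (x + y) \<noteq> {}" by (metis supp_inject supp_zero)
  then have M: "Max (supp (x + y)) \<in> supp (x + y)" by simp
  then have "pivot (Max (supp (x + y)))"
    unfolding pivot_def by (intro exI[of _ "x + y"]) (simp add: assms(3) add_self)
  then show False using reduced_add[OF assms(1,2)] M by (auto simp: reduced_def)
qed

definition code :: "'a \<Rightarrow> nat fvec" where
  "code l = (SOME x. reduced x \<and> decode e x = l)"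

lemma code:
  assumes "l \<in> carrier L"
  shows "reduced (code l)" "decode e (code l) = l"
proof -
  obtain n where "l = e n" using assms e by blast
  then have "\<exists>x. reduced x \<and> decode e x = l" using reduced_exists[of "unit n"] by simp
  from someI_ex[OF this] show "reduced (code l)" "decode e (code l) = l"
    by (simp_all add: code_def)
qed

lemma code_unique: "reduced x \<Longrightarrow> decode e x = l \<Longrightarrow> code l = x"
  using reduced_unique code decode_closed by metis

lemma code_add: "x \<in> carrier L \<Longrightarrow> y \<in> carrier L \<Longrightarrow> code (x \<oplus> y) = code x + code y"
  by (rule code_unique) (simp_all add: code reduced_add)

lemma code_zero: "code \<zero> = 0"
  by (rule code_unique) (simp_all add: reduced_def)

text \<open>Since \<open>code\<close> need not be onto, the operations on arbitrary vectors are
  computed in \<open>L\<close> after \<open>decode\<close>. Kernel vectors then have zero brackets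
  and zero squares, and \<open>decode (code l) = l\<close> carries the identities over.\<close>

lemma two_lie_fvec_code:
  "two_lie_fvec (\<lambda>x y. code (bracket L (decode e x) (decode e y))) (\<lambda>x. code (sq L (decode e x)))"
  by standard
    (simp_all add: bracket_closed sq_closed bracket_add_left bracket_add_right code bracket_self
      code_zero jacobi bracket_sq sq_add flip: code_add)

end

text \<open>Countability provides the enumeration, and with it \<open>nat\<close> and its order as
  index set of a basis on which words can be sorted.\<close>

theorem faithful_representation:
  assumes "countable (carrier L)"
  shows "\<exists>j :: 'a \<Rightarrow> endo. inj_on j (carrier L) \<and>
    (\<forall>x\<in>carrier L. \<forall>y\<in>carrier L. j (x \<oplus> y) = j x + j y) \<and>
    (\<forall>x\<in>carrier L. \<forall>y\<in>carrier L. j (bracket L x y) = j x * j y + j y * j x) \<and>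
    (\<forall>x\<in>carrier L. j (sq L x) = j x * j x)"
proof -
  define e where "e = from_nat_into (carrier L)"
  have e: "range e = carrier L"
    unfolding e_def using assms zero_closed by (intro range_from_nat_into) auto
  from two_lie_fvec.ex_rho[OF two_lie_fvec_code[OF e]] obtain r :: "nat fvec \<Rightarrow> endo" where r: "inj r"
    "r (u + v) = r u + r v"
    "r (code e (bracket L (decode e u) (decode e v))) = r u * r v + r v * r u"
    "r (code e (sq L (decode e u))) = r u * r u" for u v
    by blast
  show ?thesis
  proof (intro exI[of _ "\<lambda>x. r (code e x)"] conjI ballI)
    show "inj_on (\<lambda>x. r (code e x)) (carrier L)"
    proof (rule inj_onI)
      fix x y assume xy: "x \<in> carrier L" "y \<in> carrier L" "r (code e x) = r (code e y)"
      from injD[OF r(1) xy(3)] have "decode e (code e x) = decode e (code e y)" by (rule arg_cong)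
      then show "x = y" by (simp only: code(2)[OF e] xy(1,2))
    qed
    fix x y assume x: "x \<in> carrier L" and y: "y \<in> carrier L"
    show "r (code e (x \<oplus> y)) = r (code e x) + r (code e y)"
      by (simp add: code_add[OF e] x y r)
    show "r (code e (bracket L x y)) = r (code e x) * r (code e y) + r (code e y) * r (code e x)"
      using r(3)[of "code e x" "code e y"] by (simp add: code[OF e] x y)
  next
    fix x assume x: "x \<in> carrier L"
    show "r (code e (sq L x)) = r (code e x) * r (code e x)"
      using r(4)[of "code e x"] by (simp add: code[OF e] x)
  qed
qed

end

section \<open>The fastest restricted series of a group\<close>

text \<open>The fastest series \<open>\<Gamma>\<close> with \<open>(\<Gamma>\<^sub>k, \<Gamma>\<^sub>l) \<subseteq> \<Gamma>\<^bsub>k+l\<^esub>\<close> and \<open>g\<^sup>2 \<in> \<Gamma>\<^bsub>2k\<^esub>\<close> for \<open>g \<in> \<Gamma>\<^sub>k\<close>, an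
  \<open>N\<^sub>2\<close>-series in Lazard's terminology.\<close>

inductive N2 :: "('a, 'b) monoid_scheme \<Rightarrow> nat \<Rightarrow> 'a \<Rightarrow> bool" for G (structure) where
  carrier: "x \<in> carrier G \<Longrightarrow> N2 G 1 x"
| weaken: "N2 G (Suc k) x \<Longrightarrow> 1 \<le> k \<Longrightarrow> N2 G k x"
| one: "1 \<le> k \<Longrightarrow> N2 G k \<one>"
| mult: "N2 G k x \<Longrightarrow> N2 G k y \<Longrightarrow> N2 G k (x \<otimes> y)"
| inv: "N2 G k x \<Longrightarrow> N2 G k (inv x)"
| comm: "N2 G a x \<Longrightarrow> N2 G b y \<Longrightarrow> N2 G (a + b) (grp_comm G x y)"
| square: "N2 G a x \<Longrightarrow> N2 G (2 * a) (x \<otimes> x)"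

abbreviation "filt G k \<equiv> Collect (N2 G k)"

definition cl :: "('a, 'b) monoid_scheme \<Rightarrow> nat \<Rightarrow> 'a \<Rightarrow> 'a set" where
  "cl G n g = filt G (Suc n) #>\<^bsub>G\<^esub> g"

text \<open>Cut out of the quotient of the whole group, so that \<open>cl_mult\<close> holds for all
  elements of \<open>G\<close> and not only for those of degree \<open>n\<close>.\<close>

definition gcomp :: "('a, 'b) monoid_scheme \<Rightarrow> nat \<Rightarrow> 'a set monoid" where
  "gcomp G n = (G Mod filt G (Suc n))\<lparr>carrier := cl G n ` filt G n\<rparr>"

context group
begin

abbreviation pow_two (infixl "[^^]" 75) where "x [^^] i \<equiv> x [^] (2 ^ i :: nat)"
abbreviation "com \<equiv> grp_comm G"
abbreviation "\<gamma> \<equiv> lower_central G"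
abbreviation "\<Gamma> \<equiv> lower_2_central G"

section \<open>Commutator identities in an arbitrary group\<close>

lemma cancel_inv [simp]:
  "x \<in> carrier G \<Longrightarrow> y \<in> carrier G \<Longrightarrow> x \<otimes> (inv x \<otimes> y) = y"
  "x \<in> carrier G \<Longrightarrow> y \<in> carrier G \<Longrightarrow> inv x \<otimes> (x \<otimes> y) = y"
  by (simp_all add: m_assoc[symmetric])

text \<open>Expanding commutators and cancelling inverses turns the identities below into equalities
  of freely reduced words.\<close>

lemmas word_simps = grp_comm_def m_assoc inv_mult_group

lemma grp_comm_closed [simp]:
  "x \<in> carrier G \<Longrightarrow> y \<in> carrier G \<Longrightarrow> com x y \<in> carrier G"
  by (simp add: grp_comm_def)

lemma grp_comm_self: "x \<in> carrier G \<Longrightarrow> com x x = \<one>"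
  by (simp add: word_simps)

lemma inv_grp_comm:
  "x \<in> carrier G \<Longrightarrow> y \<in> carrier G \<Longrightarrow> inv (com x y) = com y x"
  by (simp add: word_simps)

lemma grp_comm_mult_left:
  "\<lbrakk>x \<in> carrier G; y \<in> carrier G; z \<in> carrier G\<rbrakk> \<Longrightarrow>
    com (x \<otimes> y) z = com x z \<otimes> com (com x z) y \<otimes> com y z"
  by (simp add: word_simps)

lemma grp_comm_mult_right:
  "\<lbrakk>x \<in> carrier G; y \<in> carrier G; z \<in> carrier G\<rbrakk> \<Longrightarrow>
    com x (y \<otimes> z) = com x z \<otimes> com x y \<otimes> com (com x y) z"
  by (simp add: word_simps)

lemma square_mult:
  "x \<in> carrier G \<Longrightarrow> y \<in> carrier G \<Longrightarrow>
    (x \<otimes> y) \<otimes> (x \<otimes> y) = (x \<otimes> x) \<otimes> com x (inv y) \<otimes> (y \<otimes> y)"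
  by (simp add: word_simps)

lemma conj_grp_comm:
  "\<lbrakk>x \<in> carrier G; y \<in> carrier G; z \<in> carrier G\<rbrakk> \<Longrightarrow>
    z \<otimes> com x y \<otimes> inv z = com (z \<otimes> x \<otimes> inv z) (z \<otimes> y \<otimes> inv z)"
  by (simp add: word_simps)

lemma hall_witt:
  assumes "x \<in> carrier G" "y \<in> carrier G" "z \<in> carrier G"
  shows "(inv y \<otimes> com (com x (inv y)) z \<otimes> y) \<otimes>
    (inv z \<otimes> com (com y (inv z)) x \<otimes> z) \<otimes>
    (inv x \<otimes> com (com z (inv x)) y \<otimes> x) = \<one>"
  using assms by (simp add: word_simps)

section \<open>The filtration \<open>N2\<close> and the classes in its graded pieces\<close>

lemma N2_closed: "N2 G k x \<Longrightarrow> x \<in> carrier G"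
  by (induction rule: N2.induct) auto

lemma N2_pos: "N2 G k x \<Longrightarrow> 1 \<le> k"
  by (induction rule: N2.induct) auto

lemma N2_antimono: "\<lbrakk>N2 G k x; l \<le> k; 1 \<le> l\<rbrakk> \<Longrightarrow> N2 G l x"
proof (induction "k - l" arbitrary: l)
  case (Suc d)
  then have "N2 G (Suc l) x" by simp
  then show ?case using Suc.prems(3) by (rule N2.weaken)
qed simp

lemma N2_comm':
  "\<lbrakk>N2 G a x; N2 G b y; n \<le> a + b; 1 \<le> n\<rbrakk> \<Longrightarrow>
    N2 G n (com x y)"
  using N2.comm N2_antimono by metis

lemma N2_square':
  "\<lbrakk>N2 G a x; n \<le> 2 * a; 1 \<le> n\<rbrakk> \<Longrightarrow> N2 G n (x \<otimes> x)"
  using N2.square N2_antimono by metis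

lemma subgroup_filt: "1 \<le> k \<Longrightarrow> subgroup (filt G k) G"
  by (rule subgroupI) (use N2.one in \<open>auto intro: N2_closed N2.intros\<close>)

lemma N2_conj:
  assumes "N2 G k x" "y \<in> carrier G"
  shows "N2 G k (y \<otimes> x \<otimes> inv y)"
proof -
  have "N2 G k (com x (inv y))"
    using assms N2_pos[OF assms(1)]
    by (intro N2_comm'[OF assms(1) N2.carrier[of "inv y"]]) auto
  moreover have "y \<otimes> x \<otimes> inv y = x \<otimes> com x (inv y)"
    using assms N2_closed[OF assms(1)] by (simp add: word_simps)
  ultimately show ?thesis using assms(1) N2.mult by metis
qed

lemma normal_filt: "1 \<le> k \<Longrightarrow> filt G k \<lhd> G"
  by (auto simp: normal_inv_iff subgroup_filt N2_conj)

lemma group_Mod_filt: "group (G Mod filt G (Suc n))"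
  by (rule normal.factorgroup_is_group) (simp add: normal_filt)

lemma cl_mult:
  "x \<in> carrier G \<Longrightarrow> y \<in> carrier G \<Longrightarrow> cl G n (x \<otimes> y) = cl G n x \<otimes>\<^bsub>gcomp G n\<^esub> cl G n y"
  by (simp add: cl_def gcomp_def FactGroup_def normal.rcos_sum normal_filt)

lemma one_gcomp: "\<one>\<^bsub>gcomp G n\<^esub> = filt G (Suc n)"
  by (simp add: gcomp_def FactGroup_def)

lemma cl_one_iff: "x \<in> carrier G \<Longrightarrow> cl G n x = \<one>\<^bsub>gcomp G n\<^esub> \<longleftrightarrow> N2 G (Suc n) x"
  unfolding cl_def one_gcomp
  using coset_join1[of "filt G (Suc n)" x] coset_join2[of x "filt G (Suc n)"]
    subgroup_filt[of "Suc n"] subgroup.subset by fastforce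

lemma cl_one: "N2 G (Suc n) x \<Longrightarrow> cl G n x = \<one>\<^bsub>gcomp G n\<^esub>"
  using cl_one_iff N2_closed by blast

lemma cl_of_one: "cl G n \<one> = \<one>\<^bsub>gcomp G n\<^esub>"
  by (rule cl_one) (simp add: N2.one)

lemma cl_in_gcomp [intro]: "N2 G n x \<Longrightarrow> cl G n x \<in> carrier (gcomp G n)"
  by (simp add: gcomp_def)

lemma gcomp_cases:
  assumes "X \<in> carrier (gcomp G n)"
  obtains x where "N2 G n x" "X = cl G n x"
  using assms by (auto simp: gcomp_def)

lemma subgroup_cl:
  assumes "subgroup H G" "1 \<le> n"
  shows "subgroup (cl G n ` H) (G Mod filt G (Suc n))"
proof -
  interpret Q: group "G Mod filt G (Suc n)" by (rule group_Mod_filt)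
  interpret h: group_hom G "G Mod filt G (Suc n)" "cl G n"
    by unfold_locales (use normal.r_coset_hom_Mod[OF normal_filt[of "Suc n"]] in \<open>simp add: cl_def[abs_def]\<close>)
  show ?thesis by (rule h.subgroup_img_is_subgroup) (fact assms)
qed

text \<open>A commutator of two elements of degree \<open>n\<close> has degree \<open>2 n\<close>,
  which is at least \<open>n + 1\<close>.\<close>

lemma comm_group_gcomp:
  assumes "1 \<le> n"
  shows "comm_group (gcomp G n)"
proof -
  have g: "group (gcomp G n)"
    unfolding gcomp_def
    by (rule subgroup.subgroup_is_group[OF subgroup_cl[OF subgroup_filt] group_Mod_filt])
      (use assms in auto)
  show ?thesis
  proof (rule group.group_comm_groupI[OF g])
    fix X Y assume X: "X \<in> carrier (gcomp G n)" and Y: "Y \<in> carrier (gcomp G n)"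
    from X Y obtain x y where x: "N2 G n x" "X = cl G n x" and y: "N2 G n y" "Y = cl G n y"
      by (metis gcomp_cases)
    have c: "x \<in> carrier G" "y \<in> carrier G" using x y N2_closed by auto
    have "cl G n (com x y) = \<one>\<^bsub>gcomp G n\<^esub>"
      by (rule cl_one) (rule N2_comm'[OF x(1) y(1)], use assms in auto)
    moreover have "x \<otimes> y = (y \<otimes> x) \<otimes> com x y" using c by (simp add: word_simps)
    ultimately have "cl G n (x \<otimes> y) = cl G n (y \<otimes> x) \<otimes>\<^bsub>gcomp G n\<^esub> \<one>\<^bsub>gcomp G n\<^esub>"
      using c cl_mult by (metis grp_comm_closed m_closed)
    also have "\<dots> = cl G n (y \<otimes> x)"
    proof -
      have "cl G n (y \<otimes> x) \<in> carrier (gcomp G n)"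
        using x y by (auto intro: N2.mult)
      then show ?thesis using monoid.r_one[OF group.is_monoid[OF g]] by simp
    qed
    finally show "X \<otimes>\<^bsub>gcomp G n\<^esub> Y = Y \<otimes>\<^bsub>gcomp G n\<^esub> X"
      using x y c by (simp add: cl_mult)
  qed
qed

lemma cl_square: "N2 G n x \<Longrightarrow> cl G n x \<otimes>\<^bsub>gcomp G n\<^esub> cl G n x = \<one>\<^bsub>gcomp G n\<^esub>"
  using N2_closed[of n x] N2_pos[of n x] N2_square'[of n x "Suc n"]
  by (simp add: cl_one flip: cl_mult)

lemma cl_mult_eq_one:
  assumes "N2 G n x" "N2 G n y" "cl G n x \<otimes>\<^bsub>gcomp G n\<^esub> cl G n y = \<one>\<^bsub>gcomp G n\<^esub>"
  shows "cl G n x = cl G n y"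
proof -
  interpret C: comm_group "gcomp G n"
    by (rule comm_group_gcomp) (rule N2_pos[OF assms(1)])
  show ?thesis
    using assms cl_in_gcomp cl_square by (metis C.inv_equality)
qed

lemma cl_inv:
  assumes "N2 G n x"
  shows "cl G n (inv x) = cl G n x"
  by (rule cl_mult_eq_one)
    (use assms N2_closed[OF assms] N2_pos[OF assms]
      in \<open>auto intro: N2.inv simp: cl_of_one simp flip: cl_mult\<close>)

lemma cl_eqE:
  assumes "cl G n x = cl G n y" "N2 G n x" "N2 G n y"
  obtains u where "N2 G (Suc n) u" "x = u \<otimes> y"
proof -
  have c: "x \<in> carrier G" "y \<in> carrier G" using assms N2_closed by auto
  have "cl G n (x \<otimes> inv y) = \<one>\<^bsub>gcomp G n\<^esub>"
    using c assms by (simp add: cl_mult cl_inv cl_square)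
  then have "N2 G (Suc n) (x \<otimes> inv y)" using c by (simp add: cl_one_iff)
  then show thesis by (rule that) (use c in \<open>simp add: m_assoc\<close>)
qed

text \<open>The middle factor in \<open>grp_comm_mult_left\<close> has degree \<open>2 a + b\<close>
  and vanishes in degree \<open>a + b\<close>.\<close>

lemma cl_comm_mult_left:
  assumes x: "N2 G a x" and y: "N2 G a y" and z: "N2 G b z"
  shows "cl G (a + b) (com (x \<otimes> y) z) =
    cl G (a + b) (com x z) \<otimes>\<^bsub>gcomp G (a + b)\<^esub> cl G (a + b) (com y z)"
proof -
  note c = x[THEN N2_closed] y[THEN N2_closed] z[THEN N2_closed]
  have p: "1 \<le> a" "1 \<le> b" using x z N2_pos by auto
  interpret C: comm_group "gcomp G (a + b)" by (rule comm_group_gcomp) (use p in simp)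
  have "N2 G (Suc (a + b)) (com (com x z) y)"
    by (rule N2_comm'[OF N2.comm[OF x z] y]) (use p in auto)
  then show ?thesis
    using c by (simp add: grp_comm_mult_left cl_mult cl_one C.r_one cl_in_gcomp N2.comm x z)
qed

lemma cl_comm_sym:
  assumes x: "N2 G a x" and y: "N2 G b y"
  shows "cl G (a + b) (com x y) = cl G (a + b) (com y x)"
  using cl_inv[OF N2.comm[OF x y]] x y by (simp add: inv_grp_comm N2_closed)

lemma cl_comm_mult_right:
  assumes x: "N2 G a x" and y: "N2 G b y" and z: "N2 G b z"
  shows "cl G (a + b) (com x (y \<otimes> z)) =
    cl G (a + b) (com x y) \<otimes>\<^bsub>gcomp G (a + b)\<^esub> cl G (a + b) (com x z)"
  using cl_comm_mult_left[OF y z x] cl_comm_sym[OF x y] cl_comm_sym[OF x z]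
    cl_comm_sym[OF x N2.mult[OF y z]] by (simp add: add.commute)

lemma cl_comm_cong_left:
  assumes "cl G a x = cl G a x'" "N2 G a x" "N2 G a x'" "N2 G b y"
  shows "cl G (a + b) (com x y) = cl G (a + b) (com x' y)"
proof -
  obtain u where u: "N2 G (Suc a) u" "x = u \<otimes> x'"
    using cl_eqE[OF assms(1-3)] .
  have p: "1 \<le> a" "1 \<le> b" using assms N2_pos by auto
  interpret C: comm_group "gcomp G (a + b)" by (rule comm_group_gcomp) (use p in simp)
  have "N2 G (Suc (a + b)) (com u y)"
    using N2.comm[OF u(1) assms(4)] by simp
  then show ?thesis
    using cl_comm_mult_left[OF N2.weaken[OF u(1) p(1)] assms(3,4)] u(2)
    by (simp add: cl_one cl_in_gcomp N2.comm assms(3,4))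
qed

lemma cl_comm_cong:
  assumes "cl G a x = cl G a x'" "N2 G a x" "N2 G a x'"
    and "cl G b y = cl G b y'" "N2 G b y" "N2 G b y'"
  shows "cl G (a + b) (com x y) = cl G (a + b) (com x' y')"
  using cl_comm_cong_left[OF assms(1-3,5)] cl_comm_cong_left[OF assms(4-6) assms(3)]
    cl_comm_sym[OF assms(3,5)] cl_comm_sym[OF assms(3,6)] by (simp add: add.commute)

lemma cl_conj:
  assumes "N2 G n w" "y \<in> carrier G"
  shows "cl G n (inv y \<otimes> w \<otimes> y) = cl G n w"
proof -
  have p: "1 \<le> n" using assms N2_pos by auto
  interpret C: comm_group "gcomp G n" by (rule comm_group_gcomp) (use p in simp)
  have w: "w \<in> carrier G" using assms N2_closed by blast
  have "N2 G (Suc n) (com w y)"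
    using N2.comm[OF assms(1) N2.carrier[OF assms(2)]] by simp
  moreover have "inv y \<otimes> w \<otimes> y = w \<otimes> com w y"
    using w assms by (simp add: word_simps)
  ultimately show ?thesis using w assms by (simp add: cl_mult cl_one cl_in_gcomp)
qed

lemma cl_comm_inv_right:
  assumes x: "N2 G a x" and y: "N2 G b y"
  shows "cl G (a + b) (com x (inv y)) = cl G (a + b) (com x y)"
  by (rule cl_comm_cong) (use assms N2.inv cl_inv in auto)

lemma cl_jacobi:
  assumes x: "N2 G a x" and y: "N2 G b y" and z: "N2 G c z"
    and n: "n = a + b + c"
  shows "cl G n (com (com x y) z) \<otimes>\<^bsub>gcomp G n\<^esub>
    cl G n (com (com y z) x) \<otimes>\<^bsub>gcomp G n\<^esub>
    cl G n (com (com z x) y) = \<one>\<^bsub>gcomp G n\<^esub>"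
proof -
  note cx = x[THEN N2_closed] y[THEN N2_closed] z[THEN N2_closed]
  \<comment> \<open>On classes conjugation is trivial and \<open>inv v\<close> may be replaced by
    \<open>v\<close>; this strips the Hall-Witt identity down to the Jacobi identity.\<close>
  have *: "cl G m (inv v \<otimes> com (com u (inv v)) w \<otimes> v) =
      cl G m (com (com u v) w)"
    if u: "N2 G k u" and v: "N2 G l v" and w: "N2 G r w" and m: "m = k + l + r"
    for u v w k l r m
  proof -
    have "cl G m (inv v \<otimes> com (com u (inv v)) w \<otimes> v)
        = cl G m (com (com u (inv v)) w)"
      unfolding m using u v w
      by (intro cl_conj N2.comm N2.inv N2_closed[OF v])
    also have "\<dots> = cl G m (com (com u v) w)"
      unfolding m using u v w
      by (intro cl_comm_cong_left[OF cl_comm_inv_right] N2.comm N2.inv)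
    finally show ?thesis .
  qed
  have "cl G n \<one> = \<one>\<^bsub>gcomp G n\<^esub>" by (rule cl_one) (simp add: N2.one)
  then show ?thesis
    unfolding hall_witt[OF cx, symmetric]
    using cx *[OF x y z n] *[OF y z x, of n] *[OF z x y, of n] n
    by (simp add: cl_mult)
qed

text \<open>Expanding \<open>com x (y \<otimes> y)\<close> gives the square of
  \<open>com x y\<close> times the double commutator. The square has degree
  \<open>2 (a + b)\<close>, more than \<open>a + 2 b\<close>, and drops out.\<close>

lemma cl_comm_square:
  assumes x: "N2 G a x" and y: "N2 G b y" and n: "n = a + 2 * b"
  shows "cl G n (com x (y \<otimes> y)) = cl G n (com (com x y) y)"
proof -
  note c = x[THEN N2_closed] y[THEN N2_closed]
  have p: "1 \<le> a" "1 \<le> b" using x y N2_pos by auto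
  interpret C: comm_group "gcomp G n" by (rule comm_group_gcomp) (use p n in simp)
  have t: "N2 G n (com (com x y) y)"
    unfolding n by (rule N2_comm'[OF N2.comm[OF x y] y]) (use p in auto)
  have "N2 G (Suc n) (com x y \<otimes> com x y)"
    by (rule N2_square'[OF N2.comm[OF x y]]) (use p n in auto)
  then show ?thesis
    using c t by (simp add: grp_comm_mult_right cl_one cl_in_gcomp cl_mult[of "_ \<otimes> _"])
qed

lemma cl_square_mult:
  assumes x: "N2 G a x" and y: "N2 G a y"
  shows "cl G (2 * a) ((x \<otimes> y) \<otimes> (x \<otimes> y)) = cl G (2 * a) (x \<otimes> x) \<otimes>\<^bsub>gcomp G (2 * a)\<^esub>
    cl G (2 * a) (y \<otimes> y) \<otimes>\<^bsub>gcomp G (2 * a)\<^esub> cl G (2 * a) (com x y)"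
proof -
  note c = x[THEN N2_closed] y[THEN N2_closed]
  have p: "1 \<le> a" using x N2_pos by auto
  interpret C: comm_group "gcomp G (2 * a)" by (rule comm_group_gcomp) (use p in simp)
  have "cl G (2 * a) ((x \<otimes> y) \<otimes> (x \<otimes> y)) = cl G (2 * a) (x \<otimes> x) \<otimes>\<^bsub>gcomp G (2 * a)\<^esub>
    cl G (2 * a) (com x (inv y)) \<otimes>\<^bsub>gcomp G (2 * a)\<^esub> cl G (2 * a) (y \<otimes> y)"
    unfolding square_mult[OF c] using c by (simp add: cl_mult[of "_ \<otimes> _" "y \<otimes> y"] cl_mult[of "x \<otimes> x"])
  moreover have "cl G (2 * a) (com x (inv y)) = cl G (2 * a) (com x y)"
    using cl_comm_inv_right[OF x y] by (simp add: mult_2)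
  moreover have "N2 G (2 * a) (com x y)"
    using N2.comm[OF x y] by (simp add: mult_2)
  ultimately show ?thesis
    using x y by (simp add: C.m_ac cl_in_gcomp N2.square)
qed

lemma cl_square_cong:
  assumes "cl G a x = cl G a x'" "N2 G a x" "N2 G a x'"
  shows "cl G (2 * a) (x \<otimes> x) = cl G (2 * a) (x' \<otimes> x')"
proof -
  obtain u where u: "N2 G (Suc a) u" "x = u \<otimes> x'"
    using cl_eqE[OF assms] .
  have p: "1 \<le> a" using assms N2_pos by auto
  interpret C: comm_group "gcomp G (2 * a)" by (rule comm_group_gcomp) (use p in simp)
  have "N2 G (Suc (2 * a)) (u \<otimes> u)" "N2 G (Suc (2 * a)) (com u x')"
    by (rule N2_square'[OF u(1)] N2_comm'[OF u(1) assms(3)]; simp)+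
  then show ?thesis
    using cl_square_mult[OF N2.weaken[OF u(1) p] assms(3)] u(2)
    by (simp add: cl_one cl_in_gcomp N2.square assms(3))
qed

end

section \<open>Commutators of powers in the lower central series\<close>

context group
begin

lemma generate_le: "subgroup H G \<Longrightarrow> S \<subseteq> H \<Longrightarrow> generate G S \<subseteq> H"
  by (rule generate_subgroup_incl)

lemma conj_pow:
  "x \<in> carrier G \<Longrightarrow> g \<in> carrier G \<Longrightarrow> g \<otimes> x [^] (n::nat) \<otimes> inv g = (g \<otimes> x \<otimes> inv g) [^] n"
proof (induction n)
  case (Suc n)
  have "g \<otimes> x [^] Suc n \<otimes> inv g = (g \<otimes> x [^] n \<otimes> inv g) \<otimes> (g \<otimes> x \<otimes> inv g)"
    using Suc.prems by (simp add: word_simps)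
  then show ?case using Suc by simp
qed simp

lemma normal_gamma: "\<gamma> n \<lhd> G"
proof (induction n rule: induct_nat_012)
  case (ge2 k)
  let ?S = "{com g h |g h. g \<in> \<gamma> (Suc k) \<and> h \<in> carrier G}"
  note N = normal.axioms(1)[OF ge2(2)] normal.inv_op_closed2[OF ge2(2)]
  have c: "x \<in> carrier G" if "x \<in> \<gamma> (Suc k)" for x
    using subgroup.mem_carrier[OF N(1) that] .
  have "generate G ?S \<lhd> G"
  proof (rule normal_generateI)
    show "?S \<subseteq> carrier G" using c by auto
    fix s g assume "s \<in> ?S" and g: "g \<in> carrier G"
    then obtain x h where x: "x \<in> \<gamma> (Suc k)" "h \<in> carrier G" "s = com x h"
      by blast
    have "g \<otimes> s \<otimes> inv g = com (g \<otimes> x \<otimes> inv g) (g \<otimes> h \<otimes> inv g)"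
      unfolding x(3) by (rule conj_grp_comm) (use c x g in auto)
    then show "g \<otimes> s \<otimes> inv g \<in> ?S" using N(2) x g by blast
  qed
  then show ?case by simp
qed (simp_all add: normal_self)

lemma gamma_closed: "x \<in> \<gamma> n \<Longrightarrow> x \<in> carrier G"
  using subgroup.mem_carrier[OF normal.axioms(1)[OF normal_gamma]] .

lemma gamma_comm:
  assumes "1 \<le> n" "x \<in> \<gamma> n" "y \<in> carrier G"
  shows "com x y \<in> \<gamma> (Suc n)"
proof -
  obtain k where "n = Suc k" using assms(1) by (cases n) auto
  then show ?thesis using assms by (auto intro: generate.incl)
qed

lemma gamma_N2: "1 \<le> n \<Longrightarrow> x \<in> \<gamma> n \<Longrightarrow> N2 G n x"
proof (induction n arbitrary: x rule: induct_nat_012)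
  case (ge2 k)
  have "generate G {com g h |g h. g \<in> \<gamma> (Suc k) \<and> h \<in> carrier G}
      \<subseteq> filt G (Suc (Suc k))"
  proof (rule generate_le[OF subgroup_filt], simp, clarify, simp)
    fix g h assume "g \<in> \<gamma> (Suc k)" "h \<in> carrier G"
    then show "N2 G (Suc (Suc k)) (com g h)"
      using N2.comm[OF ge2(2) N2.carrier] by simp
  qed
  then show ?case using ge2(4) by auto
qed (use N2.carrier in auto)

lemma N2_pow: "N2 G n x \<Longrightarrow> N2 G (n * 2 ^ i) (x [^^] i)"
proof (induction i)
  case 0
  then show ?case using N2_closed[OF 0] by simp
next
  case (Suc i)
  have "x [^^] (Suc i) = x [^^] i \<otimes> x [^^] i"
    using N2_closed[OF Suc.prems] by (simp add: nat_pow_mult mult_2)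
  then show ?case using N2.square[OF Suc.IH[OF Suc.prems]] by (simp add: ac_simps)
qed

lemma pow_Suc_two: "x \<in> carrier G \<Longrightarrow> x [^^] (Suc i) = x [^^] i \<otimes> x [^^] i"
  by (simp add: nat_pow_mult mult_2)

text \<open>A flat set of generators for the \<open>k\<close>-th term, in place of subgroups of
  powers nested inside a generated subgroup.\<close>

definition lazard :: "nat \<Rightarrow> 'a set" where
  "lazard k = {g [^^] i | g n i. g \<in> \<gamma> n \<and> 1 \<le> n \<and> k \<le> n * 2 ^ i}"

lemma lazard_closed: "x \<in> lazard k \<Longrightarrow> x \<in> carrier G"
  unfolding lazard_def using gamma_closed nat_pow_closed by blast

lemma Gamma_eq: "\<Gamma> k = generate G (lazard k)"
proof
  have c: "power_subgroup G (\<gamma> n) q \<subseteq> carrier G" for n and q :: nat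
    unfolding power_subgroup_def
    by (rule generate_incl) (use gamma_closed in auto)
  have s: "subgroup (generate G (lazard k)) G"
    by (rule generate_is_subgroup) (use lazard_closed in blast)
  have "subgroup (\<Gamma> k) G"
    unfolding lower_2_central_def by (rule generate_is_subgroup) (use c in blast)
  note s = s this
  show "\<Gamma> k \<subseteq> generate G (lazard k)"
    unfolding lower_2_central_def power_subgroup_def
  proof (rule generate_le[OF s(1)], rule Union_least, clarify)
    fix x n i assume x: "x \<in> generate G {h [^^] i |h. h \<in> \<gamma> n}"
      and n: "1 \<le> n" "k \<le> n * 2 ^ i"
    have "generate G {h [^^] i |h. h \<in> \<gamma> n} \<subseteq> generate G (lazard k)"
      by (rule mono_generate) (use n in \<open>auto simp: lazard_def\<close>)
    with x show "x \<in> generate G (lazard k)" by blast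
  qed
  show "generate G (lazard k) \<subseteq> \<Gamma> k"
  proof (rule generate_le[OF s(2)])
    show "lazard k \<subseteq> \<Gamma> k"
      unfolding lazard_def lower_2_central_def power_subgroup_def
      by (auto intro!: generate.incl)
  qed
qed

lemma subgroup_Gamma: "subgroup (\<Gamma> k) G"
  unfolding Gamma_eq by (rule generate_is_subgroup) (use lazard_closed in blast)

lemma normal_Gamma: "\<Gamma> k \<lhd> G"
  unfolding Gamma_eq
proof (rule normal_generateI)
  show "lazard k \<subseteq> carrier G" using lazard_closed by blast
  fix s g assume "s \<in> lazard k" and g: "g \<in> carrier G"
  then obtain x n i where x: "s = x [^^] i" "x \<in> \<gamma> n" "1 \<le> n" "k \<le> n * 2 ^ i"
    by (auto simp: lazard_def)
  have "g \<otimes> s \<otimes> inv g = (g \<otimes> x \<otimes> inv g) [^^] i"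
    unfolding x(1) by (rule conj_pow) (use x g gamma_closed in auto)
  moreover have "g \<otimes> x \<otimes> inv g \<in> \<gamma> n"
    using normal.inv_op_closed2[OF normal_gamma g x(2)] .
  ultimately show "g \<otimes> s \<otimes> inv g \<in> lazard k" using x by (auto simp: lazard_def)
qed

lemma lazard_antimono: "k \<le> l \<Longrightarrow> lazard l \<subseteq> lazard k"
  unfolding lazard_def using le_trans by blast

lemma Gamma_antimono: "k \<le> l \<Longrightarrow> \<Gamma> l \<subseteq> \<Gamma> k"
  unfolding Gamma_eq by (rule mono_generate) (rule lazard_antimono)

lemma gamma_lazard: "1 \<le> n \<Longrightarrow> x \<in> \<gamma> n \<Longrightarrow> x \<in> lazard n"
  unfolding lazard_def using gamma_closed[of x n]
  by (intro CollectI exI[of _ x] exI[of _ n] exI[of _ 0]) auto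

lemma lazard_N2: "1 \<le> k \<Longrightarrow> x \<in> lazard k \<Longrightarrow> N2 G k x"
  unfolding lazard_def using N2_antimono N2_pow gamma_N2 by blast

lemma Gamma_N2: "1 \<le> k \<Longrightarrow> x \<in> \<Gamma> k \<Longrightarrow> N2 G k x"
  unfolding Gamma_eq
  using generate_le[OF subgroup_filt, of k "lazard k"] lazard_N2 by auto

lemma cl_image_mult:
  assumes "subgroup H G" "X \<in> cl G n ` H" "Y \<in> cl G n ` H"
  shows "X \<otimes>\<^bsub>gcomp G n\<^esub> Y \<in> cl G n ` H"
  using assms subgroup.m_closed[OF assms(1)] subgroup.mem_carrier[OF assms(1)]
  by (auto simp flip: cl_mult)

text \<open>For fixed \<open>x\<close> the class of \<open>com x y\<close> is multiplicative in
  \<open>y\<close>. Hence a claim about commutators with a generated subgroup has to be checked on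
  generators only.\<close>

lemma subgroup_comm_right:
  assumes x: "N2 G a x" and b: "1 \<le> b" and H: "subgroup H G"
  shows "subgroup {y. N2 G b y \<and> cl G (a + b) (com x y) \<in> cl G (a + b) ` H} G"
proof (rule subgroupI)
  have "com x \<one> = \<one>" using N2_closed[OF x] by (simp add: grp_comm_def)
  then show "{y. N2 G b y \<and> cl G (a + b) (com x y) \<in> cl G (a + b) ` H} \<noteq> {}"
    using N2.one[OF b] subgroup.one_closed[OF H] by force
qed (auto simp: cl_comm_inv_right[OF x] cl_comm_mult_right[OF x] cl_image_mult[OF H]
    intro: N2_closed N2.intros)

lemma generate_comm_right:
  assumes "N2 G a x" "1 \<le> b" "subgroup H G" "y \<in> generate G S"
    and "\<And>s. s \<in> S \<Longrightarrow> N2 G b s \<and> cl G (a + b) (com x s) \<in> cl G (a + b) ` H"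
  shows "cl G (a + b) (com x y) \<in> cl G (a + b) ` H"
  using generate_le[OF subgroup_comm_right[OF assms(1-3)], of S] assms(4,5) by blast

lemma subgroup_gamma: "subgroup (\<gamma> n) G"
  by (rule normal.axioms(1)[OF normal_gamma])

lemma cl_jacobi':
  assumes x: "N2 G a x" and y: "N2 G b y" and z: "N2 G c z"
    and n: "n = a + b + c"
  shows "cl G n (com x (com y z)) =
    cl G n (com (com x y) z) \<otimes>\<^bsub>gcomp G n\<^esub> cl G n (com (com z x) y)"
proof -
  have p: "1 \<le> n" using n x N2_pos by fastforce
  interpret C: comm_group "gcomp G n" by (rule comm_group_gcomp[OF p])
  have t: "N2 G n (com (com x y) z)"
    "N2 G n (com (com y z) x)"
    "N2 G n (com (com z x) y)"
    unfolding n by (rule N2_comm'[OF N2.comm[OF x y] z]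
        N2_comm'[OF N2.comm[OF y z] x]
        N2_comm'[OF N2.comm[OF z x] y]; use p n in simp)+
  have s: "cl G n (com x (com y z)) = cl G n (com (com y z) x)"
    using cl_comm_sym[OF x N2.comm[OF y z]] n by (simp add: add.assoc)
  have tm: "N2 G n (com (com x y) z \<otimes> com (com z x) y)"
    using t(1,3) by (rule N2.mult)
  have "cl G n (com (com y z) x) \<otimes>\<^bsub>gcomp G n\<^esub>
      cl G n (com (com x y) z \<otimes> com (com z x) y) = \<one>\<^bsub>gcomp G n\<^esub>"
    using cl_jacobi[OF x y z n] t by (simp add: cl_mult N2_closed C.m_ac cl_in_gcomp)
  from cl_mult_eq_one[OF t(2) tm this] show ?thesis
    unfolding s using t by (simp add: cl_mult N2_closed)
qed

text \<open>Induction on \<open>b\<close>: a generator of the next term is some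
  \<open>com g h\<close>, and the Jacobi identity expresses \<open>[x, [g, h]]\<close> through
  \<open>[[x, g], h]\<close> and \<open>[[h, x], g]\<close>. The latter has first entry in degree
  \<open>a + 1\<close>, so \<open>a\<close> must stay arbitrary. Working with classes replaces the
  three subgroups lemma.\<close>

lemma gamma_cl_comm:
  assumes "1 \<le> a" "1 \<le> b" "x \<in> \<gamma> a" "y \<in> \<gamma> b"
  shows "cl G (a + b) (com x y) \<in> cl G (a + b) ` \<gamma> (a + b)"
  using assms
proof (induction b arbitrary: a x y rule: induct_nat_012)
  case 1
  then show ?case using gamma_comm[of a x y] by simp
next
  case (ge2 k)
  let ?b = "Suc k" and ?n = "a + Suc (Suc k)"
  have x: "N2 G a x" using ge2 gamma_N2 by blast
  show ?case
  proof (rule generate_comm_right[OF x _ subgroup_gamma])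
    show "y \<in> generate G {com g h |g h. g \<in> \<gamma> ?b \<and> h \<in> carrier G}"
      using ge2 by simp
    fix s assume "s \<in> {com g h |g h. g \<in> \<gamma> ?b \<and> h \<in> carrier G}"
    then obtain g h where s: "s = com g h" "g \<in> \<gamma> ?b" "h \<in> carrier G" by blast
    have g: "N2 G ?b g" and h: "N2 G 1 h"
      using s gamma_N2 N2.carrier by auto
    obtain u where u: "u \<in> \<gamma> (a + ?b)"
        "cl G (a + ?b) (com x g) = cl G (a + ?b) u"
      using ge2(2)[of a x g] ge2(3,5) s by auto
    have ut: "N2 G (a + ?b) u" by (rule gamma_N2[OF _ u(1)]) simp
    have "cl G (a + ?b + 1) (com (com x g) h) = cl G (a + ?b + 1) (com u h)"
      by (rule cl_comm_cong_left[OF u(2) N2.comm[OF x g] ut h])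
    then have A: "cl G ?n (com (com x g) h) \<in> cl G ?n ` \<gamma> ?n"
      using gamma_comm[of "a + ?b" u h] u s by auto
    have "com h x \<in> \<gamma> (Suc a)"
      using subgroup.m_inv_closed[OF subgroup_gamma gamma_comm[of a x h]] ge2(3,5) s
        gamma_closed[of x a] by (simp add: inv_grp_comm)
    then have B: "cl G ?n (com (com h x) g) \<in> cl G ?n ` \<gamma> ?n"
      using ge2(2)[of "Suc a" "com h x" g] s by simp
    have "N2 G (Suc (Suc k)) s" unfolding s(1) using N2.comm[OF g h] by simp
    moreover have "cl G ?n (com x s) \<in> cl G ?n ` \<gamma> ?n"
      unfolding s(1) using cl_jacobi'[OF x g h, of ?n] cl_image_mult[OF subgroup_gamma A B]
      by simp
    ultimately show "N2 G (Suc (Suc k)) s \<and>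
      cl G ?n (com x s) \<in> cl G ?n ` \<gamma> ?n" ..
  qed simp
qed simp

text \<open>By \<open>cl_comm_square\<close>, doubling the exponent of \<open>h\<close> means
  bracketing twice with the previous power. The hypothesis is used twice, the second time for the
  element of the lower central series that the first use supplies.\<close>

lemma gamma_cl_comm_pow:
  assumes "1 \<le> r" "1 \<le> l" "z \<in> \<gamma> r" "h \<in> \<gamma> l" "n = r + l * 2 ^ j"
  shows "cl G n (com z (h [^^] j)) \<in> cl G n ` \<gamma> n"
  using assms
proof (induction j arbitrary: r z n)
  case 0
  then show ?case using gamma_cl_comm[of r l z h] gamma_closed[of h l] by simp
next
  case (Suc j)
  let ?w = "h [^^] j" and ?b = "l * 2 ^ j"
  have z: "N2 G r z" and w: "N2 G ?b ?w"
    using Suc gamma_N2 N2_pow by blast+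
  have p: "1 \<le> r + ?b" using Suc by simp
  obtain u where u: "u \<in> \<gamma> (r + ?b)"
      "cl G (r + ?b) (com z ?w) = cl G (r + ?b) u"
    using Suc.IH[OF Suc.prems(1-4) HOL.refl] by auto
  have n: "n = r + ?b + ?b" "n = r + 2 * ?b" using Suc.prems by auto
  have "cl G n (com z (h [^^] (Suc j))) = cl G n (com (com z ?w) ?w)"
    using cl_comm_square[OF z w n(2)] pow_Suc_two[of h j] gamma_closed Suc.prems(4) by simp
  also have "\<dots> = cl G n (com u ?w)"
    unfolding n(1)
    by (rule cl_comm_cong_left[OF u(2) N2.comm[OF z w] gamma_N2[OF p u(1)] w])
  also have "\<dots> \<in> cl G n ` \<gamma> n"
    by (rule Suc.IH[OF p Suc.prems(2) u(1) Suc.prems(4) n(1)])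
  finally show ?case .
qed

text \<open>Exponent zero on the right is \<open>gamma_cl_comm_pow\<close> with the sides exchanged.
  In the step the inner bracket already has a representative in the lower central series, so
  \<open>gamma_cl_comm_pow\<close> finishes.\<close>

lemma gamma_cl_pow_comm_pow:
  assumes "1 \<le> r" "1 \<le> l" "g \<in> \<gamma> r" "h \<in> \<gamma> l"
    "n = r * 2 ^ i + l * 2 ^ j"
  shows "cl G n (com (g [^^] i) (h [^^] j)) \<in> cl G n ` \<gamma> n"
  using assms(5)
proof (induction j arbitrary: n)
  case 0
  have t: "N2 G (r * 2 ^ i) (g [^^] i)" "N2 G l h"
    using assms gamma_N2 N2_pow by blast+
  have "cl G (r * 2 ^ i + l) (com (g [^^] i) h) =
      cl G (r * 2 ^ i + l) (com h (g [^^] i))"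
    by (rule cl_comm_sym[OF t])
  then show ?case
    using gamma_cl_comm_pow[OF assms(2,1,4,3), of n i] 0 t N2_closed
    by (simp add: add.commute)
next
  case (Suc j)
  let ?w = "h [^^] j" and ?b = "l * 2 ^ j" and ?z = "g [^^] i"
    and ?r = "r * 2 ^ i"
  have z: "N2 G ?r ?z" and w: "N2 G ?b ?w"
    using assms gamma_N2 N2_pow by blast+
  have p: "1 \<le> ?r + ?b" using N2_pos[OF z] by (rule trans_le_add1)
  obtain u where u: "u \<in> \<gamma> (?r + ?b)"
      "cl G (?r + ?b) (com ?z ?w) = cl G (?r + ?b) u"
    using Suc.IH[OF HOL.refl] by auto
  have n: "n = ?r + ?b + ?b" "n = ?r + 2 * ?b" using Suc.prems by auto
  have "cl G n (com ?z (h [^^] (Suc j))) = cl G n (com (com ?z ?w) ?w)"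
    using cl_comm_square[OF z w n(2)] pow_Suc_two[of h j] gamma_closed assms(4) by simp
  also have "\<dots> = cl G n (com u ?w)"
    unfolding n(1)
    by (rule cl_comm_cong_left[OF u(2) N2.comm[OF z w] gamma_N2[OF p u(1)] w])
  also have "\<dots> \<in> cl G n ` \<gamma> n"
    by (rule gamma_cl_comm_pow[OF p assms(2) u(1) assms(4) n(1)])
  finally show ?case .
qed

lemma gamma_subset_Gamma: "1 \<le> n \<Longrightarrow> \<gamma> n \<subseteq> \<Gamma> n"
  unfolding Gamma_eq by (intro subsetI generate.incl gamma_lazard)

text \<open>Generators of excess degree are trivial in degree \<open>k\<close>, so only exact
  equality \<open>k = n * 2 ^ i\<close> calls for a computation.\<close>

lemma lazard_cases:
  assumes "x \<in> lazard k" "1 \<le> k"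
  obtains "N2 G (Suc k) x"
  | g n i where "x = g [^^] i" "g \<in> \<gamma> n" "1 \<le> n" "k = n * 2 ^ i"
proof -
  obtain g n i where x: "x = g [^^] i" "g \<in> \<gamma> n" "1 \<le> n" "k \<le> n * 2 ^ i"
    using assms by (auto simp: lazard_def)
  show thesis
  proof (cases "k = n * 2 ^ i")
    case False
    then have "Suc k \<le> n * 2 ^ i" using x by simp
    then have "N2 G (Suc k) x"
      unfolding x(1) using N2_antimono[OF N2_pow[OF gamma_N2[OF x(3,2)]]]
      by simp
    then show thesis by (rule that)
  qed (use x that in blast)
qed

lemma lazard_cl_comm:
  assumes "1 \<le> a" "1 \<le> b" "x \<in> lazard a" "y \<in> lazard b"
  shows "cl G (a + b) (com x y) \<in> cl G (a + b) ` \<Gamma> (a + b)"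
proof -
  have x: "N2 G a x" and y: "N2 G b y"
    using assms lazard_N2 by auto
  have one: "cl G (a + b) (com x y) \<in> cl G (a + b) ` \<Gamma> (a + b)"
    if "N2 G (Suc (a + b)) (com x y)"
    using cl_one[OF that] cl_of_one subgroup.one_closed[OF subgroup_Gamma] by (metis imageI)
  show ?thesis
    using assms(3,1)
  proof (cases rule: lazard_cases)
    case 1
    then show ?thesis using one N2.comm[OF 1 y] by simp
  next
    case X: (2 g r i)
    show ?thesis
      using assms(4,2)
    proof (cases rule: lazard_cases)
      case 1
      then show ?thesis using one N2.comm[OF x 1] by simp
    next
      case (2 h l j)
      have "cl G (a + b) (com x y) \<in> cl G (a + b) ` \<gamma> (a + b)"
        unfolding X(1) 2(1)
        by (rule gamma_cl_pow_comm_pow[OF X(3) 2(3) X(2) 2(2)]) (simp only: X(4) 2(4))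
      moreover have "\<gamma> (a + b) \<subseteq> \<Gamma> (a + b)"
        by (rule gamma_subset_Gamma) (use assms(1) in simp)
      ultimately show ?thesis by (rule rev_subsetD[OF _ image_mono])
    qed
  qed
qed

lemma Gamma_cl_comm:
  assumes "1 \<le> a" "1 \<le> b" "x \<in> \<Gamma> a" "y \<in> \<Gamma> b"
  shows "cl G (a + b) (com x y) \<in> cl G (a + b) ` \<Gamma> (a + b)"
proof (rule generate_comm_right[OF _ assms(2) subgroup_Gamma])
  show "y \<in> generate G (lazard b)" using assms(4) by (simp add: Gamma_eq)
  show x: "N2 G a x" using assms(1,3) by (rule Gamma_N2)
  fix s assume s: "s \<in> lazard b"
  have s2: "N2 G b s" using assms(2) s by (rule lazard_N2)
  have "cl G (b + a) (com s x) \<in> cl G (b + a) ` \<Gamma> (b + a)"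
  proof (rule generate_comm_right[OF s2 assms(1) subgroup_Gamma])
    show "x \<in> generate G (lazard a)" using assms(3) by (simp add: Gamma_eq)
    show "N2 G a t \<and> cl G (b + a) (com s t) \<in> cl G (b + a) ` \<Gamma> (b + a)"
      if "t \<in> lazard a" for t
      using that lazard_cl_comm[OF assms(2,1) s] lazard_N2 assms(1) by blast
  qed
  then show "N2 G b s \<and> cl G (a + b) (com x s) \<in> cl G (a + b) ` \<Gamma> (a + b)"
    using s2 cl_comm_sym[OF x s2] by (simp add: add.commute)
qed

text \<open>The square of a generator is again a generator, of twice the degree; products are
  handled by \<open>cl_square_mult\<close>, whose bracket term is covered by
  \<open>Gamma_cl_comm\<close>.\<close>

lemma Gamma_cl_square:
  assumes "1 \<le> a" "x \<in> \<Gamma> a"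
  shows "cl G (2 * a) (x \<otimes> x) \<in> cl G (2 * a) ` \<Gamma> (2 * a)"
proof -
  let ?S = "{x \<in> \<Gamma> a. cl G (2 * a) (x \<otimes> x) \<in> cl G (2 * a) ` \<Gamma> (2 * a)}"
  note H = subgroup_Gamma[of a] subgroup_Gamma[of "2 * a"]
  have "subgroup ?S G"
  proof (rule subgroupI)
    show "?S \<subseteq> carrier G" using subgroup.mem_carrier[OF H(1)] by blast
    show "?S \<noteq> {}" using subgroup.one_closed[OF H(1)] subgroup.one_closed[OF H(2)] by force
    show "inv x \<in> ?S" if x: "x \<in> ?S" for x
    proof -
      have "N2 G a x" using x Gamma_N2[OF assms(1)] by blast
      then have "cl G (2 * a) (inv x \<otimes> inv x) = cl G (2 * a) (x \<otimes> x)"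
        using cl_inv[OF N2.square[of G a x]] N2_closed[of a x]
        by (simp add: inv_mult_group)
      then show ?thesis using x subgroup.m_inv_closed[OF H(1)] by auto
    qed
    show "x \<otimes> y \<in> ?S" if x: "x \<in> ?S" and y: "y \<in> ?S" for x y
    proof -
      have t: "N2 G a x" "N2 G a y"
        using x y Gamma_N2[OF assms(1)] by auto
      have "cl G (2 * a) (com x y) \<in> cl G (2 * a) ` \<Gamma> (2 * a)"
        using Gamma_cl_comm[OF assms(1,1), of x y] x y by (simp add: mult_2)
      then have "cl G (2 * a) ((x \<otimes> y) \<otimes> (x \<otimes> y)) \<in> cl G (2 * a) ` \<Gamma> (2 * a)"
        unfolding cl_square_mult[OF t] using x y by (intro cl_image_mult[OF H(2)]) auto
      then show ?thesis using x y subgroup.m_closed[OF H(1)] by blast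
    qed
  qed
  moreover have "lazard a \<subseteq> ?S"
  proof
    fix s assume s: "s \<in> lazard a"
    then obtain g n i where x: "s = g [^^] i" "g \<in> \<gamma> n" "1 \<le> n" "a \<le> n * 2 ^ i"
      by (auto simp: lazard_def)
    have "s \<otimes> s = g [^^] (Suc i)"
      using pow_Suc_two[of g i] x gamma_closed by simp
    moreover have "2 * a \<le> n * 2 ^ Suc i" using x by simp
    ultimately have "s \<otimes> s \<in> lazard (2 * a)" unfolding lazard_def using x by blast
    then have "s \<otimes> s \<in> \<Gamma> (2 * a)" by (simp add: Gamma_eq generate.incl)
    then show "s \<in> ?S" using s by (simp add: Gamma_eq generate.incl)
  qed
  ultimately have "generate G (lazard a) \<subseteq> ?S" by (rule generate_le)
  then show ?thesis using assms(2) by (auto simp: Gamma_eq)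
qed

text \<open>Up to the next degree the series obeys every rule that generates \<open>N2\<close>, so
  rule induction applies. In the case \<open>weaken\<close> the class is trivial.\<close>

lemma N2_cl_Gamma:
  "N2 G k x \<Longrightarrow> cl G k x \<in> cl G k ` \<Gamma> k"
proof (induction rule: N2.induct)
  case (carrier x)
  then show ?case using gamma_subset_Gamma[of 1] by auto
next
  case (weaken k x)
  then show ?case
    using cl_one[OF weaken(1)] cl_of_one subgroup.one_closed[OF subgroup_Gamma] by (metis imageI)
next
  case (one k)
  then show ?case using subgroup.one_closed[OF subgroup_Gamma] by blast
next
  case (mult k x y)
  then show ?case using cl_image_mult[OF subgroup_Gamma] N2_closed
    by (simp add: cl_mult)
next
  case (inv k x)
  then show ?case by (simp add: cl_inv)
next
  case (comm a x b y)
  then obtain x' y' where x': "x' \<in> \<Gamma> a" "cl G a x = cl G a x'"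
    and y': "y' \<in> \<Gamma> b" "cl G b y = cl G b y'" by auto
  have p: "1 \<le> a" "1 \<le> b" using comm N2_pos by auto
  have "cl G (a + b) (com x y) = cl G (a + b) (com x' y')"
    by (rule cl_comm_cong)
      (use comm x' y' Gamma_N2 p in auto)
  then show ?case using Gamma_cl_comm p x' y' by simp
next
  case (square a x)
  then obtain x' where x': "x' \<in> \<Gamma> a" "cl G a x = cl G a x'" by auto
  have p: "1 \<le> a" using square N2_pos by auto
  have "cl G (2 * a) (x \<otimes> x) = cl G (2 * a) (x' \<otimes> x')"
    by (rule cl_square_cong) (use square x' Gamma_N2 p in auto)
  then show ?case using Gamma_cl_square p x' by simp
qed

text \<open>Iterates \<open>N2_cl_Gamma\<close>, each round raising the degree of the error
  \<open>z\<close> by one. The error need never disappear, which is why a bound of another kind is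
  required below.\<close>

lemma N2_decompose:
  "N2 G k x \<Longrightarrow> \<exists>z y. N2 G (k + n) z \<and> y \<in> \<Gamma> k \<and> x = z \<otimes> y"
proof (induction n)
  case 0
  then show ?case
    using N2_closed[OF 0] subgroup.one_closed[OF subgroup_Gamma]
    by (intro exI[of _ x] exI[of _ \<one>]) auto
next
  case (Suc n)
  then obtain z y where zy: "N2 G (k + n) z" "y \<in> \<Gamma> k" "x = z \<otimes> y" by blast
  then obtain w where w: "w \<in> \<Gamma> (k + n)" "cl G (k + n) z = cl G (k + n) w"
    using N2_cl_Gamma by blast
  have "1 \<le> k" using Suc N2_pos by blast
  then have wt: "N2 G (k + n) w" using w Gamma_N2 by simp
  obtain u where u: "N2 G (Suc (k + n)) u" "z = u \<otimes> w"
    using cl_eqE[OF w(2) zy(1) wt] .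
  have wk: "w \<in> \<Gamma> k" using w(1) Gamma_antimono[of k "k + n"] by auto
  then have "w \<otimes> y \<in> \<Gamma> k"
    using zy(2) by (rule subgroup.m_closed[OF subgroup_Gamma])
  moreover have "x = u \<otimes> (w \<otimes> y)"
    using zy(3) u N2_closed[OF u(1)] wk zy(2) subgroup.mem_carrier[OF subgroup_Gamma]
    by (simp add: m_assoc)
  ultimately show ?case using u(1) by auto
qed

end

section \<open>Lazard's description of the fastest series\<close>

context group
begin

lemma subset_generate: "S \<subseteq> T \<Longrightarrow> S \<subseteq> generate G T"
  by (intro subsetI generate.incl) (rule subsetD)

context
  fixes k :: nat
  assumes k: "1 \<le> k"
begin

abbreviation "stage_gens d j \<equiv>
  {x [^^] j | x. x \<in> \<gamma> d} \<union> \<gamma> (Suc d) \<union> \<Gamma> k"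

text \<open>For fixed \<open>d\<close>, a chain from \<open>\<gamma> d\<close> times
  \<open>\<Gamma> k\<close> down to \<open>\<gamma> (Suc d)\<close> times \<open>\<Gamma> k\<close>
  by repeated squaring. It arrives after \<open>k\<close> squarings at the latest, and the chain for
  \<open>Suc d\<close> takes over.\<close>

definition stage :: "nat \<Rightarrow> nat \<Rightarrow> 'a set" where
  "stage d j = generate G (stage_gens d j)"

lemma stage_gen_closed: "stage_gens d j \<subseteq> carrier G"
  using gamma_closed subgroup.mem_carrier[OF subgroup_Gamma] nat_pow_closed by blast

lemma normal_stage: "stage d j \<lhd> G"
  unfolding stage_def
proof (rule normal_generateI[OF stage_gen_closed])
  fix s g assume s: "s \<in> stage_gens d j" and g: "g \<in> carrier G"
  then consider x where "s = x [^^] j" "x \<in> \<gamma> d"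
    | "s \<in> \<gamma> (Suc d)" | "s \<in> \<Gamma> k" by blast
  then show "g \<otimes> s \<otimes> inv g \<in> stage_gens d j"
  proof cases
    case 1
    then show ?thesis
      using conj_pow[OF gamma_closed g] normal.inv_op_closed2[OF normal_gamma g] by blast
  qed (use normal.inv_op_closed2[OF normal_gamma g]
      normal.inv_op_closed2[OF normal_Gamma g] in blast)+
qed

lemma subgroup_stage: "subgroup (stage d j) G"
  by (rule normal.axioms(1)[OF normal_stage])

lemma stage_0: "stage d 0 = generate G (\<gamma> d \<union> \<gamma> (Suc d) \<union> \<Gamma> k)"
proof -
  have "{x [^^] 0 | x. x \<in> \<gamma> d} = \<gamma> d"
    using gamma_closed by force
  then show ?thesis by (simp add: stage_def)
qed

text \<open>\<open>\<gamma> d\<close> is central modulo \<open>\<gamma> (Suc d)\<close>. Elements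
  commuting with a fixed \<open>y\<close> modulo a normal subgroup form a subgroup, so checking
  generators is enough.\<close>

lemma stage_comm:
  assumes "1 \<le> d" "x \<in> stage d 0" "y \<in> carrier G"
  shows "com x y \<in> stage (Suc d) 0"
proof -
  let ?N = "stage (Suc d) 0"
  have sub: "\<gamma> (Suc d) \<subseteq> ?N" "\<Gamma> k \<subseteq> ?N"
    unfolding stage_0 by (rule subset_generate, blast)+
  interpret N: normal ?N G by (rule normal_stage)
  interpret Q: group "G Mod ?N" by (rule N.factorgroup_is_group)
  have conj: "inv y \<otimes> h \<otimes> y \<in> ?N" if "h \<in> ?N" for h
    using N.inv_op_closed1[OF assms(3) that] .
  have "subgroup {x \<in> carrier G. com x y \<in> ?N} G"
  proof (rule subgroupI)
    have "\<one> \<in> {x \<in> carrier G. com x y \<in> ?N}"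
      using assms(3) N.one_closed by (simp add: grp_comm_def)
    then show "{x \<in> carrier G. com x y \<in> ?N} \<noteq> {}" by blast
    show "inv x \<in> {x \<in> carrier G. com x y \<in> ?N}" if x: "x \<in> {x \<in> carrier G. com x y \<in> ?N}" for x
    proof -
      have "com (inv x) y = x \<otimes> inv (com x y) \<otimes> inv x"
        using x assms(3) by (simp add: word_simps)
      moreover have "\<dots> \<in> ?N" using x N.inv_op_closed2 by blast
      ultimately show ?thesis using x by simp
    qed
    show "x \<otimes> z \<in> {x \<in> carrier G. com x y \<in> ?N}"
      if x: "x \<in> {x \<in> carrier G. com x y \<in> ?N}" and z: "z \<in> {x \<in> carrier G. com x y \<in> ?N}" for x z
    proof -
      have "com (x \<otimes> z) y = (inv z \<otimes> com x y \<otimes> z) \<otimes> com z y"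
        using x z assms(3) by (simp add: word_simps)
      moreover have "\<dots> \<in> ?N" using x z N.inv_op_closed1 by blast
      ultimately show ?thesis using x z by simp
    qed
  qed auto
  moreover have "\<gamma> d \<union> \<gamma> (Suc d) \<union> \<Gamma> k
      \<subseteq> {x \<in> carrier G. com x y \<in> ?N}"
  proof
    fix s assume s: "s \<in> \<gamma> d \<union> \<gamma> (Suc d) \<union> \<Gamma> k"
    have sc: "s \<in> carrier G"
      using s gamma_closed subgroup.mem_carrier[OF subgroup_Gamma] by blast
    have *: "com s y \<in> H" if H: "H \<lhd> G" "s \<in> H" for H
    proof -
      have "com s y = inv s \<otimes> (inv y \<otimes> s \<otimes> y)" using sc assms(3) by (simp add: word_simps)
      then show ?thesis
        using subgroup.m_closed[OF normal.axioms(1)[OF H(1)] subgroup.m_inv_closed[OF normal.axioms(1)[OF H(1)] H(2)]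
            normal.inv_op_closed1[OF H(1) assms(3) H(2)]] by simp
    qed
    have "com s y \<in> \<gamma> (Suc d) \<union> \<Gamma> k"
      using s gamma_comm[OF assms(1) _ assms(3)] *[OF normal_gamma]
        *[OF normal_Gamma] by blast
    then show "s \<in> {x \<in> carrier G. com x y \<in> ?N}" using sc sub by blast
  qed
  ultimately have "stage d 0 \<subseteq> {x \<in> carrier G. com x y \<in> ?N}"
    unfolding stage_0 by (rule generate_le)
  then show ?thesis using assms(2) by blast
qed

lemma stage_subset_0: "stage d j \<subseteq> stage d 0"
  unfolding stage_def[of d j]
proof (rule generate_le[OF subgroup_stage])
  have pow: "x [^] (n :: nat) \<in> \<gamma> d" if "x \<in> \<gamma> d" for x n
    by (induction n) (use that subgroup_gamma[of d] in \<open>auto simp: subgroup_def\<close>)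
  show "stage_gens d j \<subseteq> stage d 0"
    unfolding stage_0 by (rule subset_generate) (use pow in blast)
qed

lemma stage_Suc_subset: "stage (Suc d) 0 \<subseteq> generate G (\<gamma> (Suc d) \<union> \<Gamma> k)"
  unfolding stage_0
proof (rule generate_le)
  show "subgroup (generate G (\<gamma> (Suc d) \<union> \<Gamma> k)) G"
    by (rule generate_is_subgroup)
      (use gamma_closed subgroup.mem_carrier[OF subgroup_Gamma] in blast)
  have "\<gamma> (Suc (Suc d)) \<subseteq> \<gamma> (Suc d)"
  proof -
    have "generate G {com g h |g h. g \<in> \<gamma> (Suc d) \<and> h \<in> carrier G} \<subseteq> \<gamma> (Suc d)"
    proof (rule generate_le[OF subgroup_gamma], clarify)
      fix g h assume g: "g \<in> \<gamma> (Suc d)" and h: "h \<in> carrier G"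
      have "com g h = inv g \<otimes> (inv h \<otimes> g \<otimes> h)"
        using gamma_closed[OF g] h by (simp add: word_simps)
      then show "com g h \<in> \<gamma> (Suc d)"
        using subgroup.m_closed[OF subgroup_gamma subgroup.m_inv_closed[OF subgroup_gamma g]
            normal.inv_op_closed1[OF normal_gamma h g]] by simp
    qed
    then show ?thesis by simp
  qed
  then show "\<gamma> (Suc d) \<union> \<gamma> (Suc (Suc d)) \<union> \<Gamma> k
      \<subseteq> generate G (\<gamma> (Suc d) \<union> \<Gamma> k)"
    by (intro subset_generate) blast
qed

lemma stage_Suc_subset_stage: "stage (Suc d) 0 \<subseteq> stage d j"
proof (rule order.trans[OF stage_Suc_subset generate_le[OF subgroup_stage]])
  show "\<gamma> (Suc d) \<union> \<Gamma> k \<subseteq> stage d j"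
    unfolding stage_def by (rule subset_generate) blast
qed

text \<open>Elements of \<open>stage d 0\<close> commute modulo \<open>stage (Suc d) 0\<close>, so
  squaring is multiplicative there and the claim reduces to generators.\<close>

lemma stage_square:
  assumes "1 \<le> d" "x \<in> stage d j"
  shows "x \<otimes> x \<in> stage d (Suc j)"
proof -
  let ?S = "{x \<in> stage d j. x \<otimes> x \<in> stage d (Suc j)}"
  have cl: "x \<in> stage d j \<Longrightarrow> x \<in> carrier G" for x j
    using subgroup.mem_carrier[OF subgroup_stage] .
  have "subgroup ?S G"
  proof (rule subgroupI)
    show "?S \<subseteq> carrier G" using cl by blast
    have "\<one> \<in> ?S" using subgroup.one_closed[OF subgroup_stage] by simp
    then show "?S \<noteq> {}" by blast
    show "inv x \<in> ?S" if "x \<in> ?S" for x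
      using that subgroup.m_inv_closed[OF subgroup_stage] cl by (auto simp flip: inv_mult_group)
    show "x \<otimes> y \<in> ?S" if x: "x \<in> ?S" and y: "y \<in> ?S" for x y
    proof -
      have "com x (inv y) \<in> stage (Suc d) 0"
        using x y cl stage_subset_0[of d j] by (intro stage_comm[OF assms(1)]) auto
      then have "com x (inv y) \<in> stage d (Suc j)" using stage_Suc_subset_stage by blast
      then have "(x \<otimes> x) \<otimes> com x (inv y) \<otimes> (y \<otimes> y) \<in> stage d (Suc j)"
        using x y by (blast intro: subgroup.m_closed[OF subgroup_stage subgroup.m_closed[OF subgroup_stage]])
      then have "(x \<otimes> y) \<otimes> (x \<otimes> y) \<in> stage d (Suc j)"
        using square_mult[of x y] cl[of x j] cl[of y j] x y by simp
      then show ?thesis using x y subgroup.m_closed[OF subgroup_stage] by blast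
    qed
  qed
  moreover have "stage_gens d j \<subseteq> ?S"
  proof (intro Un_least)
    show "{x [^^] j | x. x \<in> \<gamma> d} \<subseteq> ?S"
    proof clarify
      fix x assume x: "x \<in> \<gamma> d"
      have "x [^^] (Suc j) \<in> stage d (Suc j)" "x [^^] j \<in> stage d j"
        unfolding stage_def by (rule generate.incl, use x in blast)+
      then show "x [^^] j \<in> stage d j \<and> x [^^] j \<otimes> x [^^] j \<in> stage d (Suc j)"
        using pow_Suc_two[OF gamma_closed[OF x]] by simp
    qed
    have *: "\<gamma> (Suc d) \<subseteq> stage d i" "\<Gamma> k \<subseteq> stage d i" for i
      unfolding stage_def by (rule subset_generate, blast)+
    show "\<gamma> (Suc d) \<subseteq> ?S" "\<Gamma> k \<subseteq> ?S"
      using * subgroup.m_closed[OF subgroup_gamma] subgroup.m_closed[OF subgroup_Gamma]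
      by blast+
  qed
  ultimately have "stage d j \<subseteq> ?S" unfolding stage_def[of d j] by (rule generate_le)
  then show ?thesis using assms(2) by blast
qed

text \<open>The number \<open>k\<close> of squarings is a crude choice: \<open>k \<le> 2 ^ k\<close>
  already puts the powers into \<open>\<Gamma> k\<close>.\<close>

lemma stage_last: "1 \<le> d \<Longrightarrow> stage d k \<subseteq> stage (Suc d) 0"
proof -
  assume d: "1 \<le> d"
  have "k \<le> 1 * 2 ^ k" using less_exp[of k] by simp
  also have "\<dots> \<le> d * 2 ^ k" using d by (rule mult_le_mono1)
  finally have kd: "k \<le> d * 2 ^ k" .
  have "{x [^^] k | x. x \<in> \<gamma> d} \<subseteq> \<Gamma> k"
    unfolding Gamma_eq lazard_def by (rule subset_generate) (use d kd in blast)
  then have "stage_gens d k \<subseteq> stage (Suc d) 0"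
    unfolding stage_0 by (intro subset_generate) blast
  then show ?thesis unfolding stage_def[of d k] by (rule generate_le[OF subgroup_stage])
qed

text \<open>A commutator of degree at least \<open>2n\<close> has an entry of degree at least \<open>n\<close>, hence in \<open>stage d 0\<close>,
  so that only squares survive modulo \<open>stage (Suc d) 0\<close>.\<close>

lemma N2_stage:
  assumes d: "1 \<le> d" and n: "1 \<le> n" "filt G n \<subseteq> stage d 0"
  shows "N2 G l x \<Longrightarrow> 2 ^ j * n \<le> l \<Longrightarrow> x \<in> stage d j"
proof (induction arbitrary: j rule: N2.induct)
  case (carrier x)
  then have "n = 1" "j = 0"
    using n by (auto simp: le_Suc_eq)
  then show ?case using n N2.carrier[OF carrier(1)] by auto
next
  case (comm a x b y)
  show ?case
  proof (cases j)
    case 0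
    then have "N2 G n (com x y)"
      using comm n by (intro N2_comm'[of a x b y]) auto
    then show ?thesis using n 0 by blast
  next
    case (Suc i)
    have "2 * n \<le> 2 ^ j * n" unfolding Suc by (intro mult_le_mono1) simp
    then have "2 * n \<le> a + b" using comm.prems by (rule order.trans)
    then consider "n \<le> a" | "n \<le> b" by linarith
    then have "com x y \<in> stage (Suc d) 0"
    proof cases
      case 1
      then have "x \<in> stage d 0" using N2_antimono[OF comm(1)] n by blast
      then show ?thesis by (rule stage_comm[OF d]) (rule N2_closed[OF comm(2)])
    next
      case 2
      then have "y \<in> stage d 0" using N2_antimono[OF comm(2)] n by blast
      then have "com y x \<in> stage (Suc d) 0"
        by (rule stage_comm[OF d]) (rule N2_closed[OF comm(1)])
      then show ?thesis
        using subgroup.m_inv_closed[OF subgroup_stage] inv_grp_comm N2_closed comm(1,2) by metis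
    qed
    then show ?thesis using stage_Suc_subset_stage by blast
  qed
next
  case (square a x)
  show ?case
  proof (cases j)
    case 0
    then have "N2 G n (x \<otimes> x)"
      using square n by (intro N2_square'[of a x]) auto
    then show ?thesis using n 0 by blast
  next
    case (Suc i)
    then have "2 ^ i * n \<le> a" using square.prems by simp
    then show ?thesis using stage_square[OF d square.IH] Suc by simp
  qed
qed (auto intro: subgroup.one_closed[OF subgroup_stage] subgroup.m_closed[OF subgroup_stage]
    subgroup.m_inv_closed[OF subgroup_stage])

text \<open>Passing from \<open>d\<close> to \<open>Suc d\<close> multiplies the threshold by
  \<open>2 ^ k\<close>, the cost of \<open>k\<close> squarings in \<open>N2_stage\<close>.\<close>

lemma filt_subset_stage: "1 \<le> d \<Longrightarrow> \<exists>n\<ge>1. filt G n \<subseteq> stage d 0"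
proof (induction d rule: dec_induct)
  case base
  have "filt G 1 \<subseteq> stage 1 0"
    unfolding stage_0 by (rule subset_generate) (use N2_closed in auto)
  then show ?case by blast
next
  case (step d)
  then obtain n where n: "1 \<le> n" "filt G n \<subseteq> stage d 0" by blast
  have "filt G (2 ^ k * n) \<subseteq> stage d k"
    using N2_stage[OF step(1) n] by blast
  with stage_last[OF step(1)] n show ?case by (intro exI[of _ "2 ^ k * n"]) auto
qed

lemma filt_subset_Gamma: "\<exists>n\<ge>1. filt G n \<subseteq> \<Gamma> k"
proof -
  obtain n where n: "1 \<le> n" "filt G n \<subseteq> stage (Suc k) 0" using filt_subset_stage[of "Suc k"] by auto
  have "\<gamma> (Suc k) \<subseteq> \<Gamma> k"
    using gamma_subset_Gamma[of "Suc k"] Gamma_antimono[of k "Suc k"] by auto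
  then have "generate G (\<gamma> (Suc k) \<union> \<Gamma> k) \<subseteq> \<Gamma> k"
    by (intro generate_le[OF subgroup_Gamma]) auto
  with n stage_Suc_subset[of k] show ?thesis by blast
qed

end

text \<open>The error left by \<open>N2_decompose\<close> is pushed past the degree from which on
  the filtration lies in \<open>\<Gamma> k\<close>.\<close>

theorem Gamma_filt:
  assumes "1 \<le> k"
  shows "\<Gamma> k = filt G k"
proof
  show "\<Gamma> k \<subseteq> filt G k" using Gamma_N2[OF assms] by blast
  obtain n where n: "1 \<le> n" "filt G n \<subseteq> \<Gamma> k"
    using filt_subset_Gamma[OF assms] by blast
  show "filt G k \<subseteq> \<Gamma> k"
  proof
    fix x assume "x \<in> filt G k"
    then obtain z y where zy: "N2 G (k + n) z" "y \<in> \<Gamma> k" "x = z \<otimes> y"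
      using N2_decompose[of k x n] by blast
    have "N2 G n z" using N2_antimono[OF zy(1)] n by simp
    then show "x \<in> \<Gamma> k"
      unfolding zy(3) using n zy(2) by (intro subgroup.m_closed[OF subgroup_Gamma]) auto
  qed
qed

end

section \<open>Graded 2-Lie algebras\<close>

text \<open>The construction of \<^const>\<open>gr_two_lie\<close> for arbitrary components and homogeneous operations.\<close>

definition graded_sum ::
  "(nat \<Rightarrow> 'c monoid) \<Rightarrow> (nat \<Rightarrow> nat \<Rightarrow> 'c \<Rightarrow> 'c \<Rightarrow> 'c) \<Rightarrow> (nat \<Rightarrow> 'c \<Rightarrow> 'c) \<Rightarrow> (nat \<Rightarrow> 'c) two_lie" where
  "graded_sum C br sqh =
    (let S = sum_group {1..} C in
     \<lparr>carrier = carrier S, monoid.mult = undefined, one = undefined,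
      zero = \<one>\<^bsub>S\<^esub>, add = monoid.mult S,
      smult = (\<lambda>a x. x [^]\<^bsub>S\<^esub> (a :: int)),
      bracket = (\<lambda>x y. \<lambda>n\<in>{1..}. \<Otimes>\<^bsub>C n\<^esub>k\<in>{1..<n}. br k (n - k) (x k) (y (n - k))),
      sq = (\<lambda>x. \<lambda>n\<in>{1..}.
        (\<Otimes>\<^bsub>C n\<^esub>k\<in>{k. 1 \<le> k \<and> 2 * k = n}. sqh k (x k))
        \<otimes>\<^bsub>C n\<^esub>
        (\<Otimes>\<^bsub>C n\<^esub>k\<in>{k. 1 \<le> k \<and> k < n - k}. br k (n - k) (x k) (x (n - k))))\<rparr>)"

definition hom_elem :: "(nat \<Rightarrow> 'c monoid) \<Rightarrow> nat \<Rightarrow> 'c \<Rightarrow> nat \<Rightarrow> 'c" where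
  "hom_elem C k X = (\<lambda>n\<in>{1..}. if n = k then X else \<one>\<^bsub>C n\<^esub>)"

text \<open>What has to be verified on homogeneous elements. In \<open>br_jacobi\<close> the degree
  \<open>n\<close> is a variable because the degrees of the three terms agree only after
  arithmetic.\<close>

locale graded_two_lie =
  fixes C :: "nat \<Rightarrow> 'c monoid" and br :: "nat \<Rightarrow> nat \<Rightarrow> 'c \<Rightarrow> 'c \<Rightarrow> 'c" and sqh :: "nat \<Rightarrow> 'c \<Rightarrow> 'c"
  assumes comm_group_C: "1 \<le> n \<Longrightarrow> comm_group (C n)"
    and C_self: "1 \<le> n \<Longrightarrow> X \<in> carrier (C n) \<Longrightarrow> X \<otimes>\<^bsub>C n\<^esub> X = \<one>\<^bsub>C n\<^esub>"
    and br_closed: "\<lbrakk>1 \<le> k; 1 \<le> l; X \<in> carrier (C k); Y \<in> carrier (C l)\<rbrakk> \<Longrightarrow>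
      br k l X Y \<in> carrier (C (k + l))"
    and br_mult_left: "\<lbrakk>1 \<le> k; 1 \<le> l; X \<in> carrier (C k); X' \<in> carrier (C k);
      Y \<in> carrier (C l)\<rbrakk> \<Longrightarrow> br k l (X \<otimes>\<^bsub>C k\<^esub> X') Y = br k l X Y \<otimes>\<^bsub>C (k + l)\<^esub> br k l X' Y"
    and br_sym: "\<lbrakk>1 \<le> k; 1 \<le> l; X \<in> carrier (C k); Y \<in> carrier (C l)\<rbrakk> \<Longrightarrow>
      br k l X Y = br l k Y X"
    and br_self: "1 \<le> k \<Longrightarrow> X \<in> carrier (C k) \<Longrightarrow> br k k X X = \<one>\<^bsub>C (k + k)\<^esub>"
    and br_jacobi: "\<lbrakk>1 \<le> a; 1 \<le> b; 1 \<le> c;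
      X \<in> carrier (C a); Y \<in> carrier (C b); Z \<in> carrier (C c); n = a + b + c\<rbrakk> \<Longrightarrow>
      br a (b + c) X (br b c Y Z) \<otimes>\<^bsub>C n\<^esub> br b (c + a) Y (br c a Z X)
        \<otimes>\<^bsub>C n\<^esub> br c (a + b) Z (br a b X Y) = \<one>\<^bsub>C n\<^esub>"
    and sqh_closed: "1 \<le> k \<Longrightarrow> X \<in> carrier (C k) \<Longrightarrow> sqh k X \<in> carrier (C (2 * k))"
    and sqh_mult: "\<lbrakk>1 \<le> k; X \<in> carrier (C k); Y \<in> carrier (C k)\<rbrakk> \<Longrightarrow>
      sqh k (X \<otimes>\<^bsub>C k\<^esub> Y) = sqh k X \<otimes>\<^bsub>C (2 * k)\<^esub> sqh k Y \<otimes>\<^bsub>C (2 * k)\<^esub> br k k X Y"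
    and br_sqh: "\<lbrakk>1 \<le> k; 1 \<le> l; X \<in> carrier (C k); Y \<in> carrier (C l)\<rbrakk> \<Longrightarrow>
      br k (2 * l) X (sqh l Y) = br (k + l) l (br k l X Y) Y"
begin

abbreviation "L \<equiv> graded_sum C br sqh"
abbreviation sum_add (infixl "\<oplus>\<^sub>L" 65) where "x \<oplus>\<^sub>L y \<equiv> x \<oplus>\<^bsub>L\<^esub> y"
abbreviation sum_zero ("\<zero>\<^sub>L") where "\<zero>\<^sub>L \<equiv> \<zero>\<^bsub>L\<^esub>"

lemma group_C: "1 \<le> n \<Longrightarrow> group (C n)"
  by (simp add: comm_group_C comm_group.axioms)

lemma carrier_L: "x \<in> carrier L \<longleftrightarrow> x \<in> extensional {1..} \<and> (\<forall>n\<ge>1. x n \<in> carrier (C n)) \<and>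
    finite {n. 1 \<le> n \<and> x n \<noteq> \<one>\<^bsub>C n\<^esub>}"
proof -
  have "carrier L = carrier (sum_group {1..} C)" by (simp add: graded_sum_def Let_def)
  also have "\<dots> = {x \<in> \<Pi>\<^sub>E i\<in>{1..}. carrier (C i). finite {i \<in> {1..}. x i \<noteq> \<one>\<^bsub>C i\<^esub>}}"
    by (rule carrier_sum_group) (simp add: group_C)
  finally show ?thesis by (auto simp: PiE_iff)
qed

lemma L_comp: "x \<in> carrier L \<Longrightarrow> 1 \<le> n \<Longrightarrow> x n \<in> carrier (C n)"
  by (simp add: carrier_L)

lemma L_eqI:
  assumes "x \<in> carrier L" "y \<in> carrier L" "\<And>n. 1 \<le> n \<Longrightarrow> x n = y n"
  shows "x = y"
  using assms by (auto simp: carrier_L intro: extensionalityI)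

lemma L_carrierI:
  assumes "x \<in> extensional {1..}" "\<And>n. 1 \<le> n \<Longrightarrow> x n \<in> carrier (C n)" "finite A"
    "\<And>n. 1 \<le> n \<Longrightarrow> n \<notin> A \<Longrightarrow> x n = \<one>\<^bsub>C n\<^esub>"
  shows "x \<in> carrier L"
  using assms(1,2) finite_subset[OF _ assms(3), of "{n. 1 \<le> n \<and> x n \<noteq> \<one>\<^bsub>C n\<^esub>}"] assms(4)
  by (auto simp: carrier_L)

lemma add_L: "x \<oplus>\<^sub>L y = (\<lambda>n\<in>{1..}. x n \<otimes>\<^bsub>C n\<^esub> y n)"
  and zero_L: "\<zero>\<^sub>L = (\<lambda>n\<in>{1..}. \<one>\<^bsub>C n\<^esub>)"
  and bracket_L: "bracket L x y =
    (\<lambda>n\<in>{1..}. \<Otimes>\<^bsub>C n\<^esub>k\<in>{1..<n}. br k (n - k) (x k) (y (n - k)))"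
  and sq_L: "sq L x = (\<lambda>n\<in>{1..}.
        (\<Otimes>\<^bsub>C n\<^esub>k\<in>{k. 1 \<le> k \<and> 2 * k = n}. sqh k (x k))
        \<otimes>\<^bsub>C n\<^esub>
        (\<Otimes>\<^bsub>C n\<^esub>k\<in>{k. 1 \<le> k \<and> k < n - k}. br k (n - k) (x k) (x (n - k))))"
  by (simp_all add: graded_sum_def Let_def)

lemma smult_L: "0 \<odot>\<^bsub>L\<^esub> x = \<zero>\<^sub>L" "x \<in> carrier L \<Longrightarrow> 1 \<odot>\<^bsub>L\<^esub> x = x"
proof -
  have g: "group (sum_group {1..} C)" by (rule sum_group) (simp add: group_C)
  show "0 \<odot>\<^bsub>L\<^esub> x = \<zero>\<^sub>L"
    by (simp add: graded_sum_def Let_def int_pow_def2 del: one_sum_group)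
  show "1 \<odot>\<^bsub>L\<^esub> x = x" if "x \<in> carrier L"
    using that group.int_pow_1[OF g] by (simp add: graded_sum_def Let_def)
qed

lemma one_C [simp]: "1 \<le> n \<Longrightarrow> \<one>\<^bsub>C n\<^esub> \<in> carrier (C n)"
  by (rule monoid.one_closed[OF group.is_monoid[OF group_C]])

lemma C_idem: "\<lbrakk>1 \<le> n; X \<in> carrier (C n); X = X \<otimes>\<^bsub>C n\<^esub> X\<rbrakk> \<Longrightarrow> X = \<one>\<^bsub>C n\<^esub>"
  using C_self[of n X] by simp

lemma C_r_one [simp]: "1 \<le> n \<Longrightarrow> X \<in> carrier (C n) \<Longrightarrow> X \<otimes>\<^bsub>C n\<^esub> \<one>\<^bsub>C n\<^esub> = X"
  by (rule monoid.r_one[OF group.is_monoid[OF group_C]])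

lemma br_one_left: "\<lbrakk>1 \<le> k; 1 \<le> l; Y \<in> carrier (C l)\<rbrakk> \<Longrightarrow> br k l \<one>\<^bsub>C k\<^esub> Y = \<one>\<^bsub>C (k + l)\<^esub>"
  by (rule C_idem) (use br_mult_left[of k l "\<one>\<^bsub>C k\<^esub>" "\<one>\<^bsub>C k\<^esub>" Y] in \<open>auto simp: br_closed\<close>)

lemma br_one_right: "\<lbrakk>1 \<le> k; 1 \<le> l; X \<in> carrier (C k)\<rbrakk> \<Longrightarrow> br k l X \<one>\<^bsub>C l\<^esub> = \<one>\<^bsub>C (k + l)\<^esub>"
  using br_sym[of k l X "\<one>\<^bsub>C l\<^esub>"] br_one_left[of l k X] by (simp add: add.commute)

lemma sqh_one: "1 \<le> k \<Longrightarrow> sqh k \<one>\<^bsub>C k\<^esub> = \<one>\<^bsub>C (2 * k)\<^esub>"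
  using sqh_mult[of k "\<one>\<^bsub>C k\<^esub>" "\<one>\<^bsub>C k\<^esub>"] br_self[of k "\<one>\<^bsub>C k\<^esub>"] sqh_closed[of k "\<one>\<^bsub>C k\<^esub>"]
    C_self[of "2 * k" "sqh k \<one>\<^bsub>C k\<^esub>"]
  by (simp add: mult_2)

lemma br_closed':
  "\<lbrakk>x \<in> carrier L; y \<in> carrier L; 1 \<le> k; k < n\<rbrakk> \<Longrightarrow> br k (n - k) (x k) (y (n - k)) \<in> carrier (C n)"
  using br_closed[of k "n - k" "x k" "y (n - k)"] L_comp by simp

lemma sqh_closed': "\<lbrakk>x \<in> carrier L; 1 \<le> k; 2 * k = n\<rbrakk> \<Longrightarrow> sqh k (x k) \<in> carrier (C n)"
  using sqh_closed[of k "x k"] L_comp by auto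

lemma zero_closed_L: "\<zero>\<^sub>L \<in> carrier L"
  by (rule L_carrierI[of _ "{}"]) (auto simp: zero_L)

lemma add_closed_L:
  assumes "x \<in> carrier L" "y \<in> carrier L"
  shows "x \<oplus>\<^sub>L y \<in> carrier L"
proof (rule L_carrierI)
  show "finite ({n. 1 \<le> n \<and> x n \<noteq> \<one>\<^bsub>C n\<^esub>} \<union> {n. 1 \<le> n \<and> y n \<noteq> \<one>\<^bsub>C n\<^esub>})"
    using assms by (simp add: carrier_L)
  show "(x \<oplus>\<^sub>L y) n \<in> carrier (C n)" if n: "1 \<le> n" for n
    using n L_comp[OF assms(1) n] L_comp[OF assms(2) n] group.is_monoid[OF group_C[OF n]]
    by (simp add: add_L monoid.m_closed)
qed (auto simp: add_L)

lemma bracket_closed_L: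
  assumes x: "x \<in> carrier L" and y: "y \<in> carrier L"
  shows "bracket L x y \<in> carrier L"
proof (rule L_carrierI)
  let ?S = "\<lambda>x. {n. 1 \<le> n \<and> x n \<noteq> \<one>\<^bsub>C n\<^esub>}"
  \<comment> \<open>A nontrivial component of the bracket sits in the sumset of the two
    supports.\<close>
  show "finite ((\<lambda>(a, b). a + b) ` (?S x \<times> ?S y))"
    using assms by (simp add: carrier_L)
  fix n :: nat assume n: "1 \<le> n"
  interpret C: comm_group "C n" by (rule comm_group_C[OF n])
  show "bracket L x y n \<in> carrier (C n)"
    using n br_closed'[OF x y] by (auto simp: bracket_L intro!: C.finprod_closed)
  assume nS: "n \<notin> (\<lambda>(a, b). a + b) ` (?S x \<times> ?S y)"
  have "br k (n - k) (x k) (y (n - k)) = \<one>\<^bsub>C n\<^esub>" if k: "k \<in> {1..<n}" for k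
  proof -
    have "x k = \<one>\<^bsub>C k\<^esub> \<or> y (n - k) = \<one>\<^bsub>C (n - k)\<^esub>"
    proof (rule ccontr)
      assume "\<not> (x k = \<one>\<^bsub>C k\<^esub> \<or> y (n - k) = \<one>\<^bsub>C (n - k)\<^esub>)"
      then have "n \<in> (\<lambda>(a, b). a + b) ` (?S x \<times> ?S y)"
        using k by (intro image_eqI[of _ _ "(k, n - k)"]) auto
      then show False using nS by blast
    qed
    then show ?thesis
      using k br_one_left[of k "n - k" "y (n - k)"] br_one_right[of k "n - k" "x k"] L_comp[OF x] L_comp[OF y]
      by auto
  qed
  then have "(\<Otimes>\<^bsub>C n\<^esub>k\<in>{1..<n}. br k (n - k) (x k) (y (n - k))) = \<one>\<^bsub>C n\<^esub>"
    by (rule C.finprod_one_eqI)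
  then show "bracket L x y n = \<one>\<^bsub>C n\<^esub>"
    using n by (simp add: bracket_L)
qed (simp add: bracket_L)

lemma sq_closed_L:
  assumes x: "x \<in> carrier L"
  shows "sq L x \<in> carrier L"
proof (rule L_carrierI)
  let ?S = "{n. 1 \<le> n \<and> x n \<noteq> \<one>\<^bsub>C n\<^esub>}"
  show "finite ((\<lambda>(a, b). a + b) ` (?S \<times> ?S))"
    using assms by (simp add: carrier_L)
  fix n :: nat assume n: "1 \<le> n"
  interpret C: comm_group "C n" by (rule comm_group_C[OF n])
  have c: "(\<Otimes>\<^bsub>C n\<^esub>k\<in>{k. 1 \<le> k \<and> 2 * k = n}. sqh k (x k)) \<in> carrier (C n)"
    "(\<Otimes>\<^bsub>C n\<^esub>k\<in>{k. 1 \<le> k \<and> k < n - k}. br k (n - k) (x k) (x (n - k))) \<in> carrier (C n)"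
    using sqh_closed'[OF x] br_closed'[OF x x] by (auto intro!: C.finprod_closed)
  then show "sq L x n \<in> carrier (C n)" using n by (simp add: sq_L)
  assume nS: "n \<notin> (\<lambda>(a, b). a + b) ` (?S \<times> ?S)"
  have 1: "br k (n - k) (x k) (x (n - k)) = \<one>\<^bsub>C n\<^esub>" if k: "1 \<le> k" "k < n - k" for k
  proof -
    have "x k = \<one>\<^bsub>C k\<^esub> \<or> x (n - k) = \<one>\<^bsub>C (n - k)\<^esub>"
    proof (rule ccontr)
      assume "\<not> (x k = \<one>\<^bsub>C k\<^esub> \<or> x (n - k) = \<one>\<^bsub>C (n - k)\<^esub>)"
      then have "n \<in> (\<lambda>(a, b). a + b) ` (?S \<times> ?S)"
        using k by (intro image_eqI[of _ _ "(k, n - k)"]) auto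
      then show False using nS by blast
    qed
    then show ?thesis
      using k br_one_left[of k "n - k" "x (n - k)"] br_one_right[of k "n - k" "x k"] L_comp[OF x]
      by auto
  qed
  have 2: "sqh k (x k) = \<one>\<^bsub>C n\<^esub>" if k: "1 \<le> k" "2 * k = n" for k
  proof -
    have "x k = \<one>\<^bsub>C k\<^esub>" using nS k by (force simp: image_iff)
    then show ?thesis using sqh_one k by auto
  qed
  have "(\<Otimes>\<^bsub>C n\<^esub>k\<in>{k. 1 \<le> k \<and> 2 * k = n}. sqh k (x k)) = \<one>\<^bsub>C n\<^esub>"
    by (rule C.finprod_one_eqI) (use 2 in blast)
  moreover have "(\<Otimes>\<^bsub>C n\<^esub>k\<in>{k. 1 \<le> k \<and> k < n - k}. br k (n - k) (x k) (x (n - k))) = \<one>\<^bsub>C n\<^esub>"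
    by (rule C.finprod_one_eqI) (use 1 in blast)
  ultimately show "sq L x n = \<one>\<^bsub>C n\<^esub>"
    using n by (simp add: sq_L)
qed (simp add: sq_L)

lemma hom_elem_closed: "1 \<le> k \<Longrightarrow> X \<in> carrier (C k) \<Longrightarrow> hom_elem C k X \<in> carrier L"
  by (rule L_carrierI[of _ "{k}"]) (auto simp: hom_elem_def)

lemma abelian_group_L: "abelian_group L"
proof (rule abelian_groupI)
  fix x y z assume x: "x \<in> carrier L" and y: "y \<in> carrier L" and z: "z \<in> carrier L"
  have g: "comm_group (C n)" if "1 \<le> n" for n by (rule comm_group_C[OF that])
  show "x \<oplus>\<^sub>L y \<in> carrier L" by (rule add_closed_L[OF x y])
  show "(x \<oplus>\<^sub>L y) \<oplus>\<^sub>L z = x \<oplus>\<^sub>L (y \<oplus>\<^sub>L z)"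
    using monoid.m_assoc[OF group.is_monoid[OF group_C]] L_comp[OF x] L_comp[OF y] L_comp[OF z]
    by (auto simp: add_L fun_eq_iff)
  show "x \<oplus>\<^sub>L y = y \<oplus>\<^sub>L x"
    using comm_monoid.m_comm[OF comm_group.axioms(1)[OF g]] L_comp[OF x] L_comp[OF y]
    by (auto simp: add_L fun_eq_iff)
  show "\<zero>\<^sub>L \<oplus>\<^sub>L x = x"
  proof (rule L_eqI[OF add_closed_L[OF zero_closed_L x] x])
    fix n :: nat assume n: "1 \<le> n"
    show "(\<zero>\<^sub>L \<oplus>\<^sub>L x) n = x n"
      using n monoid.l_one[OF group.is_monoid[OF group_C[OF n]] L_comp[OF x n]]
      by (simp add: add_L zero_L)
  qed
  have "x \<oplus>\<^sub>L x = \<zero>\<^sub>L"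
    using C_self L_comp[OF x] by (auto simp: add_L zero_L fun_eq_iff)
  then show "\<exists>y\<in>carrier L. y \<oplus>\<^sub>L x = \<zero>\<^sub>L" using x by blast
qed (rule zero_closed_L)

interpretation ab: abelian_group L
  by (rule abelian_group_L)

lemma add_self_L: "x \<in> carrier L \<Longrightarrow> x \<oplus>\<^sub>L x = \<zero>\<^sub>L"
  using C_self L_comp[of x] by (auto simp: add_L zero_L fun_eq_iff)

lemma hom_elem_one: "hom_elem C k \<one>\<^bsub>C k\<^esub> = \<zero>\<^sub>L"
  by (auto simp: hom_elem_def zero_L fun_eq_iff)

lemma hom_elem_mult:
  "\<lbrakk>1 \<le> k; X \<in> carrier (C k); Y \<in> carrier (C k)\<rbrakk> \<Longrightarrow>
    hom_elem C k (X \<otimes>\<^bsub>C k\<^esub> Y) = hom_elem C k X \<oplus>\<^sub>L hom_elem C k Y"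
  by (auto simp: hom_elem_def add_L fun_eq_iff)

text \<open>Adding the homogeneous part \<open>x k\<close> deletes it from the support, and adding
  it once more restores \<open>x\<close>, as every component has exponent 2.\<close>

lemma L_induct [consumes 1, case_names zero hom add]:
  assumes x: "x \<in> carrier L"
    and zero: "P \<zero>\<^sub>L"
    and hom: "\<And>k X. 1 \<le> k \<Longrightarrow> X \<in> carrier (C k) \<Longrightarrow> P (hom_elem C k X)"
    and add: "\<And>x y. \<lbrakk>x \<in> carrier L; y \<in> carrier L; P x; P y\<rbrakk> \<Longrightarrow> P (x \<oplus>\<^sub>L y)"
  shows "P x"
  using x
proof (induction "card {n. 1 \<le> n \<and> x n \<noteq> \<one>\<^bsub>C n\<^esub>}" arbitrary: x)
  case 0
  then have "{n. 1 \<le> n \<and> x n \<noteq> \<one>\<^bsub>C n\<^esub>} = {}" by (simp add: carrier_L)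
  then have "x = \<zero>\<^sub>L"
    by (intro L_eqI[OF 0(2) zero_closed_L]) (auto simp: zero_L)
  then show ?case using zero by simp
next
  case (Suc d)
  let ?S = "{n. 1 \<le> n \<and> x n \<noteq> \<one>\<^bsub>C n\<^esub>}"
  have fin: "finite ?S" using Suc.prems by (simp add: carrier_L)
  from Suc(2) obtain k where k: "k \<in> ?S" by (metis Suc_neq_Zero card.empty equals0I)
  let ?h = "hom_elem C k (x k)" and ?y = "x \<oplus>\<^sub>L hom_elem C k (x k)"
  have h: "?h \<in> carrier L" using k L_comp[OF Suc.prems] by (intro hom_elem_closed) auto
  have y: "?y \<in> carrier L" by (rule add_closed_L[OF Suc.prems h])
  have "{n. 1 \<le> n \<and> ?y n \<noteq> \<one>\<^bsub>C n\<^esub>} = ?S - {k}"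
    using k L_comp[OF Suc.prems] C_self by (auto simp: add_L hom_elem_def split: if_splits)
  then have "card {n. 1 \<le> n \<and> ?y n \<noteq> \<one>\<^bsub>C n\<^esub>} = d"
    using Suc(2) k fin by simp
  then have "P ?y" using Suc(1) y by blast
  then have "P (?y \<oplus>\<^sub>L ?h)"
    using add[OF y h] hom k L_comp[OF Suc.prems] by auto
  moreover have "?y \<oplus>\<^sub>L ?h = x"
    using Suc.prems h by (simp add: ab.a_assoc add_self_L)
  ultimately show ?case by simp
qed

lemma bracket_hom:
  assumes "1 \<le> a" "1 \<le> b" "X \<in> carrier (C a)" "Y \<in> carrier (C b)"
  shows "bracket L (hom_elem C a X) (hom_elem C b Y) = hom_elem C (a + b) (br a b X Y)"
proof (rule L_eqI)
  show "bracket L (hom_elem C a X) (hom_elem C b Y) \<in> carrier L"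
    by (intro bracket_closed_L hom_elem_closed assms)
  show "hom_elem C (a + b) (br a b X Y) \<in> carrier L"
    by (rule hom_elem_closed) (use assms br_closed in auto)
  fix n :: nat assume n: "1 \<le> n"
  interpret C: comm_group "C n" by (rule comm_group_C[OF n])
  have t: "br k (n - k) (hom_elem C a X k) (hom_elem C b Y (n - k)) =
      (if a = k then (if n = a + b then br a b X Y else \<one>\<^bsub>C n\<^esub>) else \<one>\<^bsub>C n\<^esub>)" if k: "k \<in> {1..<n}" for k
    using k assms br_one_left[of k "n - k" "hom_elem C b Y (n - k)"] br_one_right[of k "n - k" X]
    by (auto simp: hom_elem_def)
  have "(\<Otimes>\<^bsub>C n\<^esub>k\<in>{1..<n}. br k (n - k) (hom_elem C a X k) (hom_elem C b Y (n - k))) =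
      (\<Otimes>\<^bsub>C n\<^esub>k\<in>{1..<n}. if a = k then (if n = a + b then br a b X Y else \<one>\<^bsub>C n\<^esub>) else \<one>\<^bsub>C n\<^esub>)"
    by (rule C.finprod_cong'[OF HOL.refl _ t]) (use assms br_closed in auto)
  also have "\<dots> = (if n = a + b then br a b X Y else \<one>\<^bsub>C n\<^esub>)"
  proof (cases "n = a + b")
    case True
    then have "a \<in> {1..<n}" using assms by auto
    then show ?thesis
      using C.finprod_singleton[of a "{1..<n}" "\<lambda>_. br a b X Y"] True br_closed assms by auto
  qed (simp add: C.finprod_one_eqI)
  finally show "bracket L (hom_elem C a X) (hom_elem C b Y) n = hom_elem C (a + b) (br a b X Y) n"
    using n by (simp add: bracket_L hom_elem_def[of _ "a + b"])
qed

lemma sq_hom: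
  assumes "1 \<le> a" "X \<in> carrier (C a)"
  shows "sq L (hom_elem C a X) = hom_elem C (2 * a) (sqh a X)"
proof (rule L_eqI)
  show "sq L (hom_elem C a X) \<in> carrier L"
    by (intro sq_closed_L hom_elem_closed assms)
  show "hom_elem C (2 * a) (sqh a X) \<in> carrier L"
    by (rule hom_elem_closed) (use assms sqh_closed in auto)
  fix n :: nat assume n: "1 \<le> n"
  interpret C: comm_group "C n" by (rule comm_group_C[OF n])
  have 1: "br k (n - k) (hom_elem C a X k) (hom_elem C a X (n - k)) = \<one>\<^bsub>C n\<^esub>"
    if k: "1 \<le> k" "k < n - k" for k
    using k assms br_one_left[of k "n - k" "hom_elem C a X (n - k)"] br_one_right[of k "n - k" X]
    by (auto simp: hom_elem_def)
  have "(\<Otimes>\<^bsub>C n\<^esub>k\<in>{k. 1 \<le> k \<and> 2 * k = n}. sqh k (hom_elem C a X k)) =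
      (if n = 2 * a then sqh a X else \<one>\<^bsub>C n\<^esub>)"
  proof (cases "n = 2 * a")
    case True
    then have "{k. 1 \<le> k \<and> 2 * k = n} = {a}" using assms by auto
    moreover have "sqh a X \<in> carrier (C n)" using True assms sqh_closed by simp
    then have "finprod (C n) (\<lambda>k. sqh k (hom_elem C a X k)) {a} = sqh a X"
      using C.finprod_insert[of "{}" a "\<lambda>k. sqh k (hom_elem C a X k)"] assms
      by (simp add: hom_elem_def)
    ultimately show ?thesis using True by simp
  next
    case False
    then have "sqh k (hom_elem C a X k) = \<one>\<^bsub>C n\<^esub>" if "1 \<le> k" "2 * k = n" for k
      using that sqh_one by (auto simp: hom_elem_def)
    then have "(\<Otimes>\<^bsub>C n\<^esub>k\<in>{k. 1 \<le> k \<and> 2 * k = n}. sqh k (hom_elem C a X k)) = \<one>\<^bsub>C n\<^esub>"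
      by (intro C.finprod_one_eqI) blast
    then show ?thesis using False by simp
  qed
  moreover have "(\<Otimes>\<^bsub>C n\<^esub>k\<in>{k. 1 \<le> k \<and> k < n - k}.
      br k (n - k) (hom_elem C a X k) (hom_elem C a X (n - k))) = \<one>\<^bsub>C n\<^esub>"
    by (rule C.finprod_one_eqI) (use 1 in blast)
  moreover have "hom_elem C (2 * a) (sqh a X) n = (if n = 2 * a then sqh a X else \<one>\<^bsub>C n\<^esub>)"
    using n by (simp add: hom_elem_def)
  ultimately show "sq L (hom_elem C a X) n = hom_elem C (2 * a) (sqh a X) n"
    using n assms sqh_closed by (simp add: sq_L)
qed

lemma bracket_sym_L:
  assumes x: "x \<in> carrier L" and y: "y \<in> carrier L"
  shows "bracket L x y = bracket L y x"
proof (rule L_eqI[OF bracket_closed_L[OF x y] bracket_closed_L[OF y x]])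
  fix n :: nat assume n: "1 \<le> n"
  interpret C: comm_group "C n" by (rule comm_group_C[OF n])
  have img: "{1..<n} = (\<lambda>k. n - k) ` {1..<n}"
  proof
    show "{1..<n} \<subseteq> (\<lambda>k. n - k) ` {1..<n}"
    proof
      fix k assume "k \<in> {1..<n}"
      then show "k \<in> (\<lambda>k. n - k) ` {1..<n}" by (intro image_eqI[of _ _ "n - k"]) auto
    qed
  qed auto
  have "bracket L x y n = (\<Otimes>\<^bsub>C n\<^esub>k\<in>(\<lambda>k. n - k) ` {1..<n}. br k (n - k) (x k) (y (n - k)))"
    using n img by (simp add: bracket_L)
  also have "\<dots> = (\<Otimes>\<^bsub>C n\<^esub>k\<in>{1..<n}. br (n - k) (n - (n - k)) (x (n - k)) (y (n - (n - k))))"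
    by (rule C.finprod_reindex)
      (use br_closed'[OF x y] in \<open>auto simp: inj_on_def simp flip: img simp del: One_nat_def\<close>)
  also have "\<dots> = (\<Otimes>\<^bsub>C n\<^esub>k\<in>{1..<n}. br k (n - k) (y k) (x (n - k)))"
    by (rule C.finprod_cong')
      (use br_closed'[OF y x] br_sym L_comp[OF x] L_comp[OF y] in auto)
  finally show "bracket L x y n = bracket L y x n" using n by (simp add: bracket_L)
qed

lemma bracket_add_left_L:
  assumes x: "x \<in> carrier L" and y: "y \<in> carrier L" and z: "z \<in> carrier L"
  shows "bracket L (x \<oplus>\<^sub>L y) z = bracket L x z \<oplus>\<^sub>L bracket L y z"
proof (rule L_eqI)
  show "bracket L (x \<oplus>\<^sub>L y) z \<in> carrier L" "bracket L x z \<oplus>\<^sub>L bracket L y z \<in> carrier L"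
    by (intro bracket_closed_L add_closed_L x y z)+
  fix n :: nat assume n: "1 \<le> n"
  interpret C: comm_group "C n" by (rule comm_group_C[OF n])
  have "bracket L (x \<oplus>\<^sub>L y) z n = (\<Otimes>\<^bsub>C n\<^esub>k\<in>{1..<n}.
      br k (n - k) (x k) (z (n - k)) \<otimes>\<^bsub>C n\<^esub> br k (n - k) (y k) (z (n - k)))"
    using n by (simp add: bracket_L add_L)
      (rule C.finprod_cong', use br_closed'[OF x z] br_closed'[OF y z] br_mult_left
        L_comp[OF x] L_comp[OF y] L_comp[OF z] in auto)
  also have "\<dots> = bracket L x z n \<otimes>\<^bsub>C n\<^esub> bracket L y z n"
    using n br_closed'[OF x z] br_closed'[OF y z] by (simp add: bracket_L Pi_def)
  finally show "bracket L (x \<oplus>\<^sub>L y) z n = (bracket L x z \<oplus>\<^sub>L bracket L y z) n"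
    using n by (simp add: add_L)
qed

lemma bracket_add_right_L:
  assumes "x \<in> carrier L" "y \<in> carrier L" "z \<in> carrier L"
  shows "bracket L x (y \<oplus>\<^sub>L z) = bracket L x y \<oplus>\<^sub>L bracket L x z"
  using bracket_add_left_L[of y z x] bracket_sym_L assms add_closed_L by simp

lemma bracket_zero_L: "x \<in> carrier L \<Longrightarrow> bracket L \<zero>\<^sub>L x = \<zero>\<^sub>L" "x \<in> carrier L \<Longrightarrow> bracket L x \<zero>\<^sub>L = \<zero>\<^sub>L"
proof -
  show *: "bracket L \<zero>\<^sub>L x = \<zero>\<^sub>L" if x: "x \<in> carrier L"
    using bracket_add_left_L[of "\<zero>\<^sub>L" "\<zero>\<^sub>L" x] x add_self_L[OF bracket_closed_L[of "\<zero>\<^sub>L" x]]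
    by simp
  show "bracket L x \<zero>\<^sub>L = \<zero>\<^sub>L" if x: "x \<in> carrier L"
    using *[OF x] bracket_sym_L x by simp
qed

lemma bracket_self_L: "x \<in> carrier L \<Longrightarrow> bracket L x x = \<zero>\<^sub>L"
proof (induction x rule: L_induct)
  case (add x y)
  then show ?case
    using add_self_L[OF bracket_closed_L[of x y]] bracket_sym_L[of y x]
    by (simp add: bracket_add_left_L bracket_add_right_L add_closed_L bracket_closed_L)
qed (simp_all add: bracket_zero_L bracket_hom br_self hom_elem_one)

lemma jacobi_L:
  assumes "x \<in> carrier L" "y \<in> carrier L" "z \<in> carrier L"
  shows "bracket L x (bracket L y z) \<oplus>\<^sub>L bracket L y (bracket L z x)
    \<oplus>\<^sub>L bracket L z (bracket L x y) = \<zero>\<^sub>L"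
proof -
  note D = bracket_add_left_L bracket_add_right_L add_closed_L bracket_closed_L bracket_zero_L
    zero_closed_L hom_elem_closed
  \<comment> \<open>The Jacobi sum is additive in each variable; this reduces it to homogeneous
    elements one variable at a time.\<close>
  have split: "(p1 \<oplus>\<^sub>L p2) \<oplus>\<^sub>L (q1 \<oplus>\<^sub>L q2) \<oplus>\<^sub>L (r1 \<oplus>\<^sub>L r2) = \<zero>\<^sub>L"
    if "p1 \<oplus>\<^sub>L q1 \<oplus>\<^sub>L r1 = \<zero>\<^sub>L" "p2 \<oplus>\<^sub>L q2 \<oplus>\<^sub>L r2 = \<zero>\<^sub>L"
      and c: "p1 \<in> carrier L" "p2 \<in> carrier L" "q1 \<in> carrier L" "q2 \<in> carrier L"
        "r1 \<in> carrier L" "r2 \<in> carrier L" for p1 p2 q1 q2 r1 r2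
  proof -
    have "(p1 \<oplus>\<^sub>L p2) \<oplus>\<^sub>L (q1 \<oplus>\<^sub>L q2) \<oplus>\<^sub>L (r1 \<oplus>\<^sub>L r2)
        = (p1 \<oplus>\<^sub>L q1 \<oplus>\<^sub>L r1) \<oplus>\<^sub>L (p2 \<oplus>\<^sub>L q2 \<oplus>\<^sub>L r2)"
      using c by (simp add: ab.a_ac)
    then show ?thesis using that by simp
  qed
  show ?thesis
    using assms
  proof (induction x rule: L_induct)
    case (add x x')
    show ?case using split add.IH add.hyps add.prems by (simp add: D)
  next
    case X: (hom a X)
    from X(3,4) show ?case
    proof (induction y rule: L_induct)
      case (add y y')
      show ?case using split add.IH add.hyps add.prems X by (simp add: D)
    next
      case Y: (hom b Y)
      from Y(3) show ?case
      proof (induction z rule: L_induct)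
        case (add z z')
        show ?case using split add.IH add.hyps X Y by (simp add: D)
      next
        case Z: (hom c Z)
        have n: "b + (c + a) = a + (b + c)" "c + (a + b) = a + (b + c)" by simp_all
        have "br a (b + c) X (br b c Y Z) \<in> carrier (C (a + (b + c)))"
          "br b (c + a) Y (br c a Z X) \<in> carrier (C (a + (b + c)))"
          "br c (a + b) Z (br a b X Y) \<in> carrier (C (a + (b + c)))"
          using br_closed[of a "b + c" X "br b c Y Z"] br_closed[of b "c + a" Y "br c a Z X"]
            br_closed[of c "a + b" Z "br a b X Y"] X Y Z unfolding n by (simp_all add: br_closed)
        moreover from this have "br a (b + c) X (br b c Y Z) \<otimes>\<^bsub>C (a + (b + c))\<^esub> br b (c + a) Y (br c a Z X)
            \<in> carrier (C (a + (b + c)))"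
          using group_C[of "a + (b + c)"] X by (simp add: group.is_monoid monoid.m_closed)
        ultimately show ?case
          using br_jacobi[of a b c X Y Z "a + (b + c)"] X Y Z
          by (simp add: bracket_hom br_closed n hom_elem_one flip: hom_elem_mult)
      qed (use X Y in \<open>simp add: D\<close>)
    qed (use X in \<open>simp add: D\<close>)
  qed (simp add: D)
qed

text \<open>In degree \<open>n\<close> the indices of the bracket split into the diagonal
  \<open>?A\<close>, the half \<open>?B\<close> and its mirror image \<open>?B'\<close>. The
  diagonal terms come from \<open>sqh_mult\<close>; the mixed terms of the sum over
  \<open>?B\<close> yield the half directly and, by symmetry of \<open>br\<close>, the mirror
  image.\<close>

lemma sq_add_L:
  assumes x: "x \<in> carrier L" and y: "y \<in> carrier L"
  shows "sq L (x \<oplus>\<^sub>L y) = sq L x \<oplus>\<^sub>L sq L y \<oplus>\<^sub>L bracket L x y"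
proof (rule L_eqI)
  show "sq L (x \<oplus>\<^sub>L y) \<in> carrier L" "sq L x \<oplus>\<^sub>L sq L y \<oplus>\<^sub>L bracket L x y \<in> carrier L"
    by (intro sq_closed_L bracket_closed_L add_closed_L x y)+
  fix n :: nat assume n: "1 \<le> n"
  interpret C: comm_group "C n" by (rule comm_group_C[OF n])
  let ?A = "{k. 1 \<le> k \<and> 2 * k = n}" and ?B = "{k. 1 \<le> k \<and> k < n - k}"
  let ?b = "\<lambda>x y k. br k (n - k) (x k) (y (n - k))"
    and ?B' = "(\<lambda>k. n - k) ` ?B"
    and ?s = "\<lambda>k. x k \<otimes>\<^bsub>C k\<^esub> y k" and ?P = "finprod (C n)"
  have s: "(\<lambda>k. sqh k (x k)) \<in> ?A \<rightarrow> carrier (C n)" "(\<lambda>k. sqh k (y k)) \<in> ?A \<rightarrow> carrier (C n)"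
    using sqh_closed'[OF x] sqh_closed'[OF y] by auto
  have b: "?b u v \<in> S \<rightarrow> carrier (C n)" if "u \<in> {x, y}" "v \<in> {x, y}" "S \<subseteq> {1..<n}" for u v S
  proof
    fix k assume "k \<in> S"
    then show "?b u v k \<in> carrier (C n)" using that br_closed'[of u v k n] x y by auto
  qed
  have AB: "?A \<subseteq> {1..<n}" "?B \<subseteq> {1..<n}" "?B' \<subseteq> {1..<n}" by auto
  have fin: "finite ?A" "finite ?B" using AB finite_subset by blast+
  have 1: "(\<Otimes>\<^bsub>C n\<^esub>k\<in>?A. sqh k (?s k)) =
    (\<Otimes>\<^bsub>C n\<^esub>k\<in>?A. sqh k (x k)) \<otimes>\<^bsub>C n\<^esub> (\<Otimes>\<^bsub>C n\<^esub>k\<in>?A. sqh k (y k)) \<otimes>\<^bsub>C n\<^esub> ?P (?b x y) ?A"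
  proof -
    have "(\<Otimes>\<^bsub>C n\<^esub>k\<in>?A. sqh k (?s k)) =
      (\<Otimes>\<^bsub>C n\<^esub>k\<in>?A. sqh k (x k) \<otimes>\<^bsub>C n\<^esub> sqh k (y k) \<otimes>\<^bsub>C n\<^esub> ?b x y k)"
      by (rule C.finprod_cong')
        (use s b[of x y ?A] AB sqh_mult L_comp[OF x] L_comp[OF y] in \<open>auto simp: Pi_def mult_2\<close>)
    also have "\<dots> = (\<Otimes>\<^bsub>C n\<^esub>k\<in>?A. sqh k (x k)) \<otimes>\<^bsub>C n\<^esub> (\<Otimes>\<^bsub>C n\<^esub>k\<in>?A. sqh k (y k)) \<otimes>\<^bsub>C n\<^esub> ?P (?b x y) ?A"
      using s b[of x y ?A] AB by (subst C.finprod_multf, auto simp: Pi_def)+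
    finally show ?thesis .
  qed
  have 2: "(\<Otimes>\<^bsub>C n\<^esub>k\<in>?B. br k (n - k) (?s k) (?s (n - k))) =
    ?P (?b x x) ?B \<otimes>\<^bsub>C n\<^esub> ?P (?b x y) ?B \<otimes>\<^bsub>C n\<^esub>
    (?P (?b y x) ?B \<otimes>\<^bsub>C n\<^esub> ?P (?b y y) ?B)"
  proof -
    have rt: "br k l X (Y \<otimes>\<^bsub>C l\<^esub> Y') = br k l X Y \<otimes>\<^bsub>C (k + l)\<^esub> br k l X Y'"
      if "1 \<le> k" "1 \<le> l" "X \<in> carrier (C k)" "Y \<in> carrier (C l)" "Y' \<in> carrier (C l)" for k l X Y Y'
    proof -
      have "Y \<otimes>\<^bsub>C l\<^esub> Y' \<in> carrier (C l)"
        using that group_C[of l] by (simp add: group.is_monoid monoid.m_closed)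
      then show ?thesis
        using that br_sym[of k l X] br_mult_left[of l k Y Y' X] by (simp add: add.commute)
    qed
    have *: "br k (n - k) (?s k) (?s (n - k)) =
      ?b x x k \<otimes>\<^bsub>C n\<^esub> ?b x y k \<otimes>\<^bsub>C n\<^esub> (?b y x k \<otimes>\<^bsub>C n\<^esub> ?b y y k)" if k: "k \<in> ?B" for k
    proof -
      have m: "?s (n - k) \<in> carrier (C (n - k))"
        using k L_comp[OF x] L_comp[OF y] group_C[of "n - k"] by (simp add: group.is_monoid monoid.m_closed)
      moreover have "k + (n - k) = n" using k by auto
      ultimately show ?thesis
        using k L_comp[OF x, of k] L_comp[OF y, of k] L_comp[OF x, of "n - k"] L_comp[OF y, of "n - k"]
          br_mult_left[of k "n - k" "x k" "y k" "?s (n - k)"]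
        by (simp add: rt)
    qed
    have "(\<Otimes>\<^bsub>C n\<^esub>k\<in>?B. br k (n - k) (?s k) (?s (n - k))) =
      (\<Otimes>\<^bsub>C n\<^esub>k\<in>?B. ?b x x k \<otimes>\<^bsub>C n\<^esub> ?b x y k \<otimes>\<^bsub>C n\<^esub> (?b y x k \<otimes>\<^bsub>C n\<^esub> ?b y y k))"
      by (rule C.finprod_cong'[OF HOL.refl _ *])
        (use b[of x x ?B] b[of x y ?B] b[of y x ?B] b[of y y ?B] AB in \<open>auto simp: Pi_def\<close>)
    also have "\<dots> = ?P (?b x x) ?B \<otimes>\<^bsub>C n\<^esub> ?P (?b x y) ?B \<otimes>\<^bsub>C n\<^esub>
      (?P (?b y x) ?B \<otimes>\<^bsub>C n\<^esub> ?P (?b y y) ?B)"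
      using b[of x x ?B] b[of x y ?B] b[of y x ?B] b[of y y ?B] AB
      by (subst C.finprod_multf, auto simp: Pi_def)+
    finally show ?thesis .
  qed
  have 3: "?P (?b y x) ?B = ?P (?b x y) (?B')"
  proof -
    have "?P (?b x y) (?B') = (\<Otimes>\<^bsub>C n\<^esub>k\<in>?B. ?b x y (n - k))"
      by (rule C.finprod_reindex) (use b[of x y] AB in \<open>auto simp: inj_on_def\<close>)
    also have "\<dots> = ?P (?b y x) ?B"
      by (rule C.finprod_cong') (use b[of y x ?B] AB br_sym L_comp[OF x] L_comp[OF y] in auto)
    finally show ?thesis ..
  qed
  have 4: "bracket L x y n = ?P (?b x y) ?A \<otimes>\<^bsub>C n\<^esub>
    (?P (?b x y) ?B \<otimes>\<^bsub>C n\<^esub> ?P (?b x y) (?B'))"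
  proof -
    have U: "{1..<n} = ?A \<union> (?B \<union> ?B')"
    proof
      show "{1..<n} \<subseteq> ?A \<union> (?B \<union> ?B')"
      proof
        fix k assume k: "k \<in> {1..<n}"
        consider "2 * k = n" | "k < n - k" | "n - k < k" by linarith
        then show "k \<in> ?A \<union> (?B \<union> ?B')"
        proof cases
          case 3
          then have "k = n - (n - k)" "n - k \<in> ?B" using k by auto
          then show ?thesis by blast
        qed (use k in auto)
      qed
    qed (use AB in auto)
    have disj: "?A \<inter> (?B \<union> ?B') = {}" "?B \<inter> ?B' = {}" by auto
    have "bracket L x y n = ?P (?b x y) (?A \<union> (?B \<union> ?B'))"
      using n unfolding U[symmetric] by (simp add: bracket_L)
    also have "\<dots> = ?P (?b x y) ?A \<otimes>\<^bsub>C n\<^esub> ?P (?b x y) (?B \<union> ?B')"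
      by (rule C.finprod_Un_disjoint) (use fin disj(1) b[of x y] AB in auto)
    also have "?P (?b x y) (?B \<union> ?B') =
      ?P (?b x y) ?B \<otimes>\<^bsub>C n\<^esub> ?P (?b x y) (?B')"
      by (rule C.finprod_Un_disjoint) (use fin disj(2) b[of x y] AB in auto)
    finally show ?thesis .
  qed
  have cl: "?P (?b u v) S \<in> carrier (C n)"
    if "u \<in> {x, y}" "v \<in> {x, y}" "S \<in> {?A, ?B, ?B'}" for u v S
    using that AB by (intro C.finprod_closed b) auto
  have cl2: "(\<Otimes>\<^bsub>C n\<^esub>k\<in>?A. sqh k (x k)) \<in> carrier (C n)" "(\<Otimes>\<^bsub>C n\<^esub>k\<in>?A. sqh k (y k)) \<in> carrier (C n)"
    using s by (auto intro: C.finprod_closed)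
  have "sq L (x \<oplus>\<^sub>L y) n = (\<Otimes>\<^bsub>C n\<^esub>k\<in>?A. sqh k (?s k)) \<otimes>\<^bsub>C n\<^esub>
    (\<Otimes>\<^bsub>C n\<^esub>k\<in>?B. br k (n - k) (?s k) (?s (n - k)))"
  proof -
    have "(\<Otimes>\<^bsub>C n\<^esub>k\<in>?A. sqh k ((x \<oplus>\<^sub>L y) k)) = (\<Otimes>\<^bsub>C n\<^esub>k\<in>?A. sqh k (?s k))"
      by (rule C.finprod_cong') (use sqh_closed'[OF add_closed_L[OF x y]] in \<open>auto simp: add_L\<close>)
    moreover have "(\<Otimes>\<^bsub>C n\<^esub>k\<in>?B. br k (n - k) ((x \<oplus>\<^sub>L y) k) ((x \<oplus>\<^sub>L y) (n - k))) =
      (\<Otimes>\<^bsub>C n\<^esub>k\<in>?B. br k (n - k) (?s k) (?s (n - k)))"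
    proof (rule C.finprod_cong'[OF HOL.refl])
      show "(\<lambda>k. br k (n - k) (?s k) (?s (n - k))) \<in> ?B \<rightarrow> carrier (C n)"
      proof
        fix k assume k: "k \<in> ?B"
        then have "k < n" by auto
        with k show "br k (n - k) (?s k) (?s (n - k)) \<in> carrier (C n)"
          using br_closed'[OF add_closed_L[OF x y] add_closed_L[OF x y], of k n] by (simp add: add_L)
      qed
    qed (simp add: add_L)
    ultimately show ?thesis using n by (simp add: sq_L)
  qed
  also have "\<dots> = (sq L x n \<otimes>\<^bsub>C n\<^esub> sq L y n) \<otimes>\<^bsub>C n\<^esub> bracket L x y n"
    unfolding 1 2 3 4 using n cl cl2 by (simp add: sq_L C.m_ac)
  finally show "sq L (x \<oplus>\<^sub>L y) n = (sq L x \<oplus>\<^sub>L sq L y \<oplus>\<^sub>L bracket L x y) n"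
    using n by (simp add: add_L)
qed

text \<open>Neither side is additive in \<open>y\<close>. The sum formula leaves
  \<open>[x, [y, y']]\<close> on the left and mixed double brackets on the right, and the Jacobi
  identity in the form \<open>J\<close> matches them.\<close>

lemma bracket_sq_L:
  assumes "x \<in> carrier L" "y \<in> carrier L"
  shows "bracket L x (sq L y) = bracket L (bracket L x y) y"
proof -
  note D = bracket_add_left_L bracket_add_right_L add_closed_L bracket_closed_L bracket_zero_L
    zero_closed_L hom_elem_closed sq_closed_L
  have sq0: "sq L \<zero>\<^sub>L = \<zero>\<^sub>L"
    using sq_add_L[of "\<zero>\<^sub>L" "\<zero>\<^sub>L"] add_self_L[OF sq_closed_L, of "\<zero>\<^sub>L"] by (simp add: D)
  from assms(2,1) show ?thesis
  proof (induction y arbitrary: x rule: L_induct)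
    case (hom b Y)
    from hom(3) show ?case
    proof (induction x rule: L_induct)
      case (hom a X)
      then show ?case
        using \<open>1 \<le> b\<close> \<open>Y \<in> carrier (C b)\<close> br_sqh[of a b X Y] sqh_closed[of b Y]
        by (simp add: bracket_hom sq_hom br_closed add.assoc mult_2)
    qed (use hom in \<open>simp_all add: D\<close>)
  next
    case (add y y')
    have J: "bracket L x (bracket L y y') \<oplus>\<^sub>L (bracket L (bracket L x y') y \<oplus>\<^sub>L bracket L (bracket L x y) y') = \<zero>\<^sub>L"
    proof -
      have "bracket L y (bracket L y' x) = bracket L (bracket L x y') y"
        "bracket L y' (bracket L x y) = bracket L (bracket L x y) y'"
        using add bracket_sym_L[of y' x] bracket_sym_L[of y "bracket L x y'"]
          bracket_sym_L[of y' "bracket L x y"] by (simp_all add: D)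
      then show ?thesis using jacobi_L[of x y y'] add by (simp add: D ab.a_assoc)
    qed
    have eq: "p = q" if "p \<oplus>\<^sub>L q = \<zero>\<^sub>L" "p \<in> carrier L" "q \<in> carrier L" for p q
      using that add_self_L[of q] ab.add.right_cancel by metis
    have "bracket L x (bracket L y y') = bracket L (bracket L x y') y \<oplus>\<^sub>L bracket L (bracket L x y) y'"
      by (rule eq[OF J]) (use add in \<open>simp_all add: D\<close>)
    moreover have "bracket L x (sq L (y \<oplus>\<^sub>L y')) = bracket L (bracket L x y) y \<oplus>\<^sub>L
        bracket L (bracket L x y') y' \<oplus>\<^sub>L bracket L x (bracket L y y')"
      using add by (simp add: sq_add_L D)
    moreover have "bracket L (bracket L x (y \<oplus>\<^sub>L y')) (y \<oplus>\<^sub>L y') =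
        (bracket L (bracket L x y) y \<oplus>\<^sub>L bracket L (bracket L x y') y) \<oplus>\<^sub>L
        (bracket L (bracket L x y) y' \<oplus>\<^sub>L bracket L (bracket L x y') y')"
      using add by (simp add: D)
    ultimately show ?case
      using add by (simp add: D ab.a_ac)
  qed (simp add: sq0 D)
qed

theorem two_lie_algebra_L: "two_lie_algebra L"
  by (rule two_lie_algebraI[OF abelian_group_L])
    (simp_all add: add_self_L smult_L bracket_closed_L bracket_add_left_L bracket_add_right_L
      bracket_self_L jacobi_L sq_closed_L bracket_sq_L sq_add_L)

end

section \<open>The associated graded 2-Lie algebra of a group\<close>

context group
begin

text \<open>Through \<open>Gamma_filt\<close> the components of the lower 2-central series become
  those of \<open>N2\<close>, for which the graded identities have been proved.\<close>

lemma gr_comp_eq: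
  assumes "1 \<le> n"
  shows "gr_comp G n = gcomp G n"
  using assms
  by (auto simp: gr_comp_def gcomp_def cl_def[abs_def] Gamma_filt FactGroup_def RCOSETS_def
      r_coset_def set_mult_def fun_eq_iff)

lemma cl_rep:
  assumes "N2 G k x" "g \<in> cl G k x"
  shows "N2 G k g" "cl G k g = cl G k x"
proof -
  have x: "x \<in> carrier G" using assms N2_closed by blast
  obtain u where u: "N2 G (Suc k) u" "g = u \<otimes> x"
    using assms by (auto simp: cl_def r_coset_def)
  have "N2 G k u" using u(1) N2_pos[OF assms(1)] by (rule N2.weaken)
  then show "N2 G k g" unfolding u(2) using assms(1) by (rule N2.mult)
  show "cl G k g = cl G k x"
    unfolding cl_def using repr_independence[OF _ x subgroup_filt] assms(2) by (simp add: cl_def)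
qed

lemma cl_self: "x \<in> carrier G \<Longrightarrow> x \<in> cl G k x"
  unfolding cl_def by (rule rcos_self) (simp_all add: subgroup_filt)

lemma gr_bracket_hom_cl:
  assumes x: "N2 G k x" and y: "N2 G l y"
  shows "gr_bracket_hom G k l (cl G k x) (cl G l y) = cl G (k + l) (com x y)"
proof -
  have *: "cl G (k + l) (com g h) = cl G (k + l) (com x y)"
    if "g \<in> cl G k x" "h \<in> cl G l y" for g h
    using that cl_rep[OF x] cl_rep[OF y] x y by (intro cl_comm_cong) auto
  have "gr_bracket_hom G k l (cl G k x) (cl G l y) =
      (\<Union>g\<in>cl G k x. \<Union>h\<in>cl G l y. cl G (k + l) (com g h))"
    by (simp add: gr_bracket_hom_def Gamma_filt cl_def)
  also have "\<dots> = (\<Union>g\<in>cl G k x. \<Union>h\<in>cl G l y. cl G (k + l) (com x y))"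
    using * by simp
  also have "\<dots> = cl G (k + l) (com x y)"
    using cl_self[OF N2_closed[OF x], of k] cl_self[OF N2_closed[OF y], of l] by auto
  finally show ?thesis .
qed

lemma gr_sq_hom_cl:
  assumes x: "N2 G k x"
  shows "gr_sq_hom G k (cl G k x) = cl G (2 * k) (x \<otimes> x)"
proof -
  have *: "cl G (2 * k) (g \<otimes> g) = cl G (2 * k) (x \<otimes> x)" if "g \<in> cl G k x" for g
    using that cl_rep[OF x] x by (intro cl_square_cong) auto
  have "gr_sq_hom G k (cl G k x) = (\<Union>g\<in>cl G k x. cl G (2 * k) (g \<otimes> g))"
    by (simp add: gr_sq_hom_def Gamma_filt cl_def)
  also have "\<dots> = (\<Union>g\<in>cl G k x. cl G (2 * k) (x \<otimes> x))"
    using * by simp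
  also have "\<dots> = cl G (2 * k) (x \<otimes> x)"
    using cl_self[OF N2_closed[OF x], of k] by auto
  finally show ?thesis .
qed

lemma gr_two_lie_eq: "gr_two_lie G = graded_sum (gr_comp G) (gr_bracket_hom G) (gr_sq_hom G)"
  by (simp add: gr_two_lie_def graded_sum_def)

lemma gr_comp_carrier: "1 \<le> k \<Longrightarrow> carrier (gr_comp G k) = cl G k ` filt G k"
  by (simp add: gr_comp_eq gcomp_def)

lemma gr_jacobi:
  assumes x: "N2 G a x" and y: "N2 G b y" and z: "N2 G c z"
    and n: "n = a + b + c"
  shows "cl G n (com x (com y z)) \<otimes>\<^bsub>gcomp G n\<^esub> cl G n (com y (com z x))
    \<otimes>\<^bsub>gcomp G n\<^esub> cl G n (com z (com x y)) = \<one>\<^bsub>gcomp G n\<^esub>"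
proof -
  have p: "1 \<le> n" using N2_pos[OF x] n by simp
  interpret C: comm_group "gcomp G n" by (rule comm_group_gcomp[OF p])
  have s: "cl G n (com u (com v w)) = cl G n (com (com v w) u)"
    and t: "N2 G n (com (com v w) u)"
    if "N2 G i u" "N2 G j v" "N2 G k w" "n = i + (j + k)" for u v w i j k
    using cl_comm_sym[OF that(1) N2.comm[OF that(2,3)]]
      N2.comm[OF N2.comm[OF that(2,3)] that(1)] that(4) by (simp_all add: ac_simps)
  have e: "n = a + (b + c)" "n = b + (c + a)" "n = c + (a + b)" using n by simp_all
  show ?thesis
    unfolding s[OF x y z e(1)] s[OF y z x e(2)] s[OF z x y e(3)]
    using cl_jacobi[OF x y z n] t[OF x y z e(1)] t[OF y z x e(2)] t[OF z x y e(3)]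
    by (simp add: C.m_ac cl_in_gcomp)
qed

lemma graded_two_lie_gr: "graded_two_lie (gr_comp G) (gr_bracket_hom G) (gr_sq_hom G)"
proof (rule graded_two_lie.intro)
  fix n :: nat assume n: "1 \<le> n"
  show "comm_group (gr_comp G n)" unfolding gr_comp_eq[OF n] by (rule comm_group_gcomp[OF n])
  fix X assume "X \<in> carrier (gr_comp G n)"
  then show "X \<otimes>\<^bsub>gr_comp G n\<^esub> X = \<one>\<^bsub>gr_comp G n\<^esub>"
    unfolding gr_comp_eq[OF n] using cl_square by (metis gcomp_cases)
next
  fix k l X Y assume kl: "1 \<le> k" "1 \<le> (l::nat)" and "X \<in> carrier (gr_comp G k)" "Y \<in> carrier (gr_comp G l)"
  then obtain x y where x: "N2 G k x" "X = cl G k x" and y: "N2 G l y" "Y = cl G l y"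
    by (auto simp: gr_comp_carrier)
  show "gr_bracket_hom G k l X Y \<in> carrier (gr_comp G (k + l))"
    using kl x y N2.comm[OF x(1) y(1)] by (simp add: gr_comp_carrier gr_bracket_hom_cl)
  show "gr_bracket_hom G k l X Y = gr_bracket_hom G l k Y X"
    using x y cl_comm_sym[OF x(1) y(1)] by (simp add: gr_bracket_hom_cl add.commute)
  show "gr_bracket_hom G k (2 * l) X (gr_sq_hom G l Y) = gr_bracket_hom G (k + l) l (gr_bracket_hom G k l X Y) Y"
    using x y cl_comm_square[OF x(1) y(1)] N2.comm[OF x(1) y(1)] N2.square[OF y(1)]
    by (simp add: gr_bracket_hom_cl gr_sq_hom_cl mult_2 add.assoc)
  fix X' assume "X' \<in> carrier (gr_comp G k)"
  then obtain x' where x': "N2 G k x'" "X' = cl G k x'" using kl by (auto simp: gr_comp_carrier)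
  show "gr_bracket_hom G k l (X \<otimes>\<^bsub>gr_comp G k\<^esub> X') Y =
    gr_bracket_hom G k l X Y \<otimes>\<^bsub>gr_comp G (k + l)\<^esub> gr_bracket_hom G k l X' Y"
    using kl x y x' cl_comm_mult_left[OF x(1) x'(1) y(1)] N2.mult[OF x(1) x'(1)]
    by (simp add: gr_comp_eq gr_bracket_hom_cl N2_closed flip: cl_mult[of x x'])
next
  fix k X assume k: "1 \<le> (k::nat)" and "X \<in> carrier (gr_comp G k)"
  then obtain x where x: "N2 G k x" "X = cl G k x" by (auto simp: gr_comp_carrier)
  show "gr_bracket_hom G k k X X = \<one>\<^bsub>gr_comp G (k + k)\<^esub>"
    using k x grp_comm_self[OF N2_closed[OF x(1)]]
    by (simp add: gr_bracket_hom_cl gr_comp_eq cl_of_one)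
  show "gr_sq_hom G k X \<in> carrier (gr_comp G (2 * k))"
    using k x N2.square[OF x(1)] by (simp add: gr_comp_carrier gr_sq_hom_cl)
  fix Y assume "Y \<in> carrier (gr_comp G k)"
  then obtain y where y: "N2 G k y" "Y = cl G k y" using k by (auto simp: gr_comp_carrier)
  show "gr_sq_hom G k (X \<otimes>\<^bsub>gr_comp G k\<^esub> Y) =
    gr_sq_hom G k X \<otimes>\<^bsub>gr_comp G (2 * k)\<^esub> gr_sq_hom G k Y \<otimes>\<^bsub>gr_comp G (2 * k)\<^esub> gr_bracket_hom G k k X Y"
    using k x y cl_square_mult[OF x(1) y(1)] N2.mult[OF x(1) y(1)]
    by (simp add: gr_comp_eq gr_sq_hom_cl gr_bracket_hom_cl N2_closed mult_2 flip: cl_mult[of x y])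
next
  fix a b c n X Y Z assume p: "1 \<le> (a::nat)" "1 \<le> (b::nat)" "1 \<le> (c::nat)" and n: "n = a + b + c"
    and "X \<in> carrier (gr_comp G a)" "Y \<in> carrier (gr_comp G b)" "Z \<in> carrier (gr_comp G c)"
  then obtain x y z where x: "N2 G a x" "X = cl G a x" and y: "N2 G b y" "Y = cl G b y"
    and z: "N2 G c z" "Z = cl G c z"
    by (auto simp: gr_comp_carrier)
  have e: "a + (b + c) = n" "b + (c + a) = n" "c + (a + b) = n" using n by auto
  show "gr_bracket_hom G a (b + c) X (gr_bracket_hom G b c Y Z) \<otimes>\<^bsub>gr_comp G n\<^esub>
    gr_bracket_hom G b (c + a) Y (gr_bracket_hom G c a Z X) \<otimes>\<^bsub>gr_comp G n\<^esub>
    gr_bracket_hom G c (a + b) Z (gr_bracket_hom G a b X Y) = \<one>\<^bsub>gr_comp G n\<^esub>"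
    using gr_jacobi[OF x(1) y(1) z(1) n] x y z p n N2.comm[OF x(1) y(1)]
      N2.comm[OF y(1) z(1)] N2.comm[OF z(1) x(1)]
    by (simp add: gr_bracket_hom_cl gr_comp_eq e)
qed

end

section \<open>Leading coefficients of a unipotent representation\<close>

unbundle fps_syntax

definition vanishes :: "nat \<Rightarrow> 'a::zero fps \<Rightarrow> bool" where
  "vanishes k f \<longleftrightarrow> (\<forall>i<k. f $ i = 0)"

lemma vanishes_mult:
  fixes f g :: "'a::semiring_1 fps"
  assumes "vanishes a f" "vanishes b g"
  shows "vanishes (a + b) (f * g)" "(f * g) $ (a + b) = f $ a * g $ b"
proof -
  show "vanishes (a + b) (f * g)"
    unfolding vanishes_def
  proof (intro allI impI)
    fix n assume "n < a + b"
    then have "i < a \<or> n - i < b" if "i \<in> {0..n}" for i using that by auto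
    then have "f $ i * g $ (n - i) = 0" if "i \<in> {0..n}" for i
      using that assms by (force simp: vanishes_def)
    then show "(f * g) $ n = 0" by (simp add: fps_mult_nth)
  qed
  have "f $ i * g $ (a + b - i) = (if i = a then f $ a * g $ b else 0)" if "i \<in> {0..a + b}" for i
    using that assms by (cases "i < a") (auto simp: vanishes_def)
  then have "(f * g) $ (a + b) = (\<Sum>i=0..a + b. if i = a then f $ a * g $ b else 0)"
    unfolding fps_mult_nth by (rule sum.cong[OF HOL.refl])
  then show "(f * g) $ (a + b) = f $ a * g $ b" by simp
qed

lemma vanishes_0 [simp]: "vanishes 0 f"
  by (simp add: vanishes_def)

lemma vanishes_add: "vanishes k f \<Longrightarrow> vanishes k g \<Longrightarrow> vanishes k (f + g :: 'a::monoid_add fps)"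
  by (simp add: vanishes_def)

lemma vanishes_antimono: "vanishes k f \<Longrightarrow> l \<le> k \<Longrightarrow> vanishes l f"
  by (simp add: vanishes_def)

text \<open>The filtration of \<open>\<Phi> x + 1\<close> by powers of the formal variable replaces a grading of the
  coefficient ring.\<close>

locale unipotent_rep = group G for G :: "('a, 'b) monoid_scheme" (structure) +
  fixes \<Phi> :: "'a \<Rightarrow> 'r::char_two_ring fps"
  assumes Phi_mult: "x \<in> carrier G \<Longrightarrow> y \<in> carrier G \<Longrightarrow> \<Phi> (x \<otimes> y) = \<Phi> x * \<Phi> y"
    and Phi_one: "\<Phi> \<one> = 1"
    and Phi_nth_0: "x \<in> carrier G \<Longrightarrow> \<Phi> x $ 0 = 1"
begin

text \<open>In characteristic 2, \<open>\<Phi> x + 1\<close> is \<open>\<Phi> x - 1\<close>, an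
  element of the augmentation ideal.\<close>

lemma Phi_mult_plus_one:
  assumes "x \<in> carrier G" "y \<in> carrier G"
  shows "\<Phi> (x \<otimes> y) + 1 = (\<Phi> x + 1) + (\<Phi> y + 1) + (\<Phi> x + 1) * (\<Phi> y + 1)"
  using assms by (simp add: Phi_mult distrib_left distrib_right ac_simps)

text \<open>Magnus's identity: an additive commutator does not change when 1 is subtracted from both
  factors, and \<open>\<Phi> (com x y) - 1\<close> is a unit times the additive commutator.\<close>

lemma Phi_comm_plus_one:
  assumes x: "x \<in> carrier G" and y: "y \<in> carrier G"
  shows "\<Phi> (com x y) + 1 =
    \<Phi> (inv x \<otimes> inv y) * ((\<Phi> x + 1) * (\<Phi> y + 1) + (\<Phi> y + 1) * (\<Phi> x + 1))"
proof -
  have 1: "\<Phi> (inv x \<otimes> inv y) * (\<Phi> y * \<Phi> x) = 1"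
    using x y by (simp add: Phi_one m_assoc flip: Phi_mult)
  have 2: "\<Phi> (com x y) = \<Phi> (inv x \<otimes> inv y) * (\<Phi> x * \<Phi> y)"
    using x y by (simp add: grp_comm_def m_assoc flip: Phi_mult)
  have "(\<Phi> x + 1) * (\<Phi> y + 1) + (\<Phi> y + 1) * (\<Phi> x + 1) = \<Phi> x * \<Phi> y + \<Phi> y * \<Phi> x"
    by (simp add: distrib_left distrib_right ac_simps)
  then show ?thesis by (simp add: distrib_left 1 2)
qed

lemma Phi_inv_plus_one: "x \<in> carrier G \<Longrightarrow> \<Phi> (inv x) + 1 = \<Phi> (inv x) * (\<Phi> x + 1)"
  using Phi_mult[of "inv x" x] by (simp add: Phi_one distrib_left ac_simps)

text \<open>The preimages of the congruence subgroups \<open>1 + t^k A[[t]]\<close> satisfy all the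
  rules of \<open>N2\<close>, hence contain the fastest series.\<close>

lemma Phi_vanishes: "N2 G k x \<Longrightarrow> vanishes k (\<Phi> x + 1)"
proof (induction rule: N2.induct)
  case (carrier x)
  then show ?case by (simp add: vanishes_def Phi_nth_0)
next
  case (weaken k x)
  then show ?case by (auto intro: vanishes_antimono)
next
  case (one k)
  then show ?case by (simp add: vanishes_def Phi_one)
next
  case (mult k x y)
  have "vanishes k ((\<Phi> x + 1) * (\<Phi> y + 1))"
    using vanishes_mult(1)[OF mult.IH] by (rule vanishes_antimono) simp
  with mult show ?case
    using N2_closed by (simp only: Phi_mult_plus_one vanishes_add)
next
  case (inv k x)
  then show ?case
    using vanishes_mult(1)[of 0 "\<Phi> (inv x)" k "\<Phi> x + 1"] N2_closed
    by (simp only: Phi_inv_plus_one vanishes_0 add_0)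
next
  case (comm a x b y)
  have "vanishes (a + b) ((\<Phi> x + 1) * (\<Phi> y + 1))" "vanishes (a + b) ((\<Phi> y + 1) * (\<Phi> x + 1))"
    using vanishes_mult(1)[OF comm.IH] vanishes_mult(1)[OF comm.IH(2,1)] by (simp_all add: add.commute)
  then have "vanishes (a + b) ((\<Phi> x + 1) * (\<Phi> y + 1) + (\<Phi> y + 1) * (\<Phi> x + 1))"
    by (rule vanishes_add)
  from vanishes_mult(1)[OF vanishes_0 this] show ?case
    using comm.hyps N2_closed by (simp only: Phi_comm_plus_one add_0)
next
  case (square a x)
  have "\<Phi> (x \<otimes> x) + 1 = (\<Phi> x + 1) * (\<Phi> x + 1)"
    using square.hyps N2_closed by (simp add: Phi_mult distrib_left distrib_right ac_simps)
  then show ?case using vanishes_mult(1)[OF square.IH square.IH] by (simp add: mult_2)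
qed

lemma Phi_nth_mult:
  assumes "N2 G k x" "N2 G k y"
  shows "\<Phi> (x \<otimes> y) $ k = \<Phi> x $ k + \<Phi> y $ k"
proof -
  have k: "1 \<le> k" using assms N2_pos by blast
  have "vanishes (k + k) ((\<Phi> x + 1) * (\<Phi> y + 1))"
    using assms by (intro vanishes_mult Phi_vanishes)
  then have "((\<Phi> x + 1) * (\<Phi> y + 1)) $ k = 0" using k by (simp add: vanishes_def)
  then have "(\<Phi> (x \<otimes> y) + 1) $ k = (\<Phi> x + 1) $ k + (\<Phi> y + 1) $ k"
    using assms N2_closed by (simp add: Phi_mult_plus_one del: fps_mult_nth)
  then show ?thesis using k by simp
qed

lemma Phi_nth_comm:
  assumes "N2 G a x" "N2 G b y"
  shows "\<Phi> (com x y) $ (a + b) = \<Phi> x $ a * \<Phi> y $ b + \<Phi> y $ b * \<Phi> x $ a"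
proof -
  have p: "1 \<le> a" "1 \<le> b" using assms N2_pos by auto
  note v = Phi_vanishes[OF assms(1)] Phi_vanishes[OF assms(2)]
  let ?h = "(\<Phi> x + 1) * (\<Phi> y + 1) + (\<Phi> y + 1) * (\<Phi> x + 1)"
  have "vanishes (a + b) ((\<Phi> x + 1) * (\<Phi> y + 1))" "vanishes (a + b) ((\<Phi> y + 1) * (\<Phi> x + 1))"
    using vanishes_mult(1)[OF v] vanishes_mult(1)[OF v(2,1)] by (simp_all add: add.commute)
  then have h: "vanishes (a + b) ?h" by (rule vanishes_add)
  have "?h $ (a + b) = (\<Phi> x + 1) $ a * (\<Phi> y + 1) $ b + (\<Phi> y + 1) $ b * (\<Phi> x + 1) $ a"
    using vanishes_mult(2)[OF v] vanishes_mult(2)[OF v(2,1)] by (simp only: fps_add_nth add.commute)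
  then have "?h $ (a + b) = \<Phi> x $ a * \<Phi> y $ b + \<Phi> y $ b * \<Phi> x $ a" using p by simp
  \<comment> \<open>The index is split as \<open>0 + (a + b)\<close>: the unit in front contributes
    only its constant term, which is 1.\<close>
  moreover have "(\<Phi> (com x y) + 1) $ (0 + (a + b)) = \<Phi> (inv x \<otimes> inv y) $ 0 * ?h $ (a + b)"
    using vanishes_mult(2)[OF vanishes_0[of "\<Phi> (inv x \<otimes> inv y)"] h] assms N2_closed
    by (simp only: Phi_comm_plus_one)
  ultimately show ?thesis
    using p assms N2_closed by (simp add: Phi_nth_0)
qed

lemma Phi_nth_square:
  assumes "N2 G a x"
  shows "\<Phi> (x \<otimes> x) $ (2 * a) = \<Phi> x $ a * \<Phi> x $ a"
proof -
  have p: "1 \<le> a" using assms N2_pos by auto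
  have "\<Phi> (x \<otimes> x) + 1 = (\<Phi> x + 1) * (\<Phi> x + 1)"
    using assms N2_closed by (simp add: Phi_mult distrib_left distrib_right ac_simps)
  then have "(\<Phi> (x \<otimes> x) + 1) $ (a + a) = (\<Phi> x + 1) $ a * (\<Phi> x + 1) $ a"
    using vanishes_mult(2)[OF Phi_vanishes[OF assms] Phi_vanishes[OF assms]] by simp
  then show ?thesis using p by (simp add: mult_2)
qed

text \<open>On a class of degree \<open>k\<close> the choice of representative is immaterial, since
  elements of degree \<open>k + 1\<close> have zero coefficient at \<open>k\<close>; see
  \<open>lead_cl\<close>.\<close>

definition lead :: "nat \<Rightarrow> 'a set \<Rightarrow> 'r" where
  "lead k X = \<Phi> (SOME g. g \<in> X) $ k"

lemma lead_cl:
  assumes "N2 G k x"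
  shows "lead k (cl G k x) = \<Phi> x $ k"
proof -
  have x: "x \<in> carrier G" using assms N2_closed by blast
  let ?g = "SOME g. g \<in> cl G k x"
  have "?g \<in> cl G k x" by (rule someI) (rule cl_self[OF x])
  then obtain u where u: "N2 G (Suc k) u" "?g = u \<otimes> x"
    by (auto simp: cl_def r_coset_def)
  have k: "1 \<le> k" using assms N2_pos by blast
  have uk: "N2 G k u" using u(1) k by (rule N2.weaken)
  have "(\<Phi> u + 1) $ k = 0" using Phi_vanishes[OF u(1)] by (simp add: vanishes_def)
  then have "\<Phi> u $ k = 0" using k by simp
  then show ?thesis using Phi_nth_mult[OF uk assms] u(2) by (simp add: lead_def)
qed

end

section \<open>Summing leading coefficients over all degrees\<close>

context graded_two_lie
begin

context
  fixes co :: "nat \<Rightarrow> 'c \<Rightarrow> 'r::char_two_ring"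
  assumes co_mult: "\<And>k X Y. \<lbrakk>1 \<le> k; X \<in> carrier (C k); Y \<in> carrier (C k)\<rbrakk> \<Longrightarrow>
      co k (X \<otimes>\<^bsub>C k\<^esub> Y) = co k X + co k Y"
    and co_br: "\<And>k l X Y. \<lbrakk>1 \<le> k; 1 \<le> l; X \<in> carrier (C k); Y \<in> carrier (C l)\<rbrakk> \<Longrightarrow>
      co (k + l) (br k l X Y) = co k X * co l Y + co l Y * co k X"
    and co_sqh: "\<And>k X. 1 \<le> k \<Longrightarrow> X \<in> carrier (C k) \<Longrightarrow> co (2 * k) (sqh k X) = co k X * co k X"
begin

text \<open>All degrees are added inside one associative ring. Forgetting the grading is harmless,
  because brackets and squares of sums expand in the ring by the same formulas as in the graded
  algebra.\<close>

definition total :: "(nat \<Rightarrow> 'c) \<Rightarrow> 'r" where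
  "total x = (\<Sum>k\<in>{k. 1 \<le> k \<and> x k \<noteq> \<one>\<^bsub>C k\<^esub>}. co k (x k))"

lemma co_one: "1 \<le> k \<Longrightarrow> co k \<one>\<^bsub>C k\<^esub> = 0"
  using co_mult[of k "\<one>\<^bsub>C k\<^esub>" "\<one>\<^bsub>C k\<^esub>"] by simp

lemma total_superset:
  assumes "finite U" "{k. 1 \<le> k \<and> x k \<noteq> \<one>\<^bsub>C k\<^esub>} \<subseteq> U" "U \<subseteq> {1..}"
  shows "total x = (\<Sum>k\<in>U. co k (x k))"
  unfolding total_def by (rule sum.mono_neutral_left) (use assms co_one in auto)

lemma total_add:
  assumes x: "x \<in> carrier L" and y: "y \<in> carrier L"
  shows "total (x \<oplus>\<^sub>L y) = total x + total y"
proof -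
  let ?U = "{k. 1 \<le> k \<and> x k \<noteq> \<one>\<^bsub>C k\<^esub>} \<union> {k. 1 \<le> k \<and> y k \<noteq> \<one>\<^bsub>C k\<^esub>}"
  have U: "finite ?U" "?U \<subseteq> {1..}" using x y by (auto simp: carrier_L)
  have "total (x \<oplus>\<^sub>L y) = (\<Sum>k\<in>?U. co k ((x \<oplus>\<^sub>L y) k))"
    by (rule total_superset[OF U(1) _ U(2)]) (auto simp: add_L)
  also have "\<dots> = (\<Sum>k\<in>?U. co k (x k) + co k (y k))"
    by (rule sum.cong) (use co_mult L_comp[OF x] L_comp[OF y] in \<open>auto simp: add_L\<close>)
  also have "\<dots> = total x + total y"
    using total_superset[OF U(1) _ U(2), of x] total_superset[OF U(1) _ U(2), of y]
    by (simp add: sum.distrib)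
  finally show ?thesis .
qed

lemma total_zero: "total \<zero>\<^sub>L = 0"
  using total_add[OF zero_closed_L zero_closed_L] add_self_L[OF zero_closed_L] by simp

lemma total_hom: "1 \<le> k \<Longrightarrow> X \<in> carrier (C k) \<Longrightarrow> total (hom_elem C k X) = co k X"
  by (subst total_superset[of "{k}"]) (auto simp: hom_elem_def split: if_splits)

lemma total_bracket:
  assumes "x \<in> carrier L" "y \<in> carrier L"
  shows "total (bracket L x y) = total x * total y + total y * total x"
  using assms
proof (induction x rule: L_induct)
  case zero
  then show ?case by (simp add: bracket_zero_L total_zero)
next
  case (add x x')
  then show ?case
    by (simp add: bracket_add_left_L total_add bracket_closed_L distrib_left distrib_right ac_simps)
next
  case X: (hom a X)
  from X(3) show ?case
  proof (induction y rule: L_induct)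
    case zero
    then show ?case using X by (simp add: bracket_zero_L total_zero hom_elem_closed)
  next
    case (add y y')
    then show ?case using X
      by (simp add: bracket_add_right_L total_add bracket_closed_L hom_elem_closed
          distrib_left distrib_right ac_simps)
  next
    case (hom b Y)
    then show ?case using X by (simp add: bracket_hom total_hom br_closed co_br)
  qed
qed

lemma total_sq: "x \<in> carrier L \<Longrightarrow> total (sq L x) = total x * total x"
proof (induction x rule: L_induct)
  case zero
  have "sq L \<zero>\<^sub>L = \<zero>\<^sub>L" by (rule two_lie_algebra.sq_zero[OF two_lie_algebra_L])
  then show ?case by (simp add: total_zero)
next
  case (hom k X)
  then show ?case by (simp add: sq_hom total_hom sqh_closed co_sqh)
next
  case (add x y)
  then show ?case
    by (simp add: sq_add_L total_add sq_closed_L add_closed_L bracket_closed_L total_bracket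
        distrib_left distrib_right ac_simps)
qed

end

end

context unipotent_rep
begin

lemma ex_total:
  "\<exists>c. (\<forall>x\<in>carrier (gr_two_lie G). \<forall>y\<in>carrier (gr_two_lie G). c (x \<oplus>\<^bsub>gr_two_lie G\<^esub> y) = c x + c y) \<and>
    (\<forall>x\<in>carrier (gr_two_lie G). \<forall>y\<in>carrier (gr_two_lie G).
      c (bracket (gr_two_lie G) x y) = c x * c y + c y * c x) \<and>
    (\<forall>x\<in>carrier (gr_two_lie G). c (sq (gr_two_lie G) x) = c x * c x) \<and>
    (\<forall>x\<in>carrier G. c (hom_elem (gr_comp G) 1 (cl G 1 x)) = \<Phi> x $ 1)"
proof -
  interpret gr: graded_two_lie "gr_comp G" "gr_bracket_hom G" "gr_sq_hom G"
    by (rule graded_two_lie_gr)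
  have l1: "lead k (X \<otimes>\<^bsub>gr_comp G k\<^esub> Y) = lead k X + lead k Y"
    if k: "1 \<le> k" and X: "X \<in> carrier (gr_comp G k)" and Y: "Y \<in> carrier (gr_comp G k)" for k X Y
  proof -
    obtain x y where x: "N2 G k x" "X = cl G k x" and y: "N2 G k y" "Y = cl G k y"
      using X Y by (auto simp: gr_comp_carrier[OF k])
    have "X \<otimes>\<^bsub>gr_comp G k\<^esub> Y = cl G k (x \<otimes> y)"
      unfolding gr_comp_eq[OF k] x y using x y N2_closed by (simp add: cl_mult)
    then show ?thesis
      using x y by (simp add: lead_cl N2.mult Phi_nth_mult)
  qed
  have l2: "lead (k + l) (gr_bracket_hom G k l X Y) = lead k X * lead l Y + lead l Y * lead k X"
    if k: "1 \<le> k" and l: "1 \<le> l" and X: "X \<in> carrier (gr_comp G k)" and Y: "Y \<in> carrier (gr_comp G l)" for k l X Y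
  proof -
    obtain x y where x: "N2 G k x" "X = cl G k x" and y: "N2 G l y" "Y = cl G l y"
      using X Y by (auto simp: gr_comp_carrier[OF k] gr_comp_carrier[OF l])
    then show ?thesis
      by (simp add: lead_cl N2.comm gr_bracket_hom_cl Phi_nth_comm)
  qed
  have l3: "lead (2 * k) (gr_sq_hom G k X) = lead k X * lead k X"
    if k: "1 \<le> k" and X: "X \<in> carrier (gr_comp G k)" for k X
  proof -
    obtain x where x: "N2 G k x" "X = cl G k x"
      using X by (auto simp: gr_comp_carrier[OF k])
    then show ?thesis
      by (simp add: lead_cl N2.square gr_sq_hom_cl Phi_nth_square)
  qed
  have h: "gr.total lead (hom_elem (gr_comp G) 1 (cl G 1 x)) = \<Phi> x $ 1" if "x \<in> carrier G" for x
    using that gr.total_hom[OF l1 l2 l3, of 1 "cl G 1 x"] N2.carrier[OF that]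
    by (simp add: gr_comp_carrier lead_cl del: One_nat_def)
  show ?thesis
    unfolding gr_two_lie_eq
    by (rule exI[of _ "gr.total lead"])
      (use gr.total_add[OF l1 l2 l3] gr.total_bracket[OF l1 l2 l3] gr.total_sq[OF l1 l2 l3] h in blast)
qed

end

section \<open>Right-angled Coxeter groups\<close>

lemma (in group) normal_normal_closure:
  assumes "R \<subseteq> carrier G"
  shows "normal_closure G R \<lhd> G"
  unfolding normal_closure_def
proof (rule normal_invI)
  have G: "carrier G \<in> {N. N \<lhd> G \<and> R \<subseteq> N}" using assms normal_self by blast
  show "subgroup (\<Inter>{N. N \<lhd> G \<and> R \<subseteq> N}) G"
    by (rule subgroups_Inter) (use G normal.axioms(1) in blast)+
  show "x \<otimes> h \<otimes> inv x \<in> \<Inter>{N. N \<lhd> G \<and> R \<subseteq> N}"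
    if "x \<in> carrier G" "h \<in> \<Inter>{N. N \<lhd> G \<and> R \<subseteq> N}" for x h
    using that by (auto intro: normal.inv_op_closed2)
qed

lemma normal_closure_superset: "R \<subseteq> normal_closure G R"
  unfolding normal_closure_def by blast

lemma normal_closure_least: "N \<lhd> G \<Longrightarrow> R \<subseteq> N \<Longrightarrow> normal_closure G R \<subseteq> N"
  unfolding normal_closure_def by blast

lemma free_gen_closed: "v \<in> V \<Longrightarrow> free_gen V v \<in> carrier (free_group V)"
  by (auto simp: free_gen_def free_group_def words_def intro!: quotientI)

text \<open>The universal property gives a map onto generators inside the generated subgroup;
  followed by the inclusion it must be the identity, by uniqueness.\<close>

lemma free_group_generate: "generate (free_group V) (free_gen V ` V) = carrier (free_group V)"
proof -
  let ?F = "free_group V"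
  interpret F: group ?F by (rule group_free_group)
  let ?H = "generate ?F (free_gen V ` V)"
  have gen: "free_gen V ` V \<subseteq> carrier ?F" using free_gen_closed by (rule image_subsetI)
  have H: "subgroup ?H ?F" by (rule F.generate_is_subgroup[OF gen])
  then have sub: "?H \<subseteq> carrier ?F" by (rule subgroup.subset)
  let ?FH = "?F\<lparr>carrier := ?H\<rparr>"
  have "group ?FH" by (rule subgroup.subgroup_is_group[OF H F.is_group])
  moreover have "free_gen V \<in> V \<rightarrow> carrier ?FH" by (auto intro: generate.incl)
  ultimately obtain h where h: "h \<in> extensional (carrier ?F)" "h \<in> hom ?F ?FH"
      "\<forall>v\<in>V. h (free_gen V v) = free_gen V v"
    using free_group_universal[of ?FH "free_gen V" V] by blast
  have h': "h \<in> hom ?F ?F" using h(2) sub by (auto simp: hom_def)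
  have id: "restrict id (carrier ?F) \<in> extensional (carrier ?F) \<and> restrict id (carrier ?F) \<in> hom ?F ?F \<and>
      (\<forall>v\<in>V. restrict id (carrier ?F) (free_gen V v) = free_gen V v)"
    by (auto simp: hom_def free_gen_closed)
  have "free_gen V \<in> V \<rightarrow> carrier ?F" using free_gen_closed by (rule Pi_I)
  from free_group_universal[OF F.is_group this] have "h = restrict id (carrier ?F)"
    by (rule ex1E) (use h h' id in metis)
  moreover have "h x \<in> ?H" if "x \<in> carrier ?F" for x using h(2) that by (auto simp: hom_def)
  ultimately have "carrier ?F \<subseteq> ?H" by auto
  with sub show ?thesis by blast
qed

definition racg_gen :: "nat \<Rightarrow> nat set set \<Rightarrow> nat \<Rightarrow> (nat \<times> bool) list set set" where
  "racg_gen m K i =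
     normal_closure (free_group {1..m}) (racg_relators m K) #>\<^bsub>free_group {1..m}\<^esub> free_gen {1..m} i"

context
  fixes m :: nat and K :: "nat set set"
  assumes K: "simplicial_complex m K"
  notes One_nat_def [simp del]
begin

abbreviation "FG \<equiv> free_group {1..m}"
abbreviation "NC \<equiv> normal_closure FG (racg_relators m K)"

interpretation FG: group FG by (rule group_free_group)

lemma edge: "{i, j} \<in> K \<Longrightarrow> i \<in> {1..m} \<and> j \<in> {1..m}"
  using K by (auto simp: simplicial_complex_def)

lemma racg_relators_cases:
  assumes "x \<in> racg_relators m K"
  obtains i where "i \<in> {1..m}" "x = free_gen {1..m} i \<otimes>\<^bsub>FG\<^esub> free_gen {1..m} i"
    | i j where "{i, j} \<in> K" "x = (free_gen {1..m} i \<otimes>\<^bsub>FG\<^esub> free_gen {1..m} j) \<otimes>\<^bsub>FG\<^esub>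
        inv\<^bsub>FG\<^esub> (free_gen {1..m} j \<otimes>\<^bsub>FG\<^esub> free_gen {1..m} i)"
  using assms unfolding racg_relators_def Let_def by blast

lemma racg_relators_closed: "racg_relators m K \<subseteq> carrier FG"
proof
  have a: "free_gen {1..m} i \<in> carrier FG" if "i \<in> {1..m}" for i using that by (rule free_gen_closed)
  fix x assume "x \<in> racg_relators m K"
  then show "x \<in> carrier FG"
    by (cases rule: racg_relators_cases)
      (use a edge in \<open>simp_all add: FG.m_closed FG.inv_closed\<close>)
qed

lemma normal_NC: "NC \<lhd> FG"
  by (rule FG.normal_normal_closure[OF racg_relators_closed])

lemma racg_eq: "racg m K = FG Mod NC"
  by (simp add: racg_def)

lemma group_racg: "group (racg m K)"
  unfolding racg_eq by (rule normal.factorgroup_is_group[OF normal_NC])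

lemma racg_proj: "(\<lambda>x. NC #>\<^bsub>FG\<^esub> x) \<in> hom FG (racg m K)"
  unfolding racg_eq by (rule normal.r_coset_hom_Mod[OF normal_NC])

interpretation proj: group_hom FG "racg m K" "\<lambda>x. NC #>\<^bsub>FG\<^esub> x"
  by (intro group_hom.intro group_hom_axioms.intro FG.is_group group_racg racg_proj)

lemma racg_gen_closed: "i \<in> {1..m} \<Longrightarrow> racg_gen m K i \<in> carrier (racg m K)"
  unfolding racg_gen_def by (rule proj.hom_closed) (rule free_gen_closed)

lemma racg_relator_one: "r \<in> racg_relators m K \<Longrightarrow> NC #>\<^bsub>FG\<^esub> r = \<one>\<^bsub>racg m K\<^esub>"
  using normal_closure_superset[of "racg_relators m K" FG] racg_relators_closed
    FG.coset_join2[of r NC] normal.axioms(1)[OF normal_NC]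
  by (auto simp: racg_eq FactGroup_def)

lemma racg_gen_square: "i \<in> {1..m} \<Longrightarrow> racg_gen m K i \<otimes>\<^bsub>racg m K\<^esub> racg_gen m K i = \<one>\<^bsub>racg m K\<^esub>"
  unfolding racg_gen_def
  by (subst proj.hom_mult[symmetric]; (rule free_gen_closed racg_relator_one)?)
    (auto simp: racg_relators_def Let_def)

lemma racg_gen_commute:
  assumes "{i, j} \<in> K"
  shows "racg_gen m K i \<otimes>\<^bsub>racg m K\<^esub> racg_gen m K j = racg_gen m K j \<otimes>\<^bsub>racg m K\<^esub> racg_gen m K i"
proof -
  have c: "free_gen {1..m} i \<in> carrier FG" "free_gen {1..m} j \<in> carrier FG"
    using edge[OF assms] by (auto intro: free_gen_closed)
  have "(free_gen {1..m} i \<otimes>\<^bsub>FG\<^esub> free_gen {1..m} j) \<otimes>\<^bsub>FG\<^esub>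
      inv\<^bsub>FG\<^esub> (free_gen {1..m} j \<otimes>\<^bsub>FG\<^esub> free_gen {1..m} i) \<in> racg_relators m K"
    using assms by (auto simp: racg_relators_def Let_def)
  from racg_relator_one[OF this]
  have "(racg_gen m K i \<otimes>\<^bsub>racg m K\<^esub> racg_gen m K j) \<otimes>\<^bsub>racg m K\<^esub>
      inv\<^bsub>racg m K\<^esub> (racg_gen m K j \<otimes>\<^bsub>racg m K\<^esub> racg_gen m K i) = \<one>\<^bsub>racg m K\<^esub>"
    using c by (simp add: racg_gen_def)
  then show ?thesis
    using racg_gen_closed edge[OF assms] proj.H.inv_equality proj.H.inv_inv proj.H.m_closed proj.H.inv_closed by metis
qed

lemma racg_generate: "generate (racg m K) (racg_gen m K ` {1..m}) = carrier (racg m K)"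
proof -
  have "generate (racg m K) ((\<lambda>x. NC #>\<^bsub>FG\<^esub> x) ` free_gen {1..m} ` {1..m}) =
      (\<lambda>x. NC #>\<^bsub>FG\<^esub> x) ` generate FG (free_gen {1..m} ` {1..m})"
    by (rule proj.generate_img) (auto intro: free_gen_closed)
  also have "\<dots> = (\<lambda>x. NC #>\<^bsub>FG\<^esub> x) ` carrier FG"
    by (simp only: free_group_generate)
  also have "\<dots> = carrier (racg m K)"
    by (auto simp: racg_eq FactGroup_def RCOSETS_def)
  finally show ?thesis by (simp add: racg_gen_def image_image)
qed

lemma racg_universal:
  assumes H: "group H" and f: "\<And>i. i \<in> {1..m} \<Longrightarrow> f i \<in> carrier H"
    and sq: "\<And>i. i \<in> {1..m} \<Longrightarrow> f i \<otimes>\<^bsub>H\<^esub> f i = \<one>\<^bsub>H\<^esub>"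
    and comm: "\<And>i j. {i, j} \<in> K \<Longrightarrow> f i \<otimes>\<^bsub>H\<^esub> f j = f j \<otimes>\<^bsub>H\<^esub> f i"
  obtains h where "h \<in> hom (racg m K) H" "\<And>i. i \<in> {1..m} \<Longrightarrow> h (racg_gen m K i) = f i"
proof -
  interpret H: group H by fact
  have "f \<in> {1..m} \<rightarrow> carrier H" using f by blast
  then obtain h0 where h0: "h0 \<in> hom FG H" "\<And>i. i \<in> {1..m} \<Longrightarrow> h0 (free_gen {1..m} i) = f i"
    using free_group_universal[OF H, of f "{1..m}"] by blast
  interpret h0: group_hom FG H h0
    by (intro group_hom.intro group_hom_axioms.intro FG.is_group H h0(1))
  have "h0 x = \<one>\<^bsub>H\<^esub>" if x: "x \<in> racg_relators m K" for x
  proof -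
    have a: "free_gen {1..m} i \<in> carrier FG" if "i \<in> {1..m}" for i using that by (rule free_gen_closed)
    from x show ?thesis
    proof (cases rule: racg_relators_cases)
      case (1 i)
      then show ?thesis using a[OF 1(1)] sq by (simp add: h0)
    next
      case (2 i j)
      have ij: "i \<in> {1..m}" "j \<in> {1..m}" using edge[OF 2(1)] by auto
      show ?thesis
        unfolding 2(2) using ij a[OF ij(1)] a[OF ij(2)] comm[OF 2(1)] f[OF ij(1)] f[OF ij(2)]
        by (simp add: h0 del: H.inv_mult_group)
    qed
  qed
  then have "racg_relators m K \<subseteq> kernel FG H h0"
    using racg_relators_closed by (auto simp: kernel_def)
  then have "NC \<subseteq> kernel FG H h0"
    by (rule normal_closure_least[OF h0.normal_kernel])
  then obtain h where h: "h \<in> hom (FG Mod NC) H" "\<And>x. x \<in> carrier FG \<Longrightarrow> h (NC #>\<^bsub>FG\<^esub> x) = h0 x"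
    using h0.FactGroup_universal_kernel[OF normal_NC] by metis
  show thesis
  proof (rule that)
    show "h \<in> hom (racg m K) H" using h(1) by (simp add: racg_eq)
    show "h (racg_gen m K i) = f i" if "i \<in> {1..m}" for i
      using h(2)[OF free_gen_closed[OF that]] h0(2)[OF that] by (simp add: racg_gen_def)
  qed
qed

text \<open>The substitution \<open>a\<^sub>i \<mapsto> 1 + r\<^sub>i t\<close> is invertible since \<open>(1 + r\<^sub>i t)\<^sup>2 = 1 + r\<^sub>i\<^sup>2 t\<^sup>2 = 1\<close>.\<close>

definition lin_fps :: "'r::char_two_ring \<Rightarrow> 'r fps" where
  "lin_fps r = Abs_fps (\<lambda>n. if n = 0 then 1 else if n = 1 then r else 0)"

lemma lin_fps_nth: "lin_fps r $ n = (if n = 0 then 1 else if n = 1 then r else 0)"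
  by (simp add: lin_fps_def)

lemma lin_fps_mult_nth: "(lin_fps r * lin_fps s) $ n =
    (if n = 0 then 1 else if n = 1 then r + s else if n = 2 then r * s else 0)"
proof -
  have "(lin_fps r * lin_fps s) $ n = (\<Sum>i=0..n. (if i = 0 then lin_fps s $ n else 0) +
      (if i = 1 then r * lin_fps s $ (n - 1) else 0))"
    unfolding fps_mult_nth by (rule sum.cong) (auto simp: lin_fps_nth)
  also have "\<dots> = lin_fps s $ n + (if 1 \<le> n then r * lin_fps s $ (n - 1) else 0)"
    by (simp add: sum.distrib sum.delta)
  finally show ?thesis by (auto simp: lin_fps_nth add.commute)
qed

lemma ex_unipotent_rep:
  fixes r :: "nat \<Rightarrow> 'r::char_two_ring"
  assumes sq: "\<And>i. i \<in> {1..m} \<Longrightarrow> r i * r i = 0"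
    and comm: "\<And>i j. {i, j} \<in> K \<Longrightarrow> r i * r j = r j * r i"
  shows "\<exists>\<Phi>. unipotent_rep (racg m K) \<Phi> \<and> (\<forall>i\<in>{1..m}. \<Phi> (racg_gen m K i) $ 1 = r i)"
proof -
  \<comment> \<open>The coefficient ring is not assumed commutative, so the target group is taken as
    the units of the bare multiplicative monoid of power series.\<close>
  define W :: "'r fps monoid" where "W = \<lparr>carrier = UNIV, monoid.mult = (*), one = 1\<rparr>"
  interpret W: monoid W by (rule monoidI) (auto simp: W_def mult.assoc)
  interpret U: group "units_of W" by (rule W.units_group)
  have one: "lin_fps (r i) * lin_fps (r i) = 1" if "i \<in> {1..m}" for i
    by (rule fps_ext) (use sq[OF that] in \<open>simp add: lin_fps_mult_nth\<close>)
  obtain h where h: "h \<in> hom (racg m K) (units_of W)"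
      "\<And>i. i \<in> {1..m} \<Longrightarrow> h (racg_gen m K i) = lin_fps (r i)"
  proof (rule racg_universal[OF U.is_group, of "\<lambda>i. lin_fps (r i)"])
    show "lin_fps (r i) \<in> carrier (units_of W)" if "i \<in> {1..m}" for i
      using one[OF that] by (auto simp: units_of_carrier Units_def W_def)
    show "lin_fps (r i) \<otimes>\<^bsub>units_of W\<^esub> lin_fps (r i) = \<one>\<^bsub>units_of W\<^esub>" if "i \<in> {1..m}" for i
      using one[OF that] by (simp add: units_of_mult units_of_one W_def)
    show "lin_fps (r i) \<otimes>\<^bsub>units_of W\<^esub> lin_fps (r j) = lin_fps (r j) \<otimes>\<^bsub>units_of W\<^esub> lin_fps (r i)"
      if "{i, j} \<in> K" for i j
      by (simp add: units_of_mult W_def)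
        (rule fps_ext, use comm[OF that] in \<open>simp add: lin_fps_mult_nth add.commute\<close>)
  qed blast
  interpret h: group_hom "racg m K" "units_of W" h
    by (intro group_hom.intro group_hom_axioms.intro group_racg U.is_group h(1))
  have mult: "h (x \<otimes>\<^bsub>racg m K\<^esub> y) = h x * h y" if "x \<in> carrier (racg m K)" "y \<in> carrier (racg m K)" for x y
    using h.hom_mult[OF that] by (simp add: units_of_mult W_def)
  have h1: "\<one>\<^bsub>units_of W\<^esub> = 1" by (simp add: units_of_one W_def)
  \<comment> \<open>A unit of the power series ring may have any invertible constant term; constant
    term 1 is inherited from the generators.\<close>
  have "subgroup {x \<in> carrier (racg m K). h x $ 0 = 1} (racg m K)"
  proof (rule proj.H.subgroupI)
    have "\<one>\<^bsub>racg m K\<^esub> \<in> {x \<in> carrier (racg m K). h x $ 0 = 1}" by (simp add: h1)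
    then show "{x \<in> carrier (racg m K). h x $ 0 = 1} \<noteq> {}" by blast
    show "inv\<^bsub>racg m K\<^esub> x \<in> {x \<in> carrier (racg m K). h x $ 0 = 1}"
      if x: "x \<in> {x \<in> carrier (racg m K). h x $ 0 = 1}" for x
    proof -
      have "h x * h (inv\<^bsub>racg m K\<^esub> x) = h (x \<otimes>\<^bsub>racg m K\<^esub> inv\<^bsub>racg m K\<^esub> x)"
        using x by (subst mult) auto
      also have "\<dots> = 1" using x h1 by simp
      finally have "(h x * h (inv\<^bsub>racg m K\<^esub> x)) $ 0 = 1" by simp
      then have "h (inv\<^bsub>racg m K\<^esub> x) $ 0 = 1" using x by (simp del: h.hom_inv)
      then show ?thesis using x by (simp del: h.hom_inv)
    qed
  qed (auto simp: mult simp del: h.hom_mult)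
  then have "generate (racg m K) (racg_gen m K ` {1..m}) \<subseteq> {x \<in> carrier (racg m K). h x $ 0 = 1}"
    by (rule proj.H.generate_le) (use racg_gen_closed h(2) in \<open>auto simp: lin_fps_nth\<close>)
  then have h0: "h x $ 0 = 1" if "x \<in> carrier (racg m K)" for x
    using that unfolding racg_generate by blast
  have "unipotent_rep (racg m K) h"
    by (intro unipotent_rep.intro unipotent_rep_axioms.intro group_racg) (simp_all add: mult h1 h0 del: h.hom_mult)
  then show ?thesis using h(2) by (intro exI[of _ h]) (simp add: lin_fps_nth)
qed

end

section \<open>Quotients of 2-Lie algebras\<close>

instance lie_term :: (countable) countable
  by countable_datatype

lemma two_lie_homD:
  assumes "f \<in> two_lie_hom L M"
  shows "x \<in> carrier L \<Longrightarrow> f x \<in> carrier M"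
    "x \<in> carrier L \<Longrightarrow> y \<in> carrier L \<Longrightarrow> f (x \<oplus>\<^bsub>L\<^esub> y) = f x \<oplus>\<^bsub>M\<^esub> f y"
    "x \<in> carrier L \<Longrightarrow> y \<in> carrier L \<Longrightarrow> f (bracket L x y) = bracket M (f x) (f y)"
    "x \<in> carrier L \<Longrightarrow> f (sq L x) = sq M (f x)"
  using assms by (auto simp: two_lie_hom_def)

lemma two_lie_hom_zero:
  assumes "two_lie_algebra L" "two_lie_algebra M" "f \<in> two_lie_hom L M"
  shows "f \<zero>\<^bsub>L\<^esub> = \<zero>\<^bsub>M\<^esub>"
proof -
  interpret L: two_lie_algebra L by fact
  interpret M: two_lie_algebra M by fact
  have "f \<zero>\<^bsub>L\<^esub> \<in> carrier M" by (rule two_lie_homD(1)[OF assms(3)]) simp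
  then show ?thesis
    using two_lie_homD(2)[OF assms(3), of "\<zero>\<^bsub>L\<^esub>" "\<zero>\<^bsub>L\<^esub>"] M.add_self by simp
qed

lemma two_lie_homI:
  assumes "two_lie_algebra L" "two_lie_algebra M"
    and "\<And>x. x \<in> carrier L \<Longrightarrow> f x \<in> carrier M"
    and "\<And>x y. x \<in> carrier L \<Longrightarrow> y \<in> carrier L \<Longrightarrow> f (x \<oplus>\<^bsub>L\<^esub> y) = f x \<oplus>\<^bsub>M\<^esub> f y"
    and "\<And>x y. x \<in> carrier L \<Longrightarrow> y \<in> carrier L \<Longrightarrow> f (bracket L x y) = bracket M (f x) (f y)"
    and "\<And>x. x \<in> carrier L \<Longrightarrow> f (sq L x) = sq M (f x)"
  shows "f \<in> two_lie_hom L M"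
proof -
  interpret L: two_lie_algebra L by fact
  interpret M: two_lie_algebra M by fact
  have "f \<zero>\<^bsub>L\<^esub> \<oplus>\<^bsub>M\<^esub> f \<zero>\<^bsub>L\<^esub> = f \<zero>\<^bsub>L\<^esub>" using assms(4)[of "\<zero>\<^bsub>L\<^esub>" "\<zero>\<^bsub>L\<^esub>"] by simp
  then have "f \<zero>\<^bsub>L\<^esub> = \<zero>\<^bsub>M\<^esub>" using M.add_self[OF assms(3)] by simp
  then show ?thesis
    using assms by (auto simp: two_lie_hom_def carrier_F2 L.smult_0 L.smult_1 M.smult_0 M.smult_1)
qed

text \<open>Two surjections from \<open>L\<close> that identify the same pairs have isomorphic
  images. The isomorphism sends \<open>f x\<close> to \<open>p x\<close>, with a chosen
  preimage.\<close>

lemma two_lie_isomorphicI: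
  assumes L: "two_lie_algebra L" and M: "two_lie_algebra M" and Q: "two_lie_algebra Q"
    and f: "f \<in> two_lie_hom L M" "f ` carrier L = carrier M"
    and p: "p \<in> two_lie_hom L Q" "p ` carrier L = carrier Q"
    and ker: "\<And>x y. x \<in> carrier L \<Longrightarrow> y \<in> carrier L \<Longrightarrow> f x = f y \<longleftrightarrow> p x = p y"
  shows "two_lie_isomorphic M Q"
proof -
  interpret L: two_lie_algebra L by fact
  define g where "g z = p (SOME x. x \<in> carrier L \<and> f x = z)" for z
  have g: "g (f x) = p x" if "x \<in> carrier L" for x
  proof -
    have "(SOME y. y \<in> carrier L \<and> f y = f x) \<in> carrier L \<and> f (SOME y. y \<in> carrier L \<and> f y = f x) = f x"
      by (rule someI[of "\<lambda>y. y \<in> carrier L \<and> f y = f x" x]) (simp add: that)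
    then show ?thesis using ker[OF _ that] unfolding g_def by blast
  qed
  have C: "P z" if "z \<in> carrier M" "\<And>x. x \<in> carrier L \<Longrightarrow> P (f x)" for P z
  proof -
    from that(1) obtain x where "x \<in> carrier L" "z = f x" unfolding f(2)[symmetric] by blast
    then show ?thesis using that(2) by simp
  qed
  have "g \<in> two_lie_hom M Q"
  proof (rule two_lie_homI[OF M Q])
    fix z w assume z: "z \<in> carrier M" and w: "w \<in> carrier M"
    show "g z \<in> carrier Q" by (rule C[OF z]) (simp add: g two_lie_homD[OF p(1)])
    show "g (z \<oplus>\<^bsub>M\<^esub> w) = g z \<oplus>\<^bsub>Q\<^esub> g w"
      by (rule C[OF z], rule C[OF w])
        (simp add: g two_lie_homD[OF p(1)] flip: two_lie_homD(2-4)[OF f(1)])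
    show "g (bracket M z w) = bracket Q (g z) (g w)"
      by (rule C[OF z], rule C[OF w])
        (simp add: g two_lie_homD[OF p(1)] L.bracket_closed flip: two_lie_homD(2-4)[OF f(1)])
    show "g (sq M z) = sq Q (g z)"
      by (rule C[OF z])
        (simp add: g two_lie_homD[OF p(1)] L.sq_closed flip: two_lie_homD(2-4)[OF f(1)])
  qed
  moreover have "bij_betw g (carrier M) (carrier Q)"
  proof (rule bij_betw_imageI)
    show "inj_on g (carrier M)"
    proof (rule inj_onI)
      fix z w assume "z \<in> carrier M" "w \<in> carrier M" and gzw: "g z = g w"
      then obtain x y where "x \<in> carrier L" "z = f x" "y \<in> carrier L" "w = f y" using f(2) by blast
      then show "z = w" using gzw ker by (simp add: g)
    qed
    have "g ` carrier M = p ` carrier L" unfolding f(2)[symmetric] image_image using g by simp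
    then show "g ` carrier M = carrier Q" using p(2) by simp
  qed
  ultimately show ?thesis using M Q by (auto simp: two_lie_isomorphic_def)
qed

lemma (in two_lie_algebra) two_lie_quot_proj:
  assumes I: "restricted_ideal I L"
  shows "(\<lambda>x. I +> x) \<in> two_lie_hom L (two_lie_quot L I)" (is ?hom)
    and "(\<lambda>x. I +> x) ` carrier L = carrier (two_lie_quot L I)" (is ?surj)
    and "\<And>x y. x \<in> carrier L \<Longrightarrow> y \<in> carrier L \<Longrightarrow> I +> x = I +> y \<longleftrightarrow> x \<oplus> y \<in> I" (is "PROP ?eq")
proof -
  have subm: "submodule I F2 L" using I by (simp add: restricted_ideal_def)
  interpret abelian_subgroup I L
    by (rule abelian_subgroupI3)
      (simp_all add: additive_subgroup.intro submodule.axioms(1)[OF subm]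
        module.axioms(2)[OF two_lie_algebra.axioms(1)[OF two_lie_algebra_axioms]])
  let ?c = "\<lambda>x. I +> x"
  have Ib: "bracket L x y \<in> I" if "x \<in> carrier L" "y \<in> I" for x y
    using that I by (simp add: restricted_ideal_def)
  have Is: "sq L y \<in> I" if "y \<in> I" for y
    using that I by (simp add: restricted_ideal_def)
  have Ic: "y \<in> carrier L" if "y \<in> I" for y
    using that a_subset by blast
  have cancel: "x \<oplus> (x \<oplus> y) = y" if "x \<in> carrier L" "y \<in> carrier L" for x y
    using that by (simp add: a_assoc[symmetric] add_self)
  have mem: "x' \<in> ?c x \<longleftrightarrow> x' \<in> carrier L \<and> x' \<oplus> x \<in> I" if x: "x \<in> carrier L" for x x'
  proof
    assume "x' \<in> ?c x"
    then obtain i where i: "i \<in> I" "x' = i \<oplus> x" by (auto simp: a_r_coset_def')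
    then have "x' \<oplus> x = i" using x Ic by (simp add: a_assoc add_self)
    then show "x' \<in> carrier L \<and> x' \<oplus> x \<in> I" using i x Ic by simp
  next
    assume x': "x' \<in> carrier L \<and> x' \<oplus> x \<in> I"
    then have "x' = (x' \<oplus> x) \<oplus> x" using x by (simp add: a_assoc add_self)
    then show "x' \<in> ?c x" using x' by (auto simp: a_r_coset_def')
  qed
  have self: "x \<in> ?c x" if "x \<in> carrier L" for x
    using that by (simp add: mem add_self)
  show eq: "?c x = ?c y \<longleftrightarrow> x \<oplus> y \<in> I" if "x \<in> carrier L" "y \<in> carrier L" for x y
    using that self[of x] mem[of y x] a_repr_independence'[of x y] by auto
  have comm: "bracket L x y = bracket L y x" if xy: "x \<in> carrier L" "y \<in> carrier L" for x y
  proof -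
    have "bracket L (x \<oplus> y) (x \<oplus> y) =
        bracket L x (x \<oplus> y) \<oplus> bracket L y (x \<oplus> y)"
      using xy by (intro bracket_add_left) auto
    also have "\<dots> = bracket L x y \<oplus> bracket L y x"
      using xy by (simp add: bracket_add_right bracket_closed bracket_self)
    finally have "bracket L x y \<oplus> bracket L y x = \<zero>"
      using xy by (simp add: bracket_self)
    then show ?thesis
      using cancel[of "bracket L y x" "bracket L x y"] xy by (simp add: bracket_closed a_comm)
  qed
  have br: "bracket (two_lie_quot L I) (?c x) (?c y) = ?c (bracket L x y)"
    if x: "x \<in> carrier L" and y: "y \<in> carrier L" for x y
  proof -
    have "?c (bracket L x' y') = ?c (bracket L x y)" if x': "x' \<in> ?c x" and y': "y' \<in> ?c y" for x' y'
    proof -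
      note c = x y mem[OF x, THEN iffD1, OF x'] mem[OF y, THEN iffD1, OF y']
      have "bracket L x' y' \<oplus> bracket L x y =
          bracket L y' (x' \<oplus> x) \<oplus> bracket L x (y' \<oplus> y)"
        using c by (simp add: bracket_add_right comm[of y'] bracket_closed a_assoc cancel)
      also have "\<dots> \<in> I" by (rule a_closed[OF Ib Ib]) (use c in auto)
      finally show ?thesis using c by (simp add: eq bracket_closed)
    qed
    then have "(\<Union>x'\<in>?c x. \<Union>y'\<in>?c y. ?c (bracket L x' y')) = (\<Union>x'\<in>?c x. \<Union>y'\<in>?c y. ?c (bracket L x y))"
      by simp
    also have "\<dots> = ?c (bracket L x y)" using self[OF x] self[OF y] by auto
    finally show ?thesis by (simp add: two_lie_quot_def)
  qed
  have sq: "sq (two_lie_quot L I) (?c x) = ?c (sq L x)" if x: "x \<in> carrier L" for x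
  proof -
    have "?c (sq L x') = ?c (sq L x)" if x': "x' \<in> ?c x" for x'
    proof -
      note c = x mem[OF x, THEN iffD1, OF x']
      have "sq L x' \<oplus> sq L x = sq L (x' \<oplus> x) \<oplus> bracket L x (x' \<oplus> x)"
        using c comm[of x x']
        by (simp add: sq_add bracket_add_right bracket_self bracket_closed sq_closed a_assoc add_self)
      also have "\<dots> \<in> I" by (rule a_closed[OF Is Ib]) (use c in auto)
      finally show ?thesis using c by (simp add: eq sq_closed)
    qed
    then have "(\<Union>x'\<in>?c x. ?c (sq L x')) = (\<Union>x'\<in>?c x. ?c (sq L x))" by simp
    also have "\<dots> = ?c (sq L x)" using self[OF x] by auto
    finally show ?thesis by (simp add: two_lie_quot_def)
  qed
  show ?surj by (auto simp: two_lie_quot_def A_RCOSETS_def')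
  then have cl: "?c x \<in> carrier (two_lie_quot L I)" if "x \<in> carrier L" for x using that by blast
  show ?hom
    by (rule two_lie_homI[OF two_lie_algebra_axioms two_lie_algebra_quot[OF two_lie_algebra_axioms I]])
      (use cl br sq a_rcos_sum in \<open>simp_all add: two_lie_quot_def\<close>)
qed

lemma restricted_ideal_kernel:
  assumes L: "two_lie_algebra L" and M: "two_lie_algebra M" and f: "f \<in> two_lie_hom L M"
  shows "restricted_ideal {x \<in> carrier L. f x = \<zero>\<^bsub>M\<^esub>} L"
proof -
  interpret L: two_lie_algebra L by fact
  interpret M: two_lie_algebra M by fact
  note h = two_lie_homD[OF f] two_lie_hom_zero[OF L M f]
  have neg: "\<ominus>\<^bsub>L\<^esub> x = x" if "x \<in> carrier L" for x
    using that L.add_self L.minus_equality by blast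
  have b0: "bracket M x \<zero>\<^bsub>M\<^esub> = \<zero>\<^bsub>M\<^esub>" if "x \<in> carrier M" for x
    using M.bracket_add_right[of x "\<zero>\<^bsub>M\<^esub>" "\<zero>\<^bsub>M\<^esub>"] M.add_self[OF M.bracket_closed[of x "\<zero>\<^bsub>M\<^esub>"]] that
    by simp
  have "submodule {x \<in> carrier L. f x = \<zero>\<^bsub>M\<^esub>} F2 L"
    by (rule L.submoduleI) (auto simp: h neg carrier_F2 L.smult_0 L.smult_1)
  then show ?thesis
    by (auto simp: restricted_ideal_def h b0 M.sq_zero L.bracket_closed L.sq_closed)
qed

lemma restricted_ideal_gen_least:
  "restricted_ideal I L \<Longrightarrow> S \<subseteq> I \<Longrightarrow> restricted_ideal_gen L S \<subseteq> I"
  by (auto simp: restricted_ideal_gen_def)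

lemma lie_gen_closed: "v \<in> V \<Longrightarrow> lie_gen V v \<in> carrier (free_two_lie V)"
  unfolding lie_gen_def carrier_free_two_lie by (rule bexI[of _ "Var v"]) auto

lemma free_two_lie_induct [consumes 1, case_names gen zero add bracket sq]:
  assumes x: "x \<in> carrier (free_two_lie V)"
    and "\<And>v. v \<in> V \<Longrightarrow> P (lie_gen V v)" "P \<zero>\<^bsub>free_two_lie V\<^esub>"
    and "\<And>x y. \<lbrakk>x \<in> carrier (free_two_lie V); y \<in> carrier (free_two_lie V); P x; P y\<rbrakk> \<Longrightarrow>
      P (x \<oplus>\<^bsub>free_two_lie V\<^esub> y)"
    and "\<And>x y. \<lbrakk>x \<in> carrier (free_two_lie V); y \<in> carrier (free_two_lie V); P x; P y\<rbrakk> \<Longrightarrow>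
      P (bracket (free_two_lie V) x y)"
    and "\<And>x. x \<in> carrier (free_two_lie V) \<Longrightarrow> P x \<Longrightarrow> P (sq (free_two_lie V) x)"
  shows "P x"
proof -
  have E: "lie_rel V `` {s} \<in> carrier (free_two_lie V)" if "s \<in> lie_terms V" for s
    using that carrier_free_two_lie by blast
  have "P (lie_rel V `` {s})" if "s \<in> lie_terms V" for s
    using that
  proof (induction s)
    case (Var v)
    then show ?case using assms(2)[of v] by (simp add: lie_gen_def)
  next
    case Zero
    then show ?case using assms(3) by (simp add: zero_free_two_lie)
  next
    case (Add s t)
    then show ?case using assms(4)[OF E[of s] E[of t]] by (simp add: free_two_lie_ops)
  next
    case (Brk s t)
    then show ?case using assms(5)[OF E[of s] E[of t]] by (simp add: free_two_lie_ops)
  next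
    case (Sqr s)
    then show ?case using assms(6)[OF E[of s]] free_two_lie_ops(3)[of s V s] by simp
  qed
  then show ?thesis using x carrier_free_two_lie by metis
qed

lemma countable_free_two_lie: "countable (carrier (free_two_lie (V :: 'v::countable set)))"
proof -
  have "carrier (free_two_lie V) = (\<lambda>s. lie_rel V `` {s}) ` lie_terms V"
    using carrier_free_two_lie by blast
  then show ?thesis by simp
qed

lemma racg_lie_relators_cases:
  assumes "x \<in> racg_lie_relators m K"
  obtains i where "i \<in> {1..m}" "x = sq (free_two_lie {1..m}) (lie_gen {1..m} i)"
    | i j where "{i, j} \<in> K" "x = bracket (free_two_lie {1..m}) (lie_gen {1..m} i) (lie_gen {1..m} j)"
  using assms unfolding racg_lie_relators_def Let_def by blast

section \<open>The main theorem\<close>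

theorem theorem6p4:
  fixes m :: nat and K :: "nat set set"
  assumes "simplicial_complex m K"
  shows "two_lie_isomorphic
           (gr_two_lie (racg m K))
           (two_lie_quot (free_two_lie {1..m})
              (restricted_ideal_gen (free_two_lie {1..m}) (racg_lie_relators m K)))"
proof -
  \<comment> \<open>Degree one has to stay \<open>1\<close>; rewritten to \<open>Suc 0\<close> it
    would no longer match the facts about \<open>N2 ?G 1\<close> and \<open>h 1\<close>.\<close>
  note One_nat_def [simp del]
  let ?G = "racg m K" and ?F = "free_two_lie {1..m}" and ?S = "racg_lie_relators m K"
  let ?M = "gr_two_lie ?G" and ?I = "restricted_ideal_gen ?F ?S"
  let ?Q = "two_lie_quot ?F ?I"
  interpret G: group ?G by (rule group_racg[OF assms])
  interpret gr: graded_two_lie "gr_comp ?G" "gr_bracket_hom ?G" "gr_sq_hom ?G"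
    by (rule G.graded_two_lie_gr)
  interpret F: two_lie_algebra ?F by (rule two_lie_algebra_free)
  have M: "two_lie_algebra ?M" unfolding G.gr_two_lie_eq by (rule gr.two_lie_algebra_L)
  interpret M: two_lie_algebra ?M by (rule M)
  have u: "lie_gen {1..m} i \<in> carrier ?F" if "i \<in> {1..m}" for i using that by (rule lie_gen_closed)
  have edge: "i \<in> {1..m} \<and> j \<in> {1..m}" if "{i, j} \<in> K" for i j
    using edge[OF assms that] .
  have S: "?S \<subseteq> carrier ?F"
  proof
    fix x assume "x \<in> ?S"
    then show "x \<in> carrier ?F"
      by (cases rule: racg_lie_relators_cases)
        (use u edge in \<open>simp_all add: F.sq_closed F.bracket_closed\<close>)
  qed
  have I: "restricted_ideal ?I ?F"
    by (rule restricted_ideal_restricted_ideal_gen[OF two_lie_algebra_free S])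
  have SI: "?S \<subseteq> ?I" by (auto simp: restricted_ideal_gen_def)
  have Q: "two_lie_algebra ?Q" by (rule two_lie_algebra_quot[OF two_lie_algebra_free I])
  interpret Q: two_lie_algebra ?Q by (rule Q)
  let ?p = "\<lambda>x. ?I +>\<^bsub>?F\<^esub> x"
  note p = F.two_lie_quot_proj[OF I]
  note ph = two_lie_homD[OF p(1)]
  have p0: "?p x = \<zero>\<^bsub>?Q\<^esub>" if "x \<in> ?S" for x
  proof -
    have x: "x \<in> carrier ?F" "x \<in> ?I" using that S SI by blast+
    then have "?p x = ?p \<zero>\<^bsub>?F\<^esub>" by (simp only: p(3)[OF _ F.zero_closed] F.r_zero)
    then show ?thesis using two_lie_hom_zero[OF two_lie_algebra_free Q p(1)] by simp
  qed
  have rel: "sq ?F (lie_gen {1..m} i) \<in> ?S" if "i \<in> {1..m}" for i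
    using that by (auto simp: racg_lie_relators_def Let_def)
  have rel': "bracket ?F (lie_gen {1..m} i) (lie_gen {1..m} j) \<in> ?S" if "{i, j} \<in> K" for i j
    using that by (auto simp: racg_lie_relators_def Let_def)

  \<comment> \<open>Terms over \<open>nat\<close> are countable, so every quotient of the free
    algebra is, and \<open>faithful_representation\<close> applies.\<close>
  have "countable (carrier ?Q)"
    unfolding p(2)[symmetric] by (intro countable_image countable_free_two_lie)
  then obtain j :: "_ \<Rightarrow> endo" where j: "inj_on j (carrier ?Q)"
    and jh: "\<And>x y. x \<in> carrier ?Q \<Longrightarrow> y \<in> carrier ?Q \<Longrightarrow> j (x \<oplus>\<^bsub>?Q\<^esub> y) = j x + j y"
      "\<And>x y. x \<in> carrier ?Q \<Longrightarrow> y \<in> carrier ?Q \<Longrightarrow> j (bracket ?Q x y) = j x * j y + j y * j x"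
      "\<And>x. x \<in> carrier ?Q \<Longrightarrow> j (sq ?Q x) = j x * j x"
    using Q.faithful_representation by blast
  have j0: "j \<zero>\<^bsub>?Q\<^esub> = 0" using jh(1)[of "\<zero>\<^bsub>?Q\<^esub>" "\<zero>\<^bsub>?Q\<^esub>"] by simp
  \<comment> \<open>The relators vanish in \<open>?Q\<close>, so these elements square to zero and
    commute along edges: precisely what \<open>ex_unipotent_rep\<close> asks for.\<close>
  define r where "r i = j (?p (lie_gen {1..m} i))" for i
  have r_sq: "r i * r i = 0" if "i \<in> {1..m}" for i
    using jh(3)[OF ph(1)[OF u[OF that]]] ph(4)[OF u[OF that]] p0[OF rel[OF that]] j0 by (simp add: r_def)
  have r_comm: "r i * r k = r k * r i" if "{i, k} \<in> K" for i k
  proof -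
    have c: "lie_gen {1..m} i \<in> carrier ?F" "lie_gen {1..m} k \<in> carrier ?F" using edge[OF that] u by auto
    have "r i * r k + r k * r i = 0"
      using jh(2)[OF ph(1)[OF c(1)] ph(1)[OF c(2)]] ph(3)[OF c] p0[OF rel'[OF that]] j0
      by (simp add: r_def)
    then show ?thesis by (simp add: char_two_eq_iff)
  qed
  obtain \<Phi> where \<Phi>: "unipotent_rep ?G \<Phi>" "\<And>i. i \<in> {1..m} \<Longrightarrow> \<Phi> (racg_gen m K i) $ 1 = r i"
    using ex_unipotent_rep[OF assms, of r] r_sq r_comm by blast
  obtain c where ch: "\<And>x y. x \<in> carrier ?M \<Longrightarrow> y \<in> carrier ?M \<Longrightarrow> c (x \<oplus>\<^bsub>?M\<^esub> y) = c x + c y"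
      "\<And>x y. x \<in> carrier ?M \<Longrightarrow> y \<in> carrier ?M \<Longrightarrow> c (bracket ?M x y) = c x * c y + c y * c x"
      "\<And>x. x \<in> carrier ?M \<Longrightarrow> c (sq ?M x) = c x * c x"
      "\<And>x. x \<in> carrier ?G \<Longrightarrow> c (hom_elem (gr_comp ?G) 1 (cl ?G 1 x)) = \<Phi> x $ 1"
    using unipotent_rep.ex_total[OF \<Phi>(1)] by blast
  have c0: "c \<zero>\<^bsub>?M\<^esub> = 0" using ch(1)[of "\<zero>\<^bsub>?M\<^esub>" "\<zero>\<^bsub>?M\<^esub>"] by simp

  \<comment> \<open>The degree \<open>k\<close> class of a group element as an element of the direct
    sum. On such elements the operations are group products, commutators and squares.\<close>
  define h where "h k g = hom_elem (gr_comp ?G) k (cl ?G k g)" for k g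
  have h_closed: "h k g \<in> carrier ?M" if "N2 ?G k g" for k g
  proof -
    have k: "1 \<le> k" using that by (rule G.N2_pos)
    show ?thesis
      unfolding h_def G.gr_two_lie_eq
      by (rule gr.hom_elem_closed[OF k]) (use that in \<open>simp add: G.gr_comp_carrier[OF k]\<close>)
  qed
  have h_mult: "h k (g \<otimes>\<^bsub>?G\<^esub> g') = h k g \<oplus>\<^bsub>?M\<^esub> h k g'"
    if "N2 ?G k g" "N2 ?G k g'" for k g g'
  proof -
    have k: "1 \<le> k" using that(1) by (rule G.N2_pos)
    have "cl ?G k (g \<otimes>\<^bsub>?G\<^esub> g') = cl ?G k g \<otimes>\<^bsub>gr_comp ?G k\<^esub> cl ?G k g'"
      using that G.N2_closed by (simp add: G.gr_comp_eq[OF k] G.cl_mult)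
    then show ?thesis
      unfolding h_def G.gr_two_lie_eq
      by (simp only:) (rule gr.hom_elem_mult[OF k], use that in \<open>simp_all add: G.gr_comp_carrier[OF k]\<close>)
  qed
  have h_one: "h k g = \<zero>\<^bsub>?M\<^esub>" if "N2 ?G (Suc k) g" "1 \<le> k" for k g
    unfolding h_def G.gr_two_lie_eq G.cl_one[OF that(1)]
    using gr.hom_elem_one[of k] by (simp add: G.gr_comp_eq[OF that(2)])
  have h_bracket: "bracket ?M (h k g) (h l g') = h (k + l) (grp_comm ?G g g')"
    if "N2 ?G k g" "N2 ?G l g'" for k l g g'
  proof -
    have k: "1 \<le> k" "1 \<le> l" using that G.N2_pos by auto
    show ?thesis
      unfolding h_def G.gr_two_lie_eq G.gr_bracket_hom_cl[OF that, symmetric]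
      by (rule gr.bracket_hom[OF k]) (use that in \<open>simp_all add: G.gr_comp_carrier[OF k(1)] G.gr_comp_carrier[OF k(2)]\<close>)
  qed
  have h_sq: "sq ?M (h k g) = h (2 * k) (g \<otimes>\<^bsub>?G\<^esub> g)" if "N2 ?G k g" for k g
  proof -
    have k: "1 \<le> k" using that by (rule G.N2_pos)
    show ?thesis
      unfolding h_def G.gr_two_lie_eq G.gr_sq_hom_cl[OF that, symmetric]
      by (rule gr.sq_hom[OF k]) (use that in \<open>simp add: G.gr_comp_carrier[OF k]\<close>)
  qed
  have g1: "N2 ?G 1 (racg_gen m K i)" if "i \<in> {1..m}" for i
    using racg_gen_closed[OF assms that] by (rule N2.carrier)

  have "(\<lambda>i. h 1 (racg_gen m K i)) \<in> {1..m} \<rightarrow> carrier ?M" using h_closed g1 by blast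
  from free_two_lie_universal[OF M this] obtain f where f: "f \<in> two_lie_hom ?F ?M"
      and fu: "\<And>i. i \<in> {1..m} \<Longrightarrow> f (lie_gen {1..m} i) = h 1 (racg_gen m K i)"
    by blast
  note fh = two_lie_homD[OF f]
  have f0: "f \<zero>\<^bsub>?F\<^esub> = \<zero>\<^bsub>?M\<^esub>" by (rule two_lie_hom_zero[OF two_lie_algebra_free M f])

  \<comment> \<open>Both sides are additive and turn brackets into commutators and \<open>sq\<close>
    into squares, so agreement on the generators, where both equal \<open>r i\<close>, is
    enough.\<close>
  have cf: "c (f x) = j (?p x)" if "x \<in> carrier ?F" for x
    using that
  proof (induction x rule: free_two_lie_induct)
    case (gen i)
    then show ?case
      using ch(4)[OF racg_gen_closed[OF assms gen]] \<Phi>(2)[OF gen] fu[OF gen] by (simp add: h_def r_def)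
  next
    case zero
    then show ?case using f0 c0 j0 two_lie_hom_zero[OF two_lie_algebra_free Q p(1)] by simp
  next
    case (add x y)
    then show ?case by (simp add: fh ph ch jh)
  next
    case (bracket x y)
    then show ?case by (simp add: fh ph ch jh)
  next
    case (sq x)
    then show ?case by (simp add: fh ph ch jh)
  qed

  have "?S \<subseteq> {x \<in> carrier ?F. f x = \<zero>\<^bsub>?M\<^esub>}"
  proof
    fix x assume x: "x \<in> ?S"
    then have "f x = \<zero>\<^bsub>?M\<^esub>"
    proof (cases rule: racg_lie_relators_cases)
      case 1
      have "f x = h (2 * 1) \<one>\<^bsub>?G\<^esub>"
        using 1 fh(4)[OF u] fu h_sq[OF g1] racg_gen_square[OF assms] by simp
      then show ?thesis using h_one[OF N2.one, of "2 * 1"] by simp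
    next
      case (2 i k)
      have ik: "i \<in> {1..m}" "k \<in> {1..m}" using edge[OF 2(1)] by auto
      note gc = racg_gen_closed[OF assms ik(1)] racg_gen_closed[OF assms ik(2)]
      have "grp_comm ?G (racg_gen m K i) (racg_gen m K k) = \<one>\<^bsub>?G\<^esub>"
        using gc racg_gen_commute[OF assms 2(1)] by (simp add: grp_comm_def G.m_assoc)
      then have "f x = h (1 + 1) \<one>\<^bsub>?G\<^esub>"
        using 2 fh(3)[OF u u] ik fu h_bracket[OF g1 g1] by simp
      then show ?thesis using h_one[OF N2.one, of "1 + 1"] by simp
    qed
    then show "x \<in> {x \<in> carrier ?F. f x = \<zero>\<^bsub>?M\<^esub>}" using x S by blast
  qed
  then have If: "?I \<subseteq> {x \<in> carrier ?F. f x = \<zero>\<^bsub>?M\<^esub>}"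
    by (rule restricted_ideal_gen_least[OF restricted_ideal_kernel[OF two_lie_algebra_free M f]])

  \<comment> \<open>From left to right this is the injectivity of the epimorphism: \<open>c\<close>
    recovers \<open>j (?p x)\<close> from \<open>f x\<close>, and \<open>j\<close> is injective. The
    converse is \<open>If\<close>.\<close>
  have ker: "f x = f y \<longleftrightarrow> ?p x = ?p y" if x: "x \<in> carrier ?F" and y: "y \<in> carrier ?F" for x y
  proof
    assume "f x = f y"
    then have "j (?p x) = j (?p y)" using cf x y by metis
    then show "?p x = ?p y" using j ph(1)[OF x] ph(1)[OF y] by (simp add: inj_on_def)
  next
    assume "?p x = ?p y"
    then have "f x \<oplus>\<^bsub>?M\<^esub> f y = \<zero>\<^bsub>?M\<^esub>" using p(3)[OF x y] If fh(2)[OF x y] by auto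
    then have "f x \<oplus>\<^bsub>?M\<^esub> f y = f y \<oplus>\<^bsub>?M\<^esub> f y" using M.add_self[OF fh(1)[OF y]] by simp
    then show "f x = f y" using fh(1)[OF x] fh(1)[OF y] M.add.right_cancel by blast
  qed

  have im_add: "x \<oplus>\<^bsub>?M\<^esub> y \<in> f ` carrier ?F" if "x \<in> f ` carrier ?F" "y \<in> f ` carrier ?F" for x y
  proof -
    from that obtain a b where "a \<in> carrier ?F" "b \<in> carrier ?F" "x = f a" "y = f b" by blast
    then show ?thesis by (intro image_eqI[of _ _ "a \<oplus>\<^bsub>?F\<^esub> b"]) (simp_all add: fh F.a_closed)
  qed
  have im_bracket: "bracket ?M x y \<in> f ` carrier ?F" if "x \<in> f ` carrier ?F" "y \<in> f ` carrier ?F" for x y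
  proof -
    from that obtain a b where "a \<in> carrier ?F" "b \<in> carrier ?F" "x = f a" "y = f b" by blast
    then show ?thesis by (intro image_eqI[of _ _ "bracket ?F a b"]) (simp_all add: fh F.bracket_closed)
  qed
  have im_sq: "sq ?M x \<in> f ` carrier ?F" if "x \<in> f ` carrier ?F" for x
  proof -
    from that obtain a where "a \<in> carrier ?F" "x = f a" by blast
    then show ?thesis by (intro image_eqI[of _ _ "sq ?F a"]) (simp_all add: fh F.sq_closed)
  qed
  have im_zero: "\<zero>\<^bsub>?M\<^esub> \<in> f ` carrier ?F" by (rule image_eqI[of _ _ "\<zero>\<^bsub>?F\<^esub>"]) (simp_all add: f0)
  have h_inv: "h k (inv\<^bsub>?G\<^esub> x) = h k x" if "N2 ?G k x" for k x
    by (simp add: h_def G.cl_inv[OF that])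
  \<comment> \<open>In degree one \<open>h\<close> is additive on the whole group, so the generators
    of the Coxeter group suffice.\<close>
  have im1: "h 1 g \<in> f ` carrier ?F" if "g \<in> carrier ?G" for g
  proof -
    have t1: "N2 ?G 1 x" if "x \<in> carrier ?G" for x using that by (rule N2.carrier)
    have "subgroup {g \<in> carrier ?G. h 1 g \<in> f ` carrier ?F} ?G"
    proof (rule G.subgroupI)
      have "\<one>\<^bsub>?G\<^esub> \<in> {g \<in> carrier ?G. h 1 g \<in> f ` carrier ?F}"
        using h_one[OF N2.one, of 1] im_zero by simp
      then show "{g \<in> carrier ?G. h 1 g \<in> f ` carrier ?F} \<noteq> {}" by blast
    qed (use im_add h_mult[OF t1 t1] h_inv[OF t1] in auto)
    then have "generate ?G (racg_gen m K ` {1..m}) \<subseteq> {g \<in> carrier ?G. h 1 g \<in> f ` carrier ?F}"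
      by (rule G.generate_le)
        (use racg_gen_closed[OF assms] fu[symmetric] u in blast)
    then show ?thesis using that unfolding racg_generate[OF assms] by blast
  qed
  \<comment> \<open>Generation in degree one: each rule of \<open>N2\<close> corresponds to an
    operation of the 2-Lie algebra, except that \<open>one\<close> and \<open>weaken\<close> give
    the zero class and \<open>inv\<close> leaves the class unchanged.\<close>
  have im: "h k g \<in> f ` carrier ?F" if "N2 ?G k g" for k g
    using that
  proof (induction rule: N2.induct)
    case (carrier x)
    then show ?case by (rule im1)
  next
    case (weaken k x)
    then show ?case using h_one im_zero by simp
  next
    case (one k)
    then show ?case using h_one[OF N2.one, of k] im_zero by simp
  next
    case (mult k x y)
    then show ?case using h_mult im_add by simp
  next
    case (inv k x)
    then show ?case using h_inv by simp
  next
    case (comm a x b y)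
    then show ?case using h_bracket im_bracket by (simp flip: h_bracket)
  next
    case (square a x)
    then show ?case using im_sq by (simp flip: h_sq)
  qed
  have fsurj: "f ` carrier ?F = carrier ?M"
  proof
    show "f ` carrier ?F \<subseteq> carrier ?M" using fh(1) by blast
    show "carrier ?M \<subseteq> f ` carrier ?F"
    proof
      fix x assume "x \<in> carrier ?M"
      then have "x \<in> carrier gr.L" by (simp add: G.gr_two_lie_eq)
      then show "x \<in> f ` carrier ?F"
      proof (induction x rule: gr.L_induct)
        case zero
        then show ?case using im_zero by (simp add: G.gr_two_lie_eq)
      next
        case (hom k X)
        then obtain g where "N2 ?G k g" "X = cl ?G k g" by (auto simp: G.gr_comp_carrier)
        then show ?case using im[of k g] by (simp add: h_def)
      next
        case (add x y)
        then show ?case using im_add by (simp add: G.gr_two_lie_eq)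
      qed
    qed
  qed
  show ?thesis
    by (rule two_lie_isomorphicI[OF two_lie_algebra_free M Q f fsurj p(1,2) ker])
qed

end
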